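(* Suppose Assumptions A and B hold and that $\mathbb{E}[|\varphi(Y,Z)|^{2+\delta}]<\infty$ for some $\delta>0$. Let $\gamma_n=\gamma_1n^{-\beta}$, $n\ge1$, with $\gamma_1>0$ and $\beta\in(\frac12,1)$. Then, as $\mathcal H\ni h\downarrow0$, $$h^{-1}\begin{pmatrix}\overline\xi^h_{\lceil h^{-2}\rceil}-\xi^h_\star\\ \chi^h_{\lceil h^{-2}\rceil}-\chi^h_\star\end{pmatrix}\xrightarrow{\ \mathcal L\ }\mathcal N(0,\overline\Sigma),\qquad \overline\Sigma=\begin{pmatrix}\dfrac{\alpha(1-\alpha)}{f_{X_0}(\xi^0_\star)^2} & \dfrac{\alpha}{1-\alpha}\dfrac{\mathbb E[(X_0-\xi^0_\star)^+]}{f_{X_0}(\xi^0_\star)}\\[2mm] \dfrac{\alpha}{1-\alpha}\dfrac{\mathbb E[(X_0-\xi^0_\star)^+]}{f_{X_0}(\xi^0_\star)} & \dfrac{\mathrm{Var}((X_0-\xi^0_\star)^+)}{(1-\alpha)^2}\end{pmatrix}.$$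
   Context: Fix $\alpha\in(0,1)$. Let $Y$ ($\mathbb R^d$-valued) and $Z$ ($\mathbb R^q$-valued) be independent random variables and $\varphi:\mathbb R^d\times\mathbb R^q\to\mathbb R$ measurable with $\varphi(Y,Z)\in L^1$. Set $X_0=\mathbb E[\varphi(Y,Z)\mid Y]$ and $\mathcal H=\{1/K:K\in\mathbb N,K\ge1\}$. For $h=1/K\in\mathcal H$, $X_h=\frac1K\sum_{k=1}^K\varphi(Y,Z^{(k)})$, where $Z^{(1)},\dots,Z^{(K)}$ are i.i.d. copies of $Z$ independent of $Y$. For $h\in\mathcal H\cup\{0\}$, $F_{X_h}$ denotes the cdf and $f_{X_h}$ the pdf of $X_h$, and $V_h(\xi)=\xi+\frac1{1-\alpha}\mathbb E[(X_h-\xi)^+]$, so that $V_h''=f_{X_h}/(1-\alpha)$; under Assumption A, $V_h$ has a unique minimizer $\xi^h_\star$, and $\chi^h_\star:=V_h(\xi^h_\star)=\min V_h$. Let $H_1(\xi,x)=1-\frac1{1-\alpha}\mathbf 1_{x\ge\xi}$ and $H_2(\xi,\chi,x)=\chi-\xi-\frac1{1-\alpha}(x-\xi)^+$. NSA scheme: given positive steps $(\gamma_n)_{n\ge1}$ and $h\in\mathcal H$, let $(X_h^{(n)})_{n\ge1}$ be i.i.d. copies of $X_h$, $\xi^h_0$ a real random variable independent of them, $\chi^h_0=0$, and for $n\ge0$: $\xi^h_{n+1}=\xi^h_n-\gamma_{n+1}H_1(\xi^h_n,X_h^{(n+1)})$, $\chi^h_{n+1}=\chi^h_n-\frac1{n+1}H_2(\xi^h_n,\chi^h_n,X_h^{(n+1)})$.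 The averaged VaR iterate is $\overline\xi^h_n=\frac1n\sum_{k=1}^n\xi^h_k$, $n\ge1$. Assumption A: (i) for each $h\in\mathcal H$, $F_{X_h}(\xi)-F_{X_0}(\xi)=v(\xi)h+w(\xi,h)h$ for all $\xi\in\mathbb R$, for functions $v,w(\cdot,h):\mathbb R\to\mathbb R$ with $\int_{\xi^0_\star}^\infty v(\xi)d\xi<\infty$ and $\lim_{\mathcal H\ni h\downarrow0}w(\xi^0_\star,h)=\lim_{\mathcal H\ni h\downarrow0}\int_{\xi^0_\star}^\infty w(\xi,h)d\xi=0$ for any minimizer $\xi^0_\star$ of $V_0$; (ii) for each $h\in\mathcal H\cup\{0\}$, $X_h$ has a continuous pdf $f_{X_h}$, and $f_{X_h}\to f_{X_0}$ locally uniformly as $\mathcal H\ni h\downarrow0$; (iii) for every $R>0$, $\inf_{h\in\mathcal H\cup\{0\},\,\xi\in B(\xi^0_\star,R)}f_{X_h}(\xi)>0$; (iv) $\sup_{h\in\mathcal H\cup\{0\}}(\|f_{X_h}\|_\infty+[f_{X_h}]_{\rm Lip})<\infty$, where $[\cdot]_{\rm Lip}$ is the Lipschitz constant. Assumption B: with $c_\alpha=1\vee\frac{\alpha}{1-\alpha}$, $\sup_{h\in\mathcal H}\mathbb E\big[|\xi^h_0|^2\exp\big(\frac{4}{1-\alpha}c_\alpha\sup_{h'\in\mathcal H}\|f_{X_{h'}}\|_\infty|\xi^h_0|\big)\big]<\infty$. *)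

theory Defs
  imports "HOL-Probability.Probability"
begin

text \<open>Independence of two random variables with possibly different value types
  (same as prob_space.indep_var, which requires equal value types).\<close>
definition indep_var2 :: "'m measure \<Rightarrow> 'a measure \<Rightarrow> ('m \<Rightarrow> 'a) \<Rightarrow> 'b measure \<Rightarrow> ('m \<Rightarrow> 'b) \<Rightarrow> bool" where
  "indep_var2 M Ma A Mb B \<longleftrightarrow>
     A \<in> measurable M Ma \<and> B \<in> measurable M Mb \<and>
     prob_space.indep_set M
       (sigma_sets (space M) {A -` S \<inter> space M | S. S \<in> sets Ma})
       (sigma_sets (space M) {B -` S \<inter> space M | S. S \<in> sets Mb})"

text \<open>Nested inner simulation: X_h with h = 1/K, K >= 1 (copies Zs 0, ..., Zs (K-1)).\<close>
definition Xinner :: "('a \<Rightarrow> 'b \<Rightarrow> real) \<Rightarrow> ('m \<Rightarrow> 'a) \<Rightarrow> (nat \<Rightarrow> 'm \<Rightarrow> 'b) \<Rightarrow> nat \<Rightarrow> 'm \<Rightarrow> real" where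
  "Xinner \<phi> Y Zs K \<omega> = (\<Sum>k<K. \<phi> (Y \<omega>) (Zs k \<omega>)) / real K"

definition Vfun :: "'m measure \<Rightarrow> real \<Rightarrow> ('m \<Rightarrow> real) \<Rightarrow> real \<Rightarrow> real" where
  "Vfun M \<alpha> X \<xi> = \<xi> + (\<integral>\<omega>. max 0 (X \<omega> - \<xi>) \<partial>M) / (1 - \<alpha>)"

text \<open>The (unique, under Assumption A) minimizer of V, and the minimum value.\<close>
definition xi_star :: "'m measure \<Rightarrow> real \<Rightarrow> ('m \<Rightarrow> real) \<Rightarrow> real" where
  "xi_star M \<alpha> X = (THE \<xi>. \<forall>\<eta>. Vfun M \<alpha> X \<xi> \<le> Vfun M \<alpha> X \<eta>)"

definition chi_star :: "'m measure \<Rightarrow> real \<Rightarrow> ('m \<Rightarrow> real) \<Rightarrow> real" where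
  "chi_star M \<alpha> X = Vfun M \<alpha> X (xi_star M \<alpha> X)"

definition H1 :: "real \<Rightarrow> real \<Rightarrow> real \<Rightarrow> real" where
  "H1 \<alpha> \<xi> x = 1 - (if x \<ge> \<xi> then 1 else 0) / (1 - \<alpha>)"

definition H2 :: "real \<Rightarrow> real \<Rightarrow> real \<Rightarrow> real \<Rightarrow> real" where
  "H2 \<alpha> \<xi> ch x = ch - \<xi> - max 0 (x - \<xi>) / (1 - \<alpha>)"

text \<open>NSA scheme, pathwise. xs n plays the role of X_h^{(n+1)}.\<close>
fun nsa_xi :: "real \<Rightarrow> (nat \<Rightarrow> real) \<Rightarrow> real \<Rightarrow> (nat \<Rightarrow> real) \<Rightarrow> nat \<Rightarrow> real" where
  "nsa_xi \<alpha> \<gamma> x0 xs 0 = x0"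
| "nsa_xi \<alpha> \<gamma> x0 xs (Suc n) =
     nsa_xi \<alpha> \<gamma> x0 xs n - \<gamma> (Suc n) * H1 \<alpha> (nsa_xi \<alpha> \<gamma> x0 xs n) (xs n)"

fun nsa_chi :: "real \<Rightarrow> (nat \<Rightarrow> real) \<Rightarrow> real \<Rightarrow> (nat \<Rightarrow> real) \<Rightarrow> nat \<Rightarrow> real" where
  "nsa_chi \<alpha> \<gamma> x0 xs 0 = 0"
| "nsa_chi \<alpha> \<gamma> x0 xs (Suc n) =
     nsa_chi \<alpha> \<gamma> x0 xs n - (1 / real (Suc n)) *
       H2 \<alpha> (nsa_xi \<alpha> \<gamma> x0 xs n) (nsa_chi \<alpha> \<gamma> x0 xs n) (xs n)"

definition nsa_xibar :: "real \<Rightarrow> (nat \<Rightarrow> real) \<Rightarrow> real \<Rightarrow> (nat \<Rightarrow> real) \<Rightarrow> nat \<Rightarrow> real" where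
  "nsa_xibar \<alpha> \<gamma> x0 xs n = (\<Sum>k=1..n. nsa_xi \<alpha> \<gamma> x0 xs k) / real n"

text \<open>Centered bivariate Gaussian with covariance [[s11,s12],[s12,s22]], as the law of
  L G where G is a standard normal pair and L is the Cholesky factor.\<close>
definition std_normal :: "real measure" where
  "std_normal = density lborel std_normal_density"

definition gauss2 :: "real \<Rightarrow> real \<Rightarrow> real \<Rightarrow> (real \<times> real) measure" where
  "gauss2 s11 s12 s22 =
     (let a = sqrt s11; b = s12 / a; c = sqrt (s22 - b\<^sup>2)
      in distr (std_normal \<Otimes>\<^sub>M std_normal) borel (\<lambda>(g1, g2). (a * g1, b * g1 + c * g2)))"

definition conv_law :: "(nat \<Rightarrow> 'a::metric_space measure) \<Rightarrow> 'a measure \<Rightarrow> bool" where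
  "conv_law \<mu> \<nu> \<longleftrightarrow>
     (\<forall>g :: 'a \<Rightarrow> real. continuous_on UNIV g \<and> bounded (range g) \<longrightarrow>
        (\<lambda>n. \<integral>x. g x \<partial>\<mu> n) \<longlonglongrightarrow> (\<integral>x. g x \<partial>\<nu>))"

end

theory Submission
  imports Defs
begin

text \<open>
  Write \<open>D\<^sub>n\<close> for the distance of the \<open>n\<close>-th quantile iterate to the quantile. Since the derivative of \<open>V\<close>
  is bounded, \<open>D\<^sub>n\<^sup>2\<close> is not a Lyapunov function, but \<open>cosh (\<lambda> D\<^sub>n) - 1\<close> is: its
  expectation satisfies \<open>L\<^sub>n\<^sub>+\<^sub>1 \<le> (1 - c \<gamma> + C \<gamma>\<^sup>2) L\<^sub>n + C \<gamma>\<^sup>2\<close> with \<open>\<gamma> = \<gamma>\<^sub>n\<^sub>+\<^sub>1\<close> and constants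
  uniform in the bias parameter \<open>K\<close>, whence \<open>E D\<^sub>n\<^sup>2 = O(n powr -\<beta>)\<close> uniformly in \<open>K\<close>; the exponential moment of
  the initial value is needed only for \<open>L\<^sub>0\<close>. Linearizing \<open>V'\<close> at the quantile and summing by parts,
  and replacing the martingale increments at the current iterate by those at the quantile, changes the
  normalized error only by a term tending to \<open>0\<close> in \<open>L\<^sup>1\<close> because \<open>\<beta> > 1/2\<close>. What remains is a normalized sum of
  \<open>K\<^sup>2\<close> i.i.d. variables, to which Lyapunov's central limit theorem applies; the limit covariance comes from
  the convergence of the densities together with a uniform moment of order greater than \<open>2\<close>.
\<close>

section \<open>Levy continuity in the plane\<close>

text \<open>A bounded drift lowers the square of a large distance only by an amount linear in the
  distance, which is no contraction of second moments. The derivative of \<open>cosh\<close> grows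
  like \<open>cosh\<close> itself, so there a bounded drift does contract, and near 0 the function
  is still quadratic. Its rate \<open>lam\<close> is the exponent of Assumption B, which bounds the
  initial value uniformly in \<open>K\<close>. Every \<open>K\<close> has its own law, quantile and
  scheme, so no constant may depend on \<open>K\<close>: the recursion lemma fixes \<open>A\<close>
  before the sequence, and the rates \<open>\<rho>1\<close>, \<open>\<rho>2\<close> mention common
  bounds only. With \<open>N = K\<^sup>2\<close> samples the remainders have orders
  \<open>N powr (\<beta> / 2)\<close>, \<open>N powr (1 / 2 - \<beta> / 4)\<close>,
  \<open>N powr (1 / 2 - \<beta> / 2)\<close> and \<open>N powr (1 - \<beta>)\<close> and must be
  small against \<open>sqrt N\<close>; the first asks for \<beta> < 1, the last for \<beta> > 1/2.
  Weak convergence in the plane is obtained from characteristic functions through trigonometric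
  polynomials, with one-dimensional Levy continuity supplying tightness. Moments of the limit
  variable come from Fatou's lemma along the densities.\<close>

inductive trig_poly :: "(real \<times> real \<Rightarrow> real) \<Rightarrow> bool" where
  cos: "trig_poly (\<lambda>p. a * cos (s * fst p + t * snd p + c))"
| add: "trig_poly P \<Longrightarrow> trig_poly Q \<Longrightarrow> trig_poly (\<lambda>p. P p + Q p)"

lemma trig_poly_const: "trig_poly (\<lambda>p. a)"
  using trig_poly.cos[of a 0 0 0] by simp

text \<open>The product-to-sum formula turns a product of two cosines into a sum of two. The phase
  in the constructor \<open>cos\<close> covers sines as well, so one kind of generator is enough for
  an algebra.\<close>

lemma trig_poly_cos_mult:
  assumes "trig_poly Q"
  shows "trig_poly (\<lambda>p. a * cos (s * fst p + t * snd p + c) * Q p)"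
  using assms
proof induction
  case (cos a' s' t' c')
  have "(\<lambda>p. a * cos (s * fst p + t * snd p + c) * (a' * cos (s' * fst p + t' * snd p + c'))) =
     (\<lambda>p. (a * a' / 2) * cos ((s - s') * fst p + (t - t') * snd p + (c - c')) +
          (a * a' / 2) * cos ((s + s') * fst p + (t + t') * snd p + (c + c')))"
  proof
    fix p :: "real \<times> real"
    let ?u = "s * fst p + t * snd p + c" and ?v = "s' * fst p + t' * snd p + c'"
    have 1: "(s - s') * fst p + (t - t') * snd p + (c - c') = ?u - ?v"
      "(s + s') * fst p + (t + t') * snd p + (c + c') = ?u + ?v"
      by (simp_all add: algebra_simps)
    show "a * cos ?u * (a' * cos ?v) = (a * a' / 2) * cos ((s - s') * fst p + (t - t') * snd p + (c - c')) +
          (a * a' / 2) * cos ((s + s') * fst p + (t + t') * snd p + (c + c'))"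
      unfolding 1 cos_add[of ?u] cos_diff[of ?u] by (simp add: field_simps)
  qed
  then show ?case by (simp only:) (intro trig_poly.intros)
next
  case (add P Q)
  then show ?case by (simp only: distrib_left) (intro trig_poly.add)
qed

lemma trig_poly_mult: "trig_poly P \<Longrightarrow> trig_poly Q \<Longrightarrow> trig_poly (\<lambda>p. P p * Q p)"
  by (induction rule: trig_poly.induct)
     (auto simp only: distrib_right intro: trig_poly.add trig_poly_cos_mult)

lemma trig_poly_bounded_continuous:
  assumes "trig_poly P"
  shows "continuous_on UNIV P" "\<exists>B. \<forall>p. \<bar>P p\<bar> \<le> B"
proof -
  show "continuous_on UNIV P"
    using assms by induction (auto intro!: continuous_intros)
  show "\<exists>B. \<forall>p. \<bar>P p\<bar> \<le> B"
    using assms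
  proof induction
    case (cos a s t c)
    have "\<bar>a * cos (s * fst p + t * snd p + c)\<bar> \<le> \<bar>a\<bar>" for p :: "real \<times> real"
      by (simp add: abs_mult mult_left_le)
    then show ?case by blast
  next
    case (add P Q)
    then obtain B B' where "\<And>p. \<bar>P p\<bar> \<le> B" "\<And>p. \<bar>Q p\<bar> \<le> B'" by blast
    then have "\<bar>P p + Q p\<bar> \<le> B + B'" for p
      by (meson abs_triangle_ineq add_mono order_trans)
    then show ?case by blast
  qed
qed

lemma trig_poly_of_polynomial:
  fixes q :: "real \<times> real \<Rightarrow> real"
  assumes "real_polynomial_function q"
  shows "trig_poly (\<lambda>p. q (cos (s * fst p + c), cos (t * snd p + d)))"
  using assms
proof induction
  case (linear l)
  then interpret bounded_linear l .
  have eq: "l (u, v) = l (1, 0) * u + l (0, 1) * v" for u v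
  proof -
    have "(u, v) = u *\<^sub>R (1, 0) + v *\<^sub>R (0, 1)" by simp
    then show ?thesis by (metis add scaleR mult.commute real_scaleR_def)
  qed
  have "(\<lambda>p. l (cos (s * fst p + c), cos (t * snd p + d))) =
     (\<lambda>p. l (1, 0) * cos (s * fst p + c) + l (0, 1) * cos (t * snd p + d))"
    using eq by blast
  then show ?case
    using trig_poly.add[OF trig_poly.cos[of "l (1,0)" s 0 c] trig_poly.cos[of "l (0,1)" 0 t d]] by simp
next
  case (mult f g)
  then show ?case using trig_poly_mult by fastforce
qed (auto intro: trig_poly_const trig_poly.add)

text \<open>The substitution \<open>x = 2L\<theta>/\<pi> - L\<close>, \<open>u = cos \<theta>\<close> maps the box homeomorphically onto the square
  \<open>[-1,1]\<^sup>2\<close>; polynomials in \<open>u\<close> then are trigonometric polynomials in \<open>x\<close>, whose global bound is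
  inherited from the square.\<close>
lemma trig_poly_approximation:
  fixes g :: "real \<times> real \<Rightarrow> real"
  assumes g: "continuous_on UNIV g" and B: "\<And>p. \<bar>g p\<bar> \<le> B" and L: "0 < L" and e: "0 < e"
  obtains P where "trig_poly P" "\<And>p. \<bar>P p\<bar> \<le> B + e"
    "\<And>x y. \<bar>x\<bar> \<le> L \<Longrightarrow> \<bar>y\<bar> \<le> L \<Longrightarrow> \<bar>g (x, y) - P (x, y)\<bar> \<le> e"
proof -
  define h where "h u = 2 * L / pi * arccos u - L" for u
  define th where "th x = pi / (2 * L) * x + pi / 2" for x
  have h: "continuous_on {-1..1} h"
    unfolding h_def by (intro continuous_intros continuous_on_arccos continuous_on_id) auto
  have "continuous_on ({-1..1} \<times> {-1..1}) (\<lambda>p. g (h (fst p), h (snd p)))"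
    by (intro continuous_on_compose2[OF g] continuous_on_Pair
        continuous_on_compose2[OF h] continuous_on_fst continuous_on_snd continuous_on_id) auto
  moreover have "compact ({-1..1::real} \<times> {-1..1::real})" by (intro compact_Times) auto
  ultimately obtain q where q: "real_polynomial_function q"
    "\<And>p. p \<in> {-1..1} \<times> {-1..1} \<Longrightarrow> \<bar>g (h (fst p), h (snd p)) - q p\<bar> < e"
    using Stone_Weierstrass_real_polynomial_function e by (metis (no_types, lifting))
  define P where "P p = q (cos (th (fst p)), cos (th (snd p)))" for p
  have hth: "h (cos (th x)) = x" if "\<bar>x\<bar> \<le> L" for x
  proof -
    have "\<bar>pi / (2 * L) * x\<bar> \<le> pi / 2"
      using that L by (simp add: abs_mult field_simps)
    then have "arccos (cos (th x)) = th x"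
      unfolding th_def by (intro arccos_cos) (simp_all only: abs_le_iff, linarith+)
    then show ?thesis
      unfolding h_def th_def using L by (simp add: field_simps)
  qed
  have ap: "\<bar>g (h (cos (th (fst p))), h (cos (th (snd p)))) - P p\<bar> < e" for p
    using q(2)[of "(cos (th (fst p)), cos (th (snd p)))"] by (simp add: P_def)
  show thesis
  proof
    show "trig_poly P"
      unfolding P_def th_def by (rule trig_poly_of_polynomial) fact
    show "\<bar>P p\<bar> \<le> B + e" for p
      using ap[of p] B[of "(h (cos (th (fst p))), h (cos (th (snd p))))"] by linarith
    show "\<bar>g (x, y) - P (x, y)\<bar> \<le> e" if "\<bar>x\<bar> \<le> L" "\<bar>y\<bar> \<le> L" for x y
      using ap[of "(x, y)"] hth that by simp
  qed
qed

lemma (in prob_space) integral_cos_eq_iexp: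
  assumes [measurable]: "Z \<in> borel_measurable M"
  shows "(\<integral>\<omega>. cos (Z \<omega> + c) \<partial>M) = Re (iexp c * (\<integral>\<omega>. iexp (Z \<omega>) \<partial>M))"
proof -
  have "integrable M (\<lambda>\<omega>. iexp c * iexp (Z \<omega>))"
    by (intro integrable_mult_right integrable_const_bound[where B=1]) auto
  from integral_Re[OF this]
  have "Re (iexp c * (\<integral>\<omega>. iexp (Z \<omega>) \<partial>M)) = (\<integral>\<omega>. Re (iexp c * iexp (Z \<omega>)) \<partial>M)"
    by simp
  also have "(\<lambda>\<omega>. Re (iexp c * iexp (Z \<omega>))) = (\<lambda>\<omega>. cos (Z \<omega> + c))"
    by (simp add: exp_add[symmetric] Re_exp add.commute del: exp_of_real flip: of_real_add distrib_left)
  finally show ?thesis by simp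
qed

lemma borel_prod_real_measurable_fst_snd:
  assumes "sets \<mu> = sets (borel :: (real \<times> real) measure)"
  shows "fst \<in> borel_measurable \<mu>" "snd \<in> borel_measurable \<mu>"
  using assms by (auto cong: measurable_cong_sets intro!: borel_measurable_continuous_onI continuous_intros)

text \<open>A continuous stand-in for the indicator of \<open>[-R, R]\<close>: weak convergence
  applies to it directly, and its integrals control the mass outside a box.\<close>

definition tent :: "real \<Rightarrow> real \<Rightarrow> real" where
  "tent R x = min 1 (max 0 (R + 1 - \<bar>x\<bar>))"

lemma tent_continuous: "continuous_on S (tent R)"
  unfolding tent_def by (intro continuous_intros)

lemma tent_measurable [measurable]: "tent R \<in> borel_measurable borel"
  by (intro borel_measurable_continuous_onI tent_continuous)

lemma tent_bounds: "0 \<le> tent R x" "tent R x \<le> 1" "\<bar>x\<bar> > R + 1 \<Longrightarrow> tent R x = 0"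
  by (auto simp: tent_def)

lemma (in prob_space) tent_tendsto_1:
  assumes [measurable]: "Z \<in> borel_measurable M"
  shows "(\<lambda>n. \<integral>\<omega>. tent (real n) (Z \<omega>) \<partial>M) \<longlonglongrightarrow> 1"
proof -
  have "(\<lambda>n. \<integral>\<omega>. tent (real n) (Z \<omega>) \<partial>M) \<longlonglongrightarrow> (\<integral>\<omega>. 1 \<partial>M)"
  proof (rule integral_dominated_convergence[where w="\<lambda>_. 1"])
    show "AE \<omega> in M. (\<lambda>n. tent (real n) (Z \<omega>)) \<longlonglongrightarrow> 1"
    proof (intro AE_I2 tendsto_eventually)
      fix \<omega>
      show "\<forall>\<^sub>F n in sequentially. tent (real n) (Z \<omega>) = 1"
        using eventually_ge_at_top[of "nat \<lceil>\<bar>Z \<omega>\<bar>\<rceil>"]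
        by eventually_elim (auto simp: tent_def nat_le_iff ceiling_le_iff min_def max_def)
    qed
  qed (auto simp: tent_def)
  then show ?thesis by (simp add: prob_space)
qed

text \<open>Integrals of trigonometric polynomials converge because they are combinations of
  characteristic functions. A bounded continuous \<open>g\<close> is close to such a polynomial on a
  large box, and tightness makes the mass outside the box small for the limit and for all late
  \<open>n\<close>; there the global bound of the polynomial suffices.\<close>

theorem levy_continuity_plane:
  fixes \<mu> :: "nat \<Rightarrow> (real \<times> real) measure" and \<nu> :: "(real \<times> real) measure"
  assumes \<mu>: "\<And>n. prob_space (\<mu> n)" "\<And>n. sets (\<mu> n) = sets borel"
    and \<nu>: "prob_space \<nu>" "sets \<nu> = sets borel"
    and char: "\<And>s t. (\<lambda>n. \<integral>p. iexp (s * fst p + t * snd p) \<partial>\<mu> n)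
                 \<longlonglongrightarrow> (\<integral>p. iexp (s * fst p + t * snd p) \<partial>\<nu>)"
  shows "conv_law \<mu> \<nu>"
  unfolding conv_law_def
proof (intro allI impI)
  fix g :: "real \<times> real \<Rightarrow> real"
  assume "continuous_on UNIV g \<and> bounded (range g)"
  then obtain B where g: "continuous_on UNIV g" and B: "\<And>p. \<bar>g p\<bar> \<le> B"
    by (auto simp: bounded_iff)
  interpret \<mu>: prob_space "\<mu> n" for n by fact
  interpret \<nu>: prob_space \<nu> by fact
  note m\<mu> [measurable] = borel_prod_real_measurable_fst_snd[OF \<mu>(2)]
  note m\<nu> [measurable] = borel_prod_real_measurable_fst_snd[OF \<nu>(2)]
  have meas: "P \<in> borel_measurable (\<mu> n)" "P \<in> borel_measurable \<nu>"
    if "continuous_on UNIV P" for P :: "real \<times> real \<Rightarrow> real" and n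
    using borel_measurable_continuous_onI[OF that]
    by (auto simp: measurable_cong_sets[OF \<mu>(2) refl] measurable_cong_sets[OF \<nu>(2) refl])
  have int: "integrable (\<mu> n) P" "integrable \<nu> P"
    if "continuous_on UNIV P" "\<And>p. \<bar>P p\<bar> \<le> b" for P :: "real \<times> real \<Rightarrow> real" and n b
    using meas[OF that(1)] that(2)
    by (auto intro!: \<mu>.integrable_const_bound[where B=b] \<nu>.integrable_const_bound[where B=b])
  have trig: "(\<lambda>n. integral\<^sup>L (\<mu> n) P) \<longlonglongrightarrow> integral\<^sup>L \<nu> P" if "trig_poly P" for P
    using that
  proof induction
    case (cos a s t c)
    have "(\<lambda>n. a * Re (iexp c * (\<integral>p. iexp (s * fst p + t * snd p) \<partial>\<mu> n)))
       \<longlonglongrightarrow> a * Re (iexp c * (\<integral>p. iexp (s * fst p + t * snd p) \<partial>\<nu>))"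
      by (intro tendsto_intros char)
    moreover have "(\<integral>p. cos (s * fst p + t * snd p + c) \<partial>\<mu> n)
        = Re (iexp c * (\<integral>p. iexp (s * fst p + t * snd p) \<partial>\<mu> n))" for n
      by (rule \<mu>.integral_cos_eq_iexp) measurable
    moreover have "(\<integral>p. cos (s * fst p + t * snd p + c) \<partial>\<nu>)
        = Re (iexp c * (\<integral>p. iexp (s * fst p + t * snd p) \<partial>\<nu>))"
      by (rule \<nu>.integral_cos_eq_iexp) measurable
    ultimately show ?case by simp
  next
    case (add P Q)
    have "integrable (\<mu> n) P" "integrable (\<mu> n) Q" "integrable \<nu> P" "integrable \<nu> Q" for n
      using trig_poly_bounded_continuous[OF add(1)] trig_poly_bounded_continuous[OF add(2)] int by blast+
    with tendsto_add[OF add(3,4)] show ?case by simp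
  qed
  \<comment> \<open>The characteristic function of \<open>s x + t y\<close> at \<open>u\<close> is
    that of the pair at \<open>(u s, u t)\<close>, so the one-dimensional theorem applies to every
    linear functional. The two coordinates give tightness.\<close>
  have marg: "(\<lambda>n. \<integral>p. tent R (s * fst p + t * snd p) \<partial>\<mu> n) \<longlonglongrightarrow> (\<integral>p. tent R (s * fst p + t * snd p) \<partial>\<nu>)" for R s t
  proof -
    let ?Z = "\<lambda>p :: real \<times> real. s * fst p + t * snd p"
    have rd: "real_distribution (distr (\<mu> n) borel ?Z)" "real_distribution (distr \<nu> borel ?Z)" for n
      by (auto intro!: \<mu>.real_distribution_distr \<nu>.real_distribution_distr)
    have "weak_conv_m (\<lambda>n. distr (\<mu> n) borel ?Z) (distr \<nu> borel ?Z)"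
    proof (rule levy_continuity[OF rd])
      fix u
      show "(\<lambda>n. char (distr (\<mu> n) borel ?Z) u) \<longlonglongrightarrow> char (distr \<nu> borel ?Z) u"
        using char[of "u * s" "u * t"] by (simp add: char_def integral_distr algebra_simps)
    qed
    from weak_conv_imp_integral_bdd_continuous_conv[OF rd this, of "tent R" 1]
    have "(\<lambda>n. integral\<^sup>L (distr (\<mu> n) borel ?Z) (tent R)) \<longlonglongrightarrow> integral\<^sup>L (distr \<nu> borel ?Z) (tent R)"
      using tent_continuous[of UNIV R] by (auto simp: tent_bounds continuous_on_eq_continuous_at)
    then show ?thesis by (simp add: integral_distr)
  qed
  have B0: "0 \<le> B" using B[of 0] by linarith
  show "(\<lambda>n. \<integral>x. g x \<partial>\<mu> n) \<longlonglongrightarrow> (\<integral>x. g x \<partial>\<nu>)"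
  proof (rule LIMSEQ_I)
    fix r :: real assume r: "0 < r"
    \<comment> \<open>The total error will be \<open>e * (8 * B + 7)\<close>, which the divisor
      \<open>16 * (B + 1)\<close> keeps below \<open>r\<close>.\<close>
    define e where "e = min 1 (r / (16 * (B + 1)))"
    have e: "0 < e" "e \<le> 1" using r B0 by (auto simp: e_def)
    have "(\<lambda>n. (\<integral>p. tent (real n) (fst p) \<partial>\<nu>)) \<longlonglongrightarrow> 1" "(\<lambda>n. (\<integral>p. tent (real n) (snd p) \<partial>\<nu>)) \<longlonglongrightarrow> 1"
      by (auto intro!: \<nu>.tent_tendsto_1)
    then have "\<forall>\<^sub>F n in sequentially. (\<integral>p. tent (real n) (fst p) \<partial>\<nu>) > 1 - e \<and> (\<integral>p. tent (real n) (snd p) \<partial>\<nu>) > 1 - e"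
      using e by (intro eventually_conj order_tendstoD(1)) auto
    then obtain m where m: "(\<integral>p. tent (real m) (fst p) \<partial>\<nu>) > 1 - e" "(\<integral>p. tent (real m) (snd p) \<partial>\<nu>) > 1 - e"
      using eventually_happens by fastforce
    define R where "R = real m"
    obtain P where P: "trig_poly P" "\<And>p. \<bar>P p\<bar> \<le> B + e"
      "\<And>x y. \<bar>x\<bar> \<le> R + 1 \<Longrightarrow> \<bar>y\<bar> \<le> R + 1 \<Longrightarrow> \<bar>g (x, y) - P (x, y)\<bar> \<le> e"
      using trig_poly_approximation[OF g B, of "R + 1" e] e by (auto simp: R_def)
    note Pc = trig_poly_bounded_continuous(1)[OF P(1)]
    \<comment> \<open>Outside the box at least one tent vanishes, so the bracket is at least 1 and
      pays for the crude bound \<open>2 * B + e\<close>.\<close>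
    have pw: "\<bar>g p - P p\<bar> \<le> e + (2 * B + 1) * ((1 - tent R (fst p)) + (1 - tent R (snd p)))" for p
    proof (cases "\<bar>fst p\<bar> \<le> R + 1 \<and> \<bar>snd p\<bar> \<le> R + 1")
      case True
      then have "\<bar>g p - P p\<bar> \<le> e" using P(3)[of "fst p" "snd p"] by simp
      moreover have "0 \<le> (2 * B + 1) * ((1 - tent R (fst p)) + (1 - tent R (snd p)))"
        using B0 tent_bounds[of R] by (intro mult_nonneg_nonneg add_nonneg_nonneg) auto
      ultimately show ?thesis by linarith
    next
      case False
      then have "1 \<le> (1 - tent R (fst p)) + (1 - tent R (snd p))"
        using tent_bounds[of R "fst p"] tent_bounds[of R "snd p"] by auto
      then have "(2 * B + 1) * 1 \<le> (2 * B + 1) * ((1 - tent R (fst p)) + (1 - tent R (snd p)))"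
        using B0 by (intro mult_left_mono) auto
      moreover have "\<bar>g p - P p\<bar> \<le> 2 * B + e"
        using B[of p] P(2)[of p] e by linarith
      moreover have "d \<le> 2 * B + e \<Longrightarrow> (2 * B + 1) * 1 \<le> X \<Longrightarrow> d \<le> e + X" for d X
        unfolding mult_1_right by linarith
      ultimately show ?thesis by blast
    qed
    have diff: "\<bar>(\<integral>p. g p \<partial>\<kappa>) - (\<integral>p. P p \<partial>\<kappa>)\<bar> \<le> e + (2 * B + 1) * (2 * e)"
      if ps: "prob_space \<kappa>" and se: "sets \<kappa> = sets borel"
        and t: "(\<integral>p. tent R (fst p) \<partial>\<kappa>) > 1 - e" "(\<integral>p. tent R (snd p) \<partial>\<kappa>) > 1 - e" for \<kappa> :: "(real \<times> real) measure"
    proof -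
      interpret \<kappa>: prob_space \<kappa> by fact
      note [measurable] = borel_prod_real_measurable_fst_snd[OF se]
      have i: "integrable \<kappa> Q" if "continuous_on UNIV Q" "\<And>p. \<bar>Q p\<bar> \<le> b" for Q :: "real \<times> real \<Rightarrow> real" and b
        using borel_measurable_continuous_onI[OF that(1)] that(2)
        by (intro \<kappa>.integrable_const_bound[where B=b]) (auto simp: measurable_cong_sets[OF se refl])
      have ti: "integrable \<kappa> (\<lambda>p. tent R (fst p))" "integrable \<kappa> (\<lambda>p. tent R (snd p))"
        by (auto intro!: \<kappa>.integrable_const_bound[where B=1] simp: tent_bounds)
      have gi: "integrable \<kappa> g" "integrable \<kappa> P" using i[OF g B] i[OF Pc P(2)] by auto
      have "\<bar>(\<integral>p. g p \<partial>\<kappa>) - (\<integral>p. P p \<partial>\<kappa>)\<bar> = \<bar>\<integral>p. g p - P p \<partial>\<kappa>\<bar>" using gi by simp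
      also have "\<dots> \<le> (\<integral>p. \<bar>g p - P p\<bar> \<partial>\<kappa>)" by (rule integral_abs_bound)
      also have "\<dots> \<le> (\<integral>p. e + (2 * B + 1) * ((1 - tent R (fst p)) + (1 - tent R (snd p))) \<partial>\<kappa>)"
        using gi ti by (intro integral_mono pw) auto
      also have "\<dots> = e + (2 * B + 1) * ((1 - (\<integral>p. tent R (fst p) \<partial>\<kappa>)) + (1 - (\<integral>p. tent R (snd p) \<partial>\<kappa>)))"
        using ti by (simp add: \<kappa>.prob_space)
      also have "\<dots> \<le> e + (2 * B + 1) * (2 * e)"
        using t B0 by (intro add_left_mono mult_left_mono) auto
      finally show ?thesis .
    qed
    have "\<forall>\<^sub>F n in sequentially. (\<integral>p. tent R (fst p) \<partial>\<mu> n) > 1 - e \<and> (\<integral>p. tent R (snd p) \<partial>\<mu> n) > 1 - e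
        \<and> \<bar>integral\<^sup>L (\<mu> n) P - integral\<^sup>L \<nu> P\<bar> < e"
    proof (intro eventually_conj)
      show "\<forall>\<^sub>F n in sequentially. (\<integral>p. tent R (fst p) \<partial>\<mu> n) > 1 - e"
        using marg[of R 1 0] m by (intro order_tendstoD(1)[of _ "\<integral>p. tent R (fst p) \<partial>\<nu>"]) (auto simp: R_def)
      show "\<forall>\<^sub>F n in sequentially. (\<integral>p. tent R (snd p) \<partial>\<mu> n) > 1 - e"
        using marg[of R 0 1] m by (intro order_tendstoD(1)[of _ "\<integral>p. tent R (snd p) \<partial>\<nu>"]) (auto simp: R_def)
      show "\<forall>\<^sub>F n in sequentially. \<bar>integral\<^sup>L (\<mu> n) P - integral\<^sup>L \<nu> P\<bar> < e"
        using trig[OF P(1)] e by (auto simp: tendsto_iff dist_real_def)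
    qed
    then obtain N where N: "\<And>n. n \<ge> N \<Longrightarrow> (\<integral>p. tent R (fst p) \<partial>\<mu> n) > 1 - e \<and> (\<integral>p. tent R (snd p) \<partial>\<mu> n) > 1 - e
        \<and> \<bar>integral\<^sup>L (\<mu> n) P - integral\<^sup>L \<nu> P\<bar> < e"
      by (auto simp: eventually_sequentially)
    have "norm ((\<integral>x. g x \<partial>\<mu> n) - (\<integral>x. g x \<partial>\<nu>)) < r" if "n \<ge> N" for n
    proof -
      have "\<bar>(\<integral>x. g x \<partial>\<mu> n) - (\<integral>x. g x \<partial>\<nu>)\<bar> \<le> 2 * (e + (2 * B + 1) * (2 * e)) + e"
      proof -
        have "\<bar>x - y\<bar> \<le> 2 * E + e" if "\<bar>x - x'\<bar> \<le> E" "\<bar>y - y'\<bar> \<le> E" "\<bar>x' - y'\<bar> < e" for x y x' y' E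
          using that by linarith
        then show ?thesis
          using diff[OF \<mu>(1) \<mu>(2), of n] diff[OF \<nu>] N[OF that] m unfolding R_def by blast
      qed
      also have "\<dots> = e * (8 * B + 7)" by (simp add: algebra_simps)
      also have "\<dots> \<le> r / (16 * (B + 1)) * (8 * B + 7)"
        using B0 by (intro mult_right_mono) (auto simp: e_def)
      also have "\<dots> < r" using r B0 by (simp add: field_simps add_pos_nonneg)
      finally show ?thesis by simp
    qed
    then show "\<exists>no. \<forall>n\<ge>no. norm ((\<integral>x. g x \<partial>\<mu> n) - (\<integral>x. g x \<partial>\<nu>)) < r" by blast
  qed
qed

section \<open>A central limit theorem for triangular arrays\<close>

text \<open>Interpolation in the remainder of the characteristic function: the square is used where
  \<open>t * \<bar>x\<bar> \<ge> 1\<close> and the cube where it is smaller. This is why a moment of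
  order \<open>2 + d\<close> replaces a third moment.\<close>

lemma min_square_cube_le:
  fixes x t :: real
  assumes d: "0 < d" "d \<le> 1" and t: "0 \<le> t"
  shows "min (6 * x\<^sup>2) (t * \<bar>x\<bar> ^ 3) \<le> 6 * t powr d * \<bar>x\<bar> powr (2 + d)"
proof (cases "x = 0 \<or> t = 0")
  case True
  then show ?thesis by auto
next
  case False
  then have x: "0 < \<bar>x\<bar>" and t: "0 < t" using t by auto
  have x2: "x\<^sup>2 = \<bar>x\<bar> powr 2" using x by (simp add: powr_numeral)
  have split: "\<bar>x\<bar> powr (2 + d) = \<bar>x\<bar> powr 2 * \<bar>x\<bar> powr d" by (simp add: powr_add)
  show ?thesis
  proof (cases "1 \<le> t * \<bar>x\<bar>")
    case True
    then have "1 \<le> (t * \<bar>x\<bar>) powr d" using d by (intro ge_one_powr_ge_zero) auto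
    then have "1 * \<bar>x\<bar> powr 2 \<le> (t powr d * \<bar>x\<bar> powr d) * \<bar>x\<bar> powr 2"
      using t x by (intro mult_right_mono) (auto simp: powr_mult)
    then show ?thesis unfolding x2 split by (simp add: min_le_iff_disj algebra_simps)
  next
    case False
    then have "(t * \<bar>x\<bar>) powr 1 \<le> (t * \<bar>x\<bar>) powr d"
      using d t x by (intro powr_mono') auto
    then have "t * \<bar>x\<bar> \<le> t powr d * \<bar>x\<bar> powr d" using t x by (simp add: powr_mult)
    then have "(t * \<bar>x\<bar>) * \<bar>x\<bar> powr 2 \<le> (t powr d * \<bar>x\<bar> powr d) * \<bar>x\<bar> powr 2"
      by (intro mult_right_mono) auto
    moreover have "(t * \<bar>x\<bar>) * \<bar>x\<bar> powr 2 = t * \<bar>x\<bar> ^ 3"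
      using x by (simp add: powr_numeral power2_eq_square power3_eq_cube)
    moreover have "0 \<le> t powr d * \<bar>x\<bar> powr d * \<bar>x\<bar> powr 2" by simp
    ultimately have "t * \<bar>x\<bar> ^ 3 \<le> 6 * (t powr d * \<bar>x\<bar> powr d * \<bar>x\<bar> powr 2)" by linarith
    then show ?thesis unfolding split by (simp add: min_le_iff_disj algebra_simps)
  qed
qed

lemma tendsto_exp_limit_array:
  fixes s :: "nat \<Rightarrow> real"
  assumes s: "s \<longlonglongrightarrow> c" and N: "filterlim N at_top sequentially"
  shows "(\<lambda>K. (1 + s K / real (N K)) ^ N K) \<longlonglongrightarrow> exp c"
proof -
  have N': "filterlim (\<lambda>K. real (N K)) at_top sequentially"
    by (rule filterlim_compose[OF filterlim_real_sequentially N])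
  have z: "(\<lambda>K. s K / real (N K)) \<longlonglongrightarrow> 0"
    by (rule tendsto_divide_0[OF s filterlim_at_top_imp_at_infinity[OF N']])
  \<comment> \<open>The value 1 is filled in at 0 to make the quotient continuous there, since
    \<open>s K\<close> may vanish for some \<open>K\<close>.\<close>
  have dn: "(\<lambda>x::real. if x = 0 then 1 else ln (1 + x) / x) \<midarrow>0\<rightarrow> 1"
  proof -
    have "((\<lambda>x. ln (1 + x)) has_field_derivative 1) (at (0::real))"
      by (auto intro!: derivative_eq_intros)
    then have "(\<lambda>x::real. ln (1 + x) / x) \<midarrow>0\<rightarrow> 1" by (simp add: DERIV_def)
    then show ?thesis by (rule Lim_transform_eventually) (simp add: eventually_at_filter)
  qed
  then have "(\<lambda>K. if s K / real (N K) = 0 then 1 else ln (1 + s K / real (N K)) / (s K / real (N K))) \<longlonglongrightarrow> (1::real)"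
    using isCont_tendsto_compose[of 0 "\<lambda>x::real. if x = 0 then 1 else ln (1 + x) / x", OF _ z]
    by (simp add: isCont_def)
  from tendsto_exp[OF tendsto_mult[OF s this]]
  have lim: "(\<lambda>K. exp (s K * (if s K / real (N K) = 0 then 1 else ln (1 + s K / real (N K)) / (s K / real (N K))))) \<longlonglongrightarrow> exp c"
    by simp
  have "\<forall>\<^sub>F K in sequentially. -1 < s K / real (N K)"
    using order_tendstoD(1)[OF z, of "-1"] by simp
  moreover have "\<forall>\<^sub>F K in sequentially. 1 \<le> N K"
    using N by (simp add: filterlim_at_top)
  ultimately have "\<forall>\<^sub>F K in sequentially. exp (s K * (if s K / real (N K) = 0 then 1 else ln (1 + s K / real (N K)) / (s K / real (N K))))
      = (1 + s K / real (N K)) ^ N K"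
  proof eventually_elim
    case (elim K)
    show ?case
    proof (cases "s K = 0")
      case False
      with elim have "s K * (ln (1 + s K / real (N K)) / (s K / real (N K))) = real (N K) * ln (1 + s K / real (N K))"
        by (simp add: field_simps)
      with False elim show ?thesis by (simp add: exp_of_nat_mult del: times_divide_eq_right)
    qed simp
  qed
  from Lim_transform_eventually[OF lim this] show ?thesis .
qed

text \<open>Row \<open>K\<close> contributes the power \<open>K\<^sup>2\<close> of one
  characteristic function at \<open>u / K\<close>. Replacing that function by its second-order
  expansion \<open>a K\<close> costs, over all factors together, order \<open>K powr (- d)\<close>
  by the Lyapunov moment; the powers of \<open>a K\<close> converge to the Gaussian
  exponential.\<close>

lemma (in prob_space) char_triangular_array_tendsto:
  fixes X :: "nat \<Rightarrow> nat \<Rightarrow> 'a \<Rightarrow> real" and v :: "nat \<Rightarrow> real"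
  assumes indep: "\<And>K. K \<ge> 1 \<Longrightarrow> indep_vars (\<lambda>_. borel) (X K) UNIV"
    and dist: "\<And>K n. K \<ge> 1 \<Longrightarrow> distr M borel (X K n) = distr M borel (X K 0)"
    and int: "\<And>K. K \<ge> 1 \<Longrightarrow> integrable M (X K 0)"
    and int2: "\<And>K. K \<ge> 1 \<Longrightarrow> integrable M (\<lambda>\<omega>. (X K 0 \<omega>)\<^sup>2)"
    and mean: "\<And>K. K \<ge> 1 \<Longrightarrow> expectation (X K 0) = 0"
    and var: "\<And>K. K \<ge> 1 \<Longrightarrow> expectation (\<lambda>\<omega>. (X K 0 \<omega>)\<^sup>2) = v K"
    and v: "v \<longlonglongrightarrow> \<sigma>2"
    and d: "0 < d" "d \<le> 1"
    and lyap_int: "\<And>K. K \<ge> 1 \<Longrightarrow> integrable M (\<lambda>\<omega>. \<bar>X K 0 \<omega>\<bar> powr (2 + d))"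
    and lyap: "\<And>K. K \<ge> 1 \<Longrightarrow> expectation (\<lambda>\<omega>. \<bar>X K 0 \<omega>\<bar> powr (2 + d)) \<le> C"
  shows "(\<lambda>K. expectation (\<lambda>\<omega>. iexp (u * ((\<Sum>n<K\<^sup>2. X K n \<omega>) / real K)))) \<longlonglongrightarrow> complex_of_real (exp (- (u\<^sup>2 * \<sigma>2) / 2))"
proof -
  have Xm: "X K n \<in> borel_measurable M" if "K \<ge> 1" for K n
    using indep[OF that] unfolding indep_vars_def2 by simp
  define \<psi> where "\<psi> K = char (distr M borel (X K 0)) (u / real K)" for K
  define a where "a K = 1 + (- (u\<^sup>2 * v K) / 2) / real (K\<^sup>2)" for K
  have eq: "expectation (\<lambda>\<omega>. iexp (u * ((\<Sum>n<K\<^sup>2. X K n \<omega>) / real K))) = \<psi> K ^ (K\<^sup>2)" if K: "K \<ge> 1" for K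
  proof -
    have m: "X K n \<in> borel_measurable M" for n using Xm K by blast
    note [measurable] = m
    have "expectation (\<lambda>\<omega>. iexp (u * ((\<Sum>n<K\<^sup>2. X K n \<omega>) / real K)))
        = char (distr M borel (\<lambda>\<omega>. \<Sum>n<K\<^sup>2. X K n \<omega>)) (u / real K)"
      by (simp add: char_def integral_distr)
    also have "\<dots> = (\<Prod>n<K\<^sup>2. char (distr M borel (X K n)) (u / real K))"
      by (intro char_distr_sum indep_vars_subset[OF indep[OF K]]) auto
    also have "\<dots> = \<psi> K ^ (K\<^sup>2)"
      unfolding \<psi>_def by (subst dist[OF K]) simp
    finally show ?thesis .
  qed
  \<comment> \<open>Inside the closed unit disc the \<open>n\<close>-th powers of two numbers differ
    by at most \<open>n\<close> times the difference of the numbers. Hence the condition on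
    \<open>a K\<close>, which holds for all large \<open>K\<close>.\<close>
  have bound: "cmod (\<psi> K ^ (K\<^sup>2) - complex_of_real (a K ^ (K\<^sup>2))) \<le> u\<^sup>2 * \<bar>u / real K\<bar> powr d * C"
    if K: "K \<ge> 1" and aK: "\<bar>a K\<bar> \<le> 1" for K
  proof -
    have m [measurable]: "X K n \<in> borel_measurable M" for n using Xm K by blast
    interpret D: real_distribution "distr M borel (X K 0)" by (rule real_distribution_distr) measurable
    have "cmod (\<psi> K - (1 - (u / real K)\<^sup>2 * v K / 2)) \<le>
      ((u / real K)\<^sup>2 / 6) * expectation (\<lambda>x. min (6 * (X K 0 x)\<^sup>2) (\<bar>u / real K\<bar> * \<bar>X K 0 x\<bar> ^ 3))"
      unfolding \<psi>_def by (rule char_approx3'[OF m int[OF K] int2[OF K] mean[OF K] _ refl]) (simp add: mean[OF K] var[OF K])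
    also have "\<dots> \<le> ((u / real K)\<^sup>2 / 6) * (6 * \<bar>u / real K\<bar> powr d * C)"
    proof (rule mult_left_mono)
      have "expectation (\<lambda>x. min (6 * (X K 0 x)\<^sup>2) (\<bar>u / real K\<bar> * \<bar>X K 0 x\<bar> ^ 3))
          \<le> expectation (\<lambda>x. 6 * \<bar>u / real K\<bar> powr d * \<bar>X K 0 x\<bar> powr (2 + d))"
      proof (rule integral_mono)
        show "integrable M (\<lambda>x. min (6 * (X K 0 x)\<^sup>2) (\<bar>u / real K\<bar> * \<bar>X K 0 x\<bar> ^ 3))"
          by (rule Bochner_Integration.integrable_bound[where f="\<lambda>x. 6 * (X K 0 x)\<^sup>2"])
             (use int2[OF K] in \<open>auto simp: abs_le_iff min_le_iff_disj intro!: AE_I2\<close>)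
        show "integrable M (\<lambda>x. 6 * \<bar>u / real K\<bar> powr d * \<bar>X K 0 x\<bar> powr (2 + d))"
          using lyap_int[OF K] by simp
        show "min (6 * (X K 0 x)\<^sup>2) (\<bar>u / real K\<bar> * \<bar>X K 0 x\<bar> ^ 3)
            \<le> 6 * \<bar>u / real K\<bar> powr d * \<bar>X K 0 x\<bar> powr (2 + d)" for x
          by (rule min_square_cube_le[OF d]) simp
      qed
      also have "\<dots> = 6 * \<bar>u / real K\<bar> powr d * expectation (\<lambda>x. \<bar>X K 0 x\<bar> powr (2 + d))" by simp
      also have "\<dots> \<le> 6 * \<bar>u / real K\<bar> powr d * C" using lyap[OF K] by (intro mult_left_mono) auto
      finally show "expectation (\<lambda>x. min (6 * (X K 0 x)\<^sup>2) (\<bar>u / real K\<bar> * \<bar>X K 0 x\<bar> ^ 3)) \<le> 6 * \<bar>u / real K\<bar> powr d * C" .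
    qed simp
    finally have 1: "cmod (\<psi> K - complex_of_real (a K)) \<le> (u / real K)\<^sup>2 * (\<bar>u / real K\<bar> powr d * C)"
      by (simp add: a_def power_divide mult.commute)
    have "cmod (\<psi> K ^ (K\<^sup>2) - (complex_of_real (a K)) ^ (K\<^sup>2)) \<le> real (K\<^sup>2) * cmod (\<psi> K - complex_of_real (a K))"
      using aK unfolding \<psi>_def by (intro norm_power_diff D.cmod_char_le_1) auto
    also have "\<dots> \<le> real (K\<^sup>2) * ((u / real K)\<^sup>2 * (\<bar>u / real K\<bar> powr d * C))"
      by (intro mult_left_mono 1) auto
    also have "\<dots> = u\<^sup>2 * \<bar>u / real K\<bar> powr d * C" using K by (simp add: power_divide)
    finally show ?thesis by simp
  qed
  have K2: "filterlim (\<lambda>K::nat. K\<^sup>2) at_top sequentially"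
    by (rule filterlim_at_top_mono[OF filterlim_ident]) (auto simp: power2_nat_le_imp_le)
  have s: "(\<lambda>K. - (u\<^sup>2 * v K) / 2) \<longlonglongrightarrow> - (u\<^sup>2 * \<sigma>2) / 2" by (intro tendsto_intros v) auto
  have "(\<lambda>K. a K ^ (K\<^sup>2)) \<longlonglongrightarrow> exp (- (u\<^sup>2 * \<sigma>2) / 2)"
    unfolding a_def by (rule tendsto_exp_limit_array[OF s K2])
  then have lim: "(\<lambda>K. complex_of_real (a K ^ (K\<^sup>2))) \<longlonglongrightarrow> complex_of_real (exp (- (u\<^sup>2 * \<sigma>2) / 2))"
    by (rule tendsto_of_real)
  have "(\<lambda>K. - (u\<^sup>2 * v K) / 2 / real (K\<^sup>2)) \<longlonglongrightarrow> 0"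
    by (rule tendsto_divide_0[OF s filterlim_at_top_imp_at_infinity[OF filterlim_compose[OF filterlim_real_sequentially K2]]])
  then have a_ev: "\<forall>\<^sub>F K in sequentially. - (u\<^sup>2 * v K) / 2 / real (K\<^sup>2) > -1"
    by (rule order_tendstoD) simp
  have uK: "(\<lambda>K. u\<^sup>2 * \<bar>u / real K\<bar> powr d * C) \<longlonglongrightarrow> u\<^sup>2 * (0 powr d) * C"
  proof (intro tendsto_mult tendsto_const tendsto_powr2)
    show "(\<lambda>K. \<bar>u / real K\<bar>) \<longlonglongrightarrow> 0"
      using tendsto_rabs[OF lim_const_over_n[of u]] by simp
  qed (use d in auto)
  have "(\<lambda>K. \<psi> K ^ (K\<^sup>2) - complex_of_real (a K ^ (K\<^sup>2))) \<longlonglongrightarrow> 0"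
  proof (rule Lim_null_comparison)
    show "\<forall>\<^sub>F K in sequentially. norm (\<psi> K ^ (K\<^sup>2) - complex_of_real (a K ^ (K\<^sup>2))) \<le> u\<^sup>2 * \<bar>u / real K\<bar> powr d * C"
      using a_ev eventually_ge_at_top[of 1]
    proof eventually_elim
      case (elim K)
      have "0 \<le> v K" using var[OF elim(2)] by (metis integral_nonneg_AE AE_I2 zero_le_power2)
      then have "- (u\<^sup>2 * v K) / 2 / real (K\<^sup>2) \<le> 0" by (simp add: divide_nonpos_nonneg)
      then have "\<bar>a K\<bar> \<le> 1" using elim unfolding a_def by linarith
      from bound[OF elim(2) this] show ?case .
    qed
    show "(\<lambda>K. u\<^sup>2 * \<bar>u / real K\<bar> powr d * C) \<longlonglongrightarrow> 0" using uK by simp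
  qed
  from Lim_transform[OF lim this]
  have "(\<lambda>K. \<psi> K ^ (K\<^sup>2)) \<longlonglongrightarrow> complex_of_real (exp (- (u\<^sup>2 * \<sigma>2) / 2))" .
  then show ?thesis
    by (rule Lim_transform_eventually) (use eq in \<open>auto intro!: eventually_sequentiallyI[of 1]\<close>)
qed

section \<open>Quantiles and expected shortfall under a Lipschitz density\<close>

text \<open>\<open>C\<close> is at once a bound and a Lipschitz constant of the density and is a
  parameter separate from the law, so one \<open>C\<close> can serve all \<open>K\<close> in the
  estimates below.\<close>

locale lipschitz_density = real_distribution \<nu> for \<nu> :: "real measure" +
  fixes f :: "real \<Rightarrow> real" and C \<alpha> :: real
  assumes alpha: "0 < \<alpha>" "\<alpha> < 1"
    and density: "\<nu> = density lborel (\<lambda>x. ennreal (f x))"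
    and f_measurable [measurable]: "f \<in> borel_measurable borel"
    and f_nonneg: "\<And>x. 0 \<le> f x"
    and f_le: "\<And>x. f x \<le> C"
    and f_Lipschitz: "\<And>x y. \<bar>f x - f y\<bar> \<le> C * \<bar>x - y\<bar>"
    and C_pos: "0 < C"
    and mean_finite: "integrable \<nu> (\<lambda>x. x)"
begin

lemma emeasure_nu: "A \<in> sets borel \<Longrightarrow> emeasure \<nu> A = (\<integral>\<^sup>+x. ennreal (f x) * indicator A x \<partial>lborel)"
  unfolding density by (subst emeasure_density) auto

lemma measure_singleton: "measure \<nu> {x} = 0"
proof -
  have "emeasure \<nu> {x} = 0"
    by (subst emeasure_nu) (auto simp: nn_integral_0_iff_AE intro!: AE_I[where N="{x}"] split: split_indicator)
  then show ?thesis by (simp add: measure_def)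
qed

lemma measure_Icc_eq_cdf:
  assumes "a \<le> b"
  shows "measure \<nu> {a..b} = cdf \<nu> b - cdf \<nu> a"
proof -
  have "measure \<nu> {a..b} = measure \<nu> ({a} \<union> {a<..b})"
    by (rule arg_cong[where f="measure \<nu>"]) (use assms in auto)
  also have "\<dots> = measure \<nu> {a} + measure \<nu> {a<..b}" by (rule finite_measure_Union) auto
  finally show ?thesis
    using assms measure_singleton by (cases "a = b") (auto simp: cdf_diff_eq)
qed

lemma measure_atLeast: "measure \<nu> {a..} = 1 - cdf \<nu> a"
proof -
  have "measure \<nu> {a..} = measure \<nu> ({a} \<union> {a<..})"
    by (rule arg_cong[where f="measure \<nu>"]) auto
  also have "\<dots> = measure \<nu> {a} + measure \<nu> {a<..}" by (rule finite_measure_Union) auto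
  also have "measure \<nu> {a<..} = measure \<nu> (space \<nu> - {..a})"
    by (rule arg_cong[where f="measure \<nu>"]) auto
  also have "\<dots> = 1 - cdf \<nu> a" unfolding cdf_def by (rule prob_compl) auto
  finally show ?thesis by (simp add: measure_singleton)
qed

lemma cdf_diff_bounds:
  assumes ab: "a \<le> b" and lu: "\<And>x. a \<le> x \<Longrightarrow> x \<le> b \<Longrightarrow> l \<le> f x \<and> f x \<le> u"
  shows "l * (b - a) \<le> cdf \<nu> b - cdf \<nu> a" "cdf \<nu> b - cdf \<nu> a \<le> u * (b - a)"
proof -
  have u0: "0 \<le> u" using lu[of a] f_nonneg[of a] ab by auto
  have "emeasure \<nu> {a..b} \<le> (\<integral>\<^sup>+x. ennreal u * indicator {a..b} x \<partial>lborel)"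
    using lu by (subst emeasure_nu) (auto intro!: nn_integral_mono ennreal_leI split: split_indicator)
  also have "\<dots> = ennreal (u * (b - a))"
    using ab u0 by (subst nn_integral_cmult_indicator) (auto simp: ennreal_mult)
  finally show "cdf \<nu> b - cdf \<nu> a \<le> u * (b - a)"
    using ab u0 by (simp add: measure_Icc_eq_cdf[symmetric] emeasure_eq_measure)
  show "l * (b - a) \<le> cdf \<nu> b - cdf \<nu> a"
  proof (cases "0 \<le> l")
    case True
    have "ennreal (l * (b - a)) = (\<integral>\<^sup>+x. ennreal l * indicator {a..b} x \<partial>lborel)"
      using ab True by (subst nn_integral_cmult_indicator) (auto simp: ennreal_mult)
    also have "\<dots> \<le> emeasure \<nu> {a..b}"
      using lu by (subst emeasure_nu) (auto intro!: nn_integral_mono ennreal_leI split: split_indicator)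
    finally show ?thesis
      using ab True by (simp add: measure_Icc_eq_cdf[symmetric] emeasure_eq_measure)
  next
    case False
    then have "l * (b - a) \<le> 0" using ab by (intro mult_nonpos_nonneg) auto
    also have "0 \<le> cdf \<nu> b - cdf \<nu> a" using ab by (simp add: measure_Icc_eq_cdf[symmetric])
    finally show ?thesis .
  qed
qed

lemma cdf_Lipschitz: "\<bar>cdf \<nu> y - cdf \<nu> x\<bar> \<le> C * \<bar>y - x\<bar>"
  using cdf_diff_bounds[of x y 0 C] cdf_diff_bounds[of y x 0 C] f_nonneg f_le
  by (cases "x \<le> y") auto

lemma continuous_cdf: "continuous_on S (cdf \<nu>)"
proof (rule continuous_on_subset[OF _ subset_UNIV], rule lipschitz_on_continuous_on)
  show "C-lipschitz_on UNIV (cdf \<nu>)"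
    using cdf_Lipschitz C_pos by (intro lipschitz_onI) (auto simp: dist_real_def)
qed

text \<open>Between \<open>x\<close> and \<open>y\<close> the density differs from
  \<open>f x\<close> by at most \<open>C * \<bar>y - x\<bar>\<close>. Integrating this crude bound
  gives the constant \<open>C\<close>, twice the sharp one.\<close>

lemma cdf_Taylor: "\<bar>cdf \<nu> y - cdf \<nu> x - f x * (y - x)\<bar> \<le> C * (y - x)\<^sup>2"
proof (cases "x \<le> y")
  case True
  have "f x - C * (y - x) \<le> f z \<and> f z \<le> f x + C * (y - x)" if "x \<le> z" "z \<le> y" for z
  proof -
    have "C * \<bar>z - x\<bar> \<le> C * (y - x)" using that C_pos by (intro mult_left_mono) auto
    with f_Lipschitz[of z x] show ?thesis by linarith
  qed
  from cdf_diff_bounds[OF True this] show ?thesis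
    by (simp add: abs_le_iff algebra_simps power2_eq_square)
next
  case False
  then have le: "y \<le> x" by simp
  have "f x - C * (x - y) \<le> f z \<and> f z \<le> f x + C * (x - y)" if "y \<le> z" "z \<le> x" for z
  proof -
    have "C * \<bar>z - x\<bar> \<le> C * (x - y)" using that C_pos by (intro mult_left_mono) auto
    with f_Lipschitz[of z x] show ?thesis by linarith
  qed
  from cdf_diff_bounds[OF le this] show ?thesis
    by (simp add: abs_le_iff algebra_simps power2_eq_square)
qed

abbreviation V :: "real \<Rightarrow> real" where "V \<equiv> Vfun \<nu> \<alpha> (\<lambda>x. x)"

text \<open>The derivative of \<open>V\<close>, written through the cdf. It enters as the mean of
  \<open>H1\<close> and as the slope in \<open>V_Taylor\<close>, so no differentiation under the
  integral is carried out.\<close>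

definition V' :: "real \<Rightarrow> real" where "V' \<xi> = (cdf \<nu> \<xi> - \<alpha>) / (1 - \<alpha>)"

lemma V'_measurable [measurable]: "V' \<in> borel_measurable borel"
  unfolding V'_def[abs_def] using borel_measurable_continuous_onI[OF continuous_cdf] by measurable

lemma integrable_pos_part [simp]: "integrable \<nu> (\<lambda>x. max 0 (x - \<xi>))"
proof (rule Bochner_Integration.integrable_bound)
  show "integrable \<nu> (\<lambda>x. \<bar>x\<bar> + \<bar>\<xi>\<bar>)" using mean_finite by auto
qed auto

lemma integrable_tail_indicator [simp]: "integrable \<nu> (\<lambda>x. if \<xi> \<le> x then 1 else 0 :: real)"
  by (rule integrable_const_bound[where B=1]) auto

lemma integral_tail_indicator: "(\<integral>x. (if \<xi> \<le> x then 1 else 0) \<partial>\<nu>) = 1 - cdf \<nu> \<xi>"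
proof -
  have "(\<integral>x. (if \<xi> \<le> x then 1 else 0 :: real) \<partial>\<nu>) = (\<integral>x. indicator {\<xi>..} x \<partial>\<nu>)"
    by (intro Bochner_Integration.integral_cong) (auto split: split_indicator)
  then show ?thesis by (simp add: measure_atLeast)
qed

lemma integrable_H1 [simp]: "integrable \<nu> (H1 \<alpha> \<xi>)"
  unfolding H1_def[abs_def] by auto

lemma integral_H1: "(\<integral>x. H1 \<alpha> \<xi> x \<partial>\<nu>) = V' \<xi>"
  using alpha prob_space
  by (simp add: H1_def integral_tail_indicator V'_def field_simps)

text \<open>Up to the factor \<open>1 - \<alpha>\<close> the remainder is the integral of
  \<open>g\<close>, which is nonnegative, lives between \<xi> and \<eta>, and is at most
  \<open>\<bar>\<eta> - \<xi>\<bar>\<close> there; the mass of that interval contributes the second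
  factor \<open>\<bar>\<eta> - \<xi>\<bar>\<close>.\<close>

lemma V_Taylor:
  "0 \<le> V \<eta> - V \<xi> - (\<eta> - \<xi>) * V' \<xi>" (is ?lower)
  "V \<eta> - V \<xi> - (\<eta> - \<xi>) * V' \<xi> \<le> C / (1 - \<alpha>) * (\<eta> - \<xi>)\<^sup>2" (is ?upper)
proof -
  define g where "g x = max 0 (x - \<eta>) - max 0 (x - \<xi>) + (\<eta> - \<xi>) * (if \<xi> \<le> x then 1 else 0)" for x
  have g_int: "integrable \<nu> g" unfolding g_def[abs_def] by auto
  have g_bnd: "0 \<le> g x" "g x \<le> \<bar>\<eta> - \<xi>\<bar> * indicator {min \<xi> \<eta>..max \<xi> \<eta>} x" for x
    by (auto simp: g_def split: split_indicator)
  have "integral\<^sup>L \<nu> g = (\<integral>x. max 0 (x - \<eta>) \<partial>\<nu>) - (\<integral>x. max 0 (x - \<xi>) \<partial>\<nu>) + (\<eta> - \<xi>) * (1 - cdf \<nu> \<xi>)"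
    unfolding g_def[abs_def] by (simp add: integral_tail_indicator)
  then have eq: "V \<eta> - V \<xi> - (\<eta> - \<xi>) * V' \<xi> = integral\<^sup>L \<nu> g / (1 - \<alpha>)"
  proof -
    define q where "q = 1 - \<alpha>"
    have "q \<noteq> 0" using alpha by (simp add: q_def)
    then have "\<eta> + A / q - (\<xi> + B / q) - (\<eta> - \<xi>) * ((F - (1 - q)) / q) = (A - B + (\<eta> - \<xi>) * (1 - F)) / q" for A B F
      by (simp add: field_simps)
    then show ?thesis
      using \<open>integral\<^sup>L \<nu> g = _\<close> by (simp add: Vfun_def V'_def q_def)
  qed
  show ?lower unfolding eq using alpha g_bnd(1) by (intro divide_nonneg_nonneg integral_nonneg_AE) auto
  have "integral\<^sup>L \<nu> g \<le> (\<integral>x. \<bar>\<eta> - \<xi>\<bar> * indicator {min \<xi> \<eta>..max \<xi> \<eta>} x \<partial>\<nu>)"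
    by (intro integral_mono g_int g_bnd integrable_mult_right integrable_real_indicator)
       (auto simp: emeasure_eq_measure)
  also have "\<dots> = \<bar>\<eta> - \<xi>\<bar> * (cdf \<nu> (max \<xi> \<eta>) - cdf \<nu> (min \<xi> \<eta>))"
    by (simp add: measure_Icc_eq_cdf)
  also have "\<dots> \<le> \<bar>\<eta> - \<xi>\<bar> * (C * \<bar>\<eta> - \<xi>\<bar>)"
    using cdf_Lipschitz[of "max \<xi> \<eta>" "min \<xi> \<eta>"] by (intro mult_left_mono) (auto simp: max_def min_def split: if_splits)
  finally have "integral\<^sup>L \<nu> g \<le> C * (\<eta> - \<xi>)\<^sup>2" by (simp add: power2_eq_square abs_mult_self_eq algebra_simps)
  then show ?upper unfolding eq using alpha by (simp add: divide_right_mono)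
qed

lemma V_minimizer_iff: "(\<forall>\<eta>. V \<xi> \<le> V \<eta>) \<longleftrightarrow> cdf \<nu> \<xi> = \<alpha>"
proof
  assume "cdf \<nu> \<xi> = \<alpha>"
  then have "V' \<xi> = 0" by (simp add: V'_def)
  then show "\<forall>\<eta>. V \<xi> \<le> V \<eta>" using V_Taylor(1)[of _ \<xi>] by auto
next
  assume min: "\<forall>\<eta>. V \<xi> \<le> V \<eta>"
  define c where "c = C / (1 - \<alpha>)"
  have c: "0 < c" using C_pos alpha by (simp add: c_def)
  \<comment> \<open>This point minimizes the quadratic upper bound of \<open>V_Taylor\<close>, whose
    value there is negative unless the slope vanishes.\<close>
  define \<eta> where "\<eta> = \<xi> - V' \<xi> / (2 * c)"
  have "0 \<le> V \<eta> - V \<xi>" using min by simp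
  also have "\<dots> \<le> (\<eta> - \<xi>) * V' \<xi> + c * (\<eta> - \<xi>)\<^sup>2" using V_Taylor(2)[of \<eta> \<xi>] by (simp add: c_def)
  also have "\<dots> = - (V' \<xi>)\<^sup>2 / (4 * c)" using c by (simp add: \<eta>_def power2_eq_square field_simps)
  finally have "(V' \<xi>)\<^sup>2 \<le> 0" using c by (simp add: divide_le_0_iff field_simps)
  then show "cdf \<nu> \<xi> = \<alpha>" using alpha by (simp add: V'_def)
qed

lemma quantile_exists: "\<exists>\<xi>. cdf \<nu> \<xi> = \<alpha>"
proof -
  obtain a where a: "cdf \<nu> a < \<alpha>"
    using order_tendstoD(2)[OF cdf_lim_at_bot, of \<alpha>] alpha by (auto simp: eventually_at_bot_linorder)
  obtain b where b: "cdf \<nu> b > \<alpha>"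
    using order_tendstoD(1)[OF cdf_lim_at_top_prob, of \<alpha>] alpha by (auto simp: eventually_at_top_linorder)
  have "a \<le> b" using a b cdf_nondecreasing[of b a] by (cases "a \<le> b") auto
  with a b show ?thesis
    using IVT'[of "cdf \<nu>" a \<alpha> b] continuous_cdf by force
qed

lemma V_Lipschitz: "\<bar>V x - V y\<bar> \<le> (1 + 1 / (1 - \<alpha>)) * \<bar>x - y\<bar>"
proof -
  have "\<bar>(\<integral>z. max 0 (z - x) \<partial>\<nu>) - (\<integral>z. max 0 (z - y) \<partial>\<nu>)\<bar> = \<bar>\<integral>z. max 0 (z - x) - max 0 (z - y) \<partial>\<nu>\<bar>" by simp
  also have "\<dots> \<le> (\<integral>z. \<bar>max 0 (z - x) - max 0 (z - y)\<bar> \<partial>\<nu>)" by (rule integral_abs_bound)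
  also have "\<dots> \<le> (\<integral>z. \<bar>x - y\<bar> \<partial>\<nu>)" by (intro integral_mono) auto
  also have "\<dots> = \<bar>x - y\<bar>" using prob_space by simp
  finally have "\<bar>((\<integral>z. max 0 (z - x) \<partial>\<nu>) - (\<integral>z. max 0 (z - y) \<partial>\<nu>)) / (1 - \<alpha>)\<bar> \<le> \<bar>x - y\<bar> / (1 - \<alpha>)"
    using alpha by (simp add: abs_divide divide_right_mono)
  moreover have "V x - V y = (x - y) + ((\<integral>z. max 0 (z - x) \<partial>\<nu>) - (\<integral>z. max 0 (z - y) \<partial>\<nu>)) / (1 - \<alpha>)"
    by (simp add: Vfun_def diff_divide_distrib)
  moreover have "(1 + 1 / (1 - \<alpha>)) * \<bar>x - y\<bar> = \<bar>x - y\<bar> + \<bar>x - y\<bar> / (1 - \<alpha>)" by (simp add: distrib_right)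
  ultimately show ?thesis by linarith
qed

end

section \<open>Adapted processes driven by i.i.d. variables\<close>

text \<open>Joins the initial value, at index 0, and the driving sequence into one independent
  family. Index 0 splits off by independence from the whole sequence, the remaining indices by
  independence within it.\<close>

lemma (in prob_space) indep_vars_case_nat:
  fixes x0 :: "'a \<Rightarrow> real" and X :: "nat \<Rightarrow> 'a \<Rightarrow> real"
  assumes X: "indep_vars (\<lambda>_. borel) X UNIV"
    and x0X: "indep_var2 M borel x0 (\<Pi>\<^sub>M n\<in>UNIV. borel) (\<lambda>\<omega> n. X n \<omega>)"
  shows "indep_vars (\<lambda>_. borel) (case_nat x0 X) UNIV"
proof -
  have m [measurable]: "x0 \<in> borel_measurable M" "X n \<in> borel_measurable M" for n
    using x0X X by (auto simp: indep_var2_def indep_vars_def2)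
  have ind: "indep_set (sigma_sets (space M) {x0 -` S \<inter> space M | S. S \<in> sets borel})
       (sigma_sets (space M) {(\<lambda>\<omega> n. X n \<omega>) -` S \<inter> space M | S. S \<in> sets (\<Pi>\<^sub>M n\<in>UNIV. borel)})"
    using x0X by (auto simp: indep_var2_def)
  have Xs: "indep_sets (\<lambda>i. {X i -` A \<inter> space M | A. A \<in> sets borel}) UNIV"
    using X by (simp add: indep_vars_def2)
  let ?F = "\<lambda>i. {case_nat x0 X i -` A \<inter> space M | A. A \<in> sets borel}"
  have "indep_sets ?F UNIV"
  proof (rule indep_setsI)
    show "?F i \<subseteq> events" for i by (cases i) auto
  next
    fix A J assume J: "J \<noteq> {}" "J \<subseteq> UNIV" "finite J" and A: "\<forall>j\<in>J. A j \<in> ?F j"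
    define J' where "J' = {j. Suc j \<in> J}"
    have J': "finite J'" unfolding J'_def using J(3) by (rule finite_vimageI[of J Suc, unfolded vimage_def]) auto
    have prodJ': "prob (\<Inter>j\<in>J'. A (Suc j)) = (\<Prod>j\<in>J'. prob (A (Suc j)))" if "J' \<noteq> {}"
    proof (rule indep_setsD[OF Xs _ that J'])
      show "\<forall>j\<in>J'. A (Suc j) \<in> {X j -` S \<inter> space M | S. S \<in> sets borel}"
      proof
        fix j assume "j \<in> J'"
        then show "A (Suc j) \<in> {X j -` S \<inter> space M | S. S \<in> sets borel}"
          using bspec[OF A, of "Suc j"] by (auto simp: J'_def)
      qed
    qed simp
    have SucJ': "(\<Inter>j\<in>Suc ` J'. A j) = (\<Inter>j\<in>J'. A (Suc j))" "(\<Prod>j\<in>Suc ` J'. prob (A j)) = (\<Prod>j\<in>J'. prob (A (Suc j)))"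
      by (auto simp: prod.reindex)
    show "prob (\<Inter>j\<in>J. A j) = (\<Prod>j\<in>J. prob (A j))"
    proof (cases "0 \<in> J")
      case False
      then have "J = Suc ` J'" by (auto simp: J'_def image_iff) (metis not0_implies_Suc)
      with J prodJ' SucJ' show ?thesis by simp
    next
      case True
      then have Jeq: "J = insert 0 (Suc ` J')" by (auto simp: J'_def image_iff) (metis not0_implies_Suc)
      show ?thesis
      proof (cases "J' = {}")
        case True
        then show ?thesis by (simp add: Jeq)
      next
        case False
        have "\<forall>j\<in>J'. \<exists>S. S \<in> sets borel \<and> A (Suc j) = X j -` S \<inter> space M"
        proof
          fix j assume "j \<in> J'"
          then show "\<exists>S. S \<in> sets borel \<and> A (Suc j) = X j -` S \<inter> space M"
            using bspec[OF A, of "Suc j"] by (auto simp: J'_def)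
        qed
        then obtain S where S: "\<And>j. j \<in> J' \<Longrightarrow> S j \<in> sets borel \<and> A (Suc j) = X j -` S j \<inter> space M"
          by metis
        \<comment> \<open>A cylinder set that presents the finitely many events at later indices as
          one event of the whole sequence, the form in which independence from \<open>x0\<close> is
          given.\<close>
        let ?T = "\<Inter>j\<in>J'. {x \<in> space (\<Pi>\<^sub>M n\<in>UNIV. borel). x j \<in> S j}"
        have T: "?T \<in> sets (\<Pi>\<^sub>M n\<in>UNIV. borel)"
        proof (intro sets.finite_INT J' False)
          fix j assume "j \<in> J'"
          with S have [measurable]: "S j \<in> sets borel" by blast
          show "{x \<in> space (\<Pi>\<^sub>M n\<in>UNIV. borel). x j \<in> S j} \<in> sets (\<Pi>\<^sub>M n\<in>UNIV. borel)"
            by measurable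
        qed
        have eq: "(\<Inter>j\<in>J'. A (Suc j)) = (\<lambda>\<omega> n. X n \<omega>) -` ?T \<inter> space M"
          using S False by (auto simp: space_PiM)
        have A0: "A 0 \<in> sigma_sets (space M) {x0 -` S \<inter> space M | S. S \<in> sets borel}"
          using A True by (intro sigma_sets.Basic) (auto dest!: bspec[of J _ 0])
        have A1: "(\<Inter>j\<in>J'. A (Suc j)) \<in> sigma_sets (space M) {(\<lambda>\<omega> n. X n \<omega>) -` S \<inter> space M | S. S \<in> sets (\<Pi>\<^sub>M n\<in>UNIV. borel)}"
          unfolding eq using T by (intro sigma_sets.Basic) blast
        have "prob (A 0 \<inter> (\<Inter>j\<in>J'. A (Suc j))) = prob (A 0) * prob (\<Inter>j\<in>J'. A (Suc j))"
          by (rule indep_setD[OF ind A0 A1])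
        then show ?thesis
          unfolding Jeq using prodJ'[OF False] J' SucJ' by (subst prod.insert) auto
      qed
    qed
  qed
  moreover have "case_nat x0 X i \<in> borel_measurable M" for i by (cases i) auto
  ultimately show ?thesis unfolding indep_vars_def2 by blast
qed

locale iid_chain = prob_space M for M :: "'m measure" +
  fixes x0 :: "'m \<Rightarrow> real" and X :: "nat \<Rightarrow> 'm \<Rightarrow> real" and \<nu> :: "real measure"
  assumes indep: "indep_vars (\<lambda>_. borel) (case_nat x0 X) UNIV"
    and distr_X: "\<And>n. distr M borel (X n) = \<nu>"
begin

lemma x0_measurable [measurable]: "x0 \<in> borel_measurable M"
  and X_measurable [measurable]: "X n \<in> borel_measurable M"
proof -
  have "case_nat x0 X i \<in> borel_measurable M" for i using indep by (simp add: indep_vars_def2)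
  from this[of 0] this[of "Suc n"] show "x0 \<in> borel_measurable M" "X n \<in> borel_measurable M" by auto
qed

text \<open>Index 0 holds the initial value and index \<open>Suc k\<close> holds \<open>X k\<close>.
  So the history up to \<open>n\<close> contains \<open>X 0\<close> to \<open>X (n - 1)\<close> but
  not \<open>X n\<close>, which makes the \<open>n\<close>-th iterate a function of it.\<close>

definition history :: "nat \<Rightarrow> 'm \<Rightarrow> nat \<Rightarrow> real" where
  "history n \<omega> = restrict (\<lambda>i. case_nat x0 X i \<omega>) {..n}"

text \<open>As a pullback along \<open>history n\<close>, every event of the past is literally a
  preimage under the history. This lets independence of coordinates carry over to anything
  measurable in the past.\<close>

definition past :: "nat \<Rightarrow> 'm measure" where
  "past n = vimage_algebra (space M) (history n) (\<Pi>\<^sub>M i\<in>{..n}. borel)"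

lemma history_measurable [measurable]: "history n \<in> measurable M (\<Pi>\<^sub>M i\<in>{..n}. borel)"
proof -
  have "case_nat x0 X i \<in> borel_measurable M" for i by (cases i) auto
  then show ?thesis unfolding history_def[abs_def] by (intro measurable_restrict) auto
qed

lemma space_past [simp]: "space (past n) = space M" by (simp add: past_def)

lemma sets_past: "sets (past n) = {history n -` S \<inter> space M | S. S \<in> sets (\<Pi>\<^sub>M i\<in>{..n}. borel)}"
  unfolding past_def using measurable_space[OF history_measurable]
  by (intro sets_vimage_algebra2) auto

lemma measurable_past_imp: "A \<in> measurable (past n) N \<Longrightarrow> A \<in> measurable M N"
proof -
  have "sets (past n) \<subseteq> sets M"
    unfolding sets_past by (auto intro: measurable_sets)
  then show "A \<in> measurable (past n) N \<Longrightarrow> A \<in> measurable M N"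
    by (auto simp: measurable_def)
qed

lemma case_nat_past: "i \<le> n \<Longrightarrow> case_nat x0 X i \<in> borel_measurable (past n)"
proof -
  assume i: "i \<le> n"
  have "history n \<in> measurable (past n) (\<Pi>\<^sub>M i\<in>{..n}. borel)"
    unfolding past_def by (rule measurable_vimage_algebra1) (use measurable_space[OF history_measurable] in auto)
  then have "(\<lambda>\<omega>. history n \<omega> i) \<in> borel_measurable (past n)"
    by (rule measurable_compose[OF _ measurable_component_singleton]) (use i in simp)
  then show ?thesis using i by (simp add: history_def)
qed

lemma x0_past: "x0 \<in> borel_measurable (past n)"
  using case_nat_past[of 0 n] by simp

lemma X_past: "k < n \<Longrightarrow> X k \<in> borel_measurable (past n)"
  using case_nat_past[of "Suc k" n] by simp

text \<open>Events of \<open>A\<close> are preimages under \<open>history n\<close>, and this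
  history and coordinate \<open>Suc n\<close> restrict an independent family to disjoint index sets.
  Hence the joint law is a product.\<close>

lemma distr_past_pair:
  assumes A: "A \<in> measurable (past n) N"
  shows "distr M N A \<Otimes>\<^sub>M \<nu> = distr M (N \<Otimes>\<^sub>M borel) (\<lambda>\<omega>. (A \<omega>, X n \<omega>))"
proof (rule pair_measure_eqI)
  have Am [measurable]: "A \<in> measurable M N" by (rule measurable_past_imp[OF A])
  interpret A: prob_space "distr M N A" by (rule prob_space_distr) fact
  interpret \<nu>: prob_space \<nu> unfolding distr_X[of 0, symmetric] by (rule prob_space_distr) simp
  show "sigma_finite_measure (distr M N A)" "sigma_finite_measure \<nu>" by unfold_locales
  have sets\<nu>: "sets \<nu> = sets borel" unfolding distr_X[of 0, symmetric] by simp
  show "sets (distr M N A \<Otimes>\<^sub>M \<nu>) = sets (distr M (N \<Otimes>\<^sub>M borel) (\<lambda>\<omega>. (A \<omega>, X n \<omega>)))"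
    using sets\<nu> by (simp cong: sets_pair_measure_cong)
  fix S T assume "S \<in> sets (distr M N A)" "T \<in> sets \<nu>"
  then have S [measurable]: "S \<in> sets N" and T [measurable]: "T \<in> sets borel" using sets\<nu> by auto
  have "A -` S \<inter> space M \<in> sets (past n)" using measurable_sets[OF A S] by simp
  then obtain S' where S': "S' \<in> sets (\<Pi>\<^sub>M i\<in>{..n}. borel)" "A -` S \<inter> space M = history n -` S' \<inter> space M"
    unfolding sets_past by auto
  let ?R = "\<lambda>\<omega>. restrict (\<lambda>i. case_nat x0 X i \<omega>) {Suc n}"
  have iv: "indep_var (\<Pi>\<^sub>M i\<in>{..n}. borel) (history n) (\<Pi>\<^sub>M i\<in>{Suc n}. borel) ?R"
    unfolding history_def[abs_def] by (rule indep_var_restrict[OF indep]) auto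
  let ?T = "{x \<in> space (\<Pi>\<^sub>M i\<in>{Suc n}. borel). x (Suc n) \<in> T}"
  have T': "?T \<in> sets (\<Pi>\<^sub>M i\<in>{Suc n}. borel)" by measurable
  have R: "?R -` ?T \<inter> space M = X n -` T \<inter> space M" by (auto simp: space_PiM)
  have "emeasure M ((\<lambda>\<omega>. (A \<omega>, X n \<omega>)) -` (S \<times> T) \<inter> space M)
      = emeasure M ((A -` S \<inter> space M) \<inter> (X n -` T \<inter> space M))"
    by (rule arg_cong[where f="emeasure M"]) auto
  also have "\<dots> = emeasure M ((\<lambda>\<omega>. (history n \<omega>, ?R \<omega>)) -` (S' \<times> ?T) \<inter> space M)"
    unfolding S'(2) R[symmetric] by (rule arg_cong[where f="emeasure M"]) auto
  also have "\<dots> = emeasure M (A -` S \<inter> space M) * emeasure M (X n -` T \<inter> space M)"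
    unfolding S'(2) R[symmetric] emeasure_eq_measure indep_varD[OF iv S'(1) T']
    by (simp add: ennreal_mult)
  finally show "emeasure (distr M N A) S * emeasure \<nu> T = emeasure (distr M (N \<Otimes>\<^sub>M borel) (\<lambda>\<omega>. (A \<omega>, X n \<omega>))) (S \<times> T)"
    unfolding distr_X[of n, symmetric] by (simp add: emeasure_distr)
qed

text \<open>Conditioning on the past in integrated form: with the product law of the pair it is
  Fubini's theorem, and conditional expectations do not appear.\<close>

lemma
  fixes G :: "'b \<times> real \<Rightarrow> real"
  assumes A: "A \<in> measurable (past n) N" and G [measurable]: "G \<in> borel_measurable (N \<Otimes>\<^sub>M borel)"
    and int: "integrable M (\<lambda>\<omega>. G (A \<omega>, X n \<omega>))"
  shows expectation_past: "expectation (\<lambda>\<omega>. G (A \<omega>, X n \<omega>)) = expectation (\<lambda>\<omega>. \<integral>x. G (A \<omega>, x) \<partial>\<nu>)"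
    and integrable_past: "integrable M (\<lambda>\<omega>. \<integral>x. G (A \<omega>, x) \<partial>\<nu>)"
proof -
  have Am [measurable]: "A \<in> measurable M N" by (rule measurable_past_imp[OF A])
  interpret A: prob_space "distr M N A" by (rule prob_space_distr) fact
  interpret \<nu>: prob_space \<nu> unfolding distr_X[of 0, symmetric] by (rule prob_space_distr) simp
  interpret P: pair_prob_space "distr M N A" \<nu> ..
  have sets\<nu> [measurable_cong]: "sets \<nu> = sets borel" unfolding distr_X[of 0, symmetric] by simp
  have I: "integrable (distr M N A \<Otimes>\<^sub>M \<nu>) G"
    unfolding distr_past_pair[OF A] using int by (simp add: integrable_distr_eq)
  have "expectation (\<lambda>\<omega>. G (A \<omega>, X n \<omega>)) = integral\<^sup>L (distr M N A \<Otimes>\<^sub>M \<nu>) G"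
    unfolding distr_past_pair[OF A] by (simp add: integral_distr)
  also have "\<dots> = (\<integral>a. (\<integral>x. G (a, x) \<partial>\<nu>) \<partial>distr M N A)"
    by (rule P.integral_fst'[OF I, symmetric])
  also have "\<dots> = expectation (\<lambda>\<omega>. \<integral>x. G (A \<omega>, x) \<partial>\<nu>)"
    by (intro integral_distr) measurable
  finally show "expectation (\<lambda>\<omega>. G (A \<omega>, X n \<omega>)) = expectation (\<lambda>\<omega>. \<integral>x. G (A \<omega>, x) \<partial>\<nu>)" .
  have "integrable (distr M N A) (\<lambda>a. \<integral>x. G (a, x) \<partial>\<nu>)"
    by (rule P.integrable_fst'[OF I])
  then show "integrable M (\<lambda>\<omega>. \<integral>x. G (A \<omega>, x) \<partial>\<nu>)"
    by (subst (asm) integrable_distr_eq) auto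
qed

text \<open>Martingale increments are orthogonal: integrating out the newest sample first
  annihilates the cross term, because \<open>G z\<close> is centered for every fixed
  \<open>z\<close>.\<close>

lemma martingale_second_moment:
  fixes Z :: "nat \<Rightarrow> 'm \<Rightarrow> real" and G :: "real \<Rightarrow> real \<Rightarrow> real"
  assumes Z: "\<And>n. Z n \<in> borel_measurable (past n)"
    and G [measurable]: "(\<lambda>p. G (fst p) (snd p)) \<in> borel_measurable (borel \<Otimes>\<^sub>M borel)"
    and centered: "\<And>z. (\<integral>x. G z x \<partial>\<nu>) = 0"
    and int: "\<And>n. integrable M (\<lambda>\<omega>. (G (Z n \<omega>) (X n \<omega>))\<^sup>2)"
    and le: "\<And>n. expectation (\<lambda>\<omega>. (G (Z n \<omega>) (X n \<omega>))\<^sup>2) \<le> b n"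
  shows "integrable M (\<lambda>\<omega>. (\<Sum>k<n. G (Z k \<omega>) (X k \<omega>))\<^sup>2) \<and>
         expectation (\<lambda>\<omega>. (\<Sum>k<n. G (Z k \<omega>) (X k \<omega>))\<^sup>2) \<le> (\<Sum>k<n. b k)"
proof (induction n)
  case 0
  show ?case by simp
next
  case (Suc n)
  define S where "S \<omega> = (\<Sum>k<n. G (Z k \<omega>) (X k \<omega>))" for \<omega>
  define d where "d \<omega> = G (Z n \<omega>) (X n \<omega>)" for \<omega>
  have G2: "(\<lambda>\<omega>. G (U \<omega>) (W \<omega>)) \<in> borel_measurable L"
    if "U \<in> borel_measurable L" "W \<in> borel_measurable L" for U W and L :: "'c measure"
    using measurable_compose[OF measurable_Pair[OF that] G] by simp
  have "Z k \<in> borel_measurable (past n)" if "k \<le> n" for k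
  proof -
    have "(\<lambda>\<omega>. history k \<omega>) \<in> measurable (past n) (\<Pi>\<^sub>M i\<in>{..k}. borel)"
      unfolding history_def using case_nat_past that by (intro measurable_restrict) auto
    then have "(\<lambda>\<omega>. \<omega>) \<in> measurable (past n) (past k)"
      unfolding past_def[of k] by (intro measurable_vimage_algebra2) auto
    from measurable_compose[OF this Z[of k]] show ?thesis .
  qed
  then have Sp: "S \<in> borel_measurable (past n)"
    unfolding S_def using X_past by (intro borel_measurable_sum G2) auto
  have [measurable]: "S \<in> borel_measurable M" "Z n \<in> borel_measurable M"
    using measurable_past_imp[OF Sp] measurable_past_imp[OF Z] by auto
  have [measurable]: "d \<in> borel_measurable M" unfolding d_def by (intro G2) auto
  have S2: "integrable M (\<lambda>\<omega>. (S \<omega>)\<^sup>2)" "expectation (\<lambda>\<omega>. (S \<omega>)\<^sup>2) \<le> (\<Sum>k<n. b k)"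
    using Suc unfolding S_def by auto
  have d2: "integrable M (\<lambda>\<omega>. (d \<omega>)\<^sup>2)" "expectation (\<lambda>\<omega>. (d \<omega>)\<^sup>2) \<le> b n"
    using int le unfolding d_def by auto
  have Sd: "integrable M (\<lambda>\<omega>. S \<omega> * d \<omega>)"
  proof (rule Bochner_Integration.integrable_bound[where f="\<lambda>\<omega>. (S \<omega>)\<^sup>2 + (d \<omega>)\<^sup>2"])
    have "\<bar>x * y\<bar> \<le> x\<^sup>2 + y\<^sup>2" for x y :: real
    proof -
      have "0 \<le> \<bar>x\<bar> * \<bar>y\<bar>" by simp
      moreover have "2 * (\<bar>x\<bar> * \<bar>y\<bar>) \<le> x\<^sup>2 + y\<^sup>2"
        using sum_squares_bound[of "\<bar>x\<bar>" "\<bar>y\<bar>"] by (simp add: mult.assoc)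
      ultimately show ?thesis unfolding abs_mult by linarith
    qed
    then show "AE \<omega> in M. norm (S \<omega> * d \<omega>) \<le> norm ((S \<omega>)\<^sup>2 + (d \<omega>)\<^sup>2)" by auto
  qed (use S2 d2 in auto)
  have "expectation (\<lambda>\<omega>. S \<omega> * d \<omega>) = expectation (\<lambda>\<omega>. \<integral>x. S \<omega> * G (Z n \<omega>) x \<partial>\<nu>)"
  proof -
    \<comment> \<open>The partial sum and the current state are carried together as one quantity of
      the past, so that only \<open>X n\<close> is integrated out.\<close>
    let ?A = "\<lambda>\<omega>. (S \<omega>, Z n \<omega>)" and ?G = "\<lambda>p :: (real \<times> real) \<times> real. fst (fst p) * G (snd (fst p)) (snd p)"
    have "?A \<in> measurable (past n) (borel \<Otimes>\<^sub>M borel)" using Sp Z by measurable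
    moreover have "?G \<in> borel_measurable ((borel \<Otimes>\<^sub>M borel) \<Otimes>\<^sub>M borel)"
      by (intro borel_measurable_times G2) measurable
    ultimately show ?thesis using expectation_past[of ?A n _ ?G] Sd by (simp add: d_def)
  qed
  also have "\<dots> = 0" by (simp add: centered)
  finally have cross: "expectation (\<lambda>\<omega>. S \<omega> * d \<omega>) = 0" .
  have eq: "(\<Sum>k<Suc n. G (Z k \<omega>) (X k \<omega>))\<^sup>2 = (S \<omega>)\<^sup>2 + 2 * (S \<omega> * d \<omega>) + (d \<omega>)\<^sup>2" for \<omega>
    by (simp add: S_def d_def power2_sum)
  show ?case
    unfolding eq using S2 d2 Sd cross by simp
qed

end

section \<open>Second moments of the quantile iterates\<close>

lemma cosh_minus_one_ge: "x\<^sup>2 / 2 \<le> cosh x - 1" for x :: real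
proof -
  have "\<bar>x / 2\<bar> \<le> \<bar>sinh (x / 2)\<bar>"
    using real_le_abs_sinh[of "x / 2"] by (simp add: sinh_field_def exp_minus)
  then have "(x / 2)\<^sup>2 \<le> (sinh (x / 2))\<^sup>2" by (simp only: abs_le_square_iff)
  moreover have "cosh x = 2 * (sinh (x / 2))\<^sup>2 + 1"
    using cosh_double_cosh[of "x / 2"] by (simp add: cosh_square_eq)
  ultimately show ?thesis by (simp add: power_divide)
qed

text \<open>The first bound serves far from the quantile, where the drift is only bounded below; the
  second serves near it, where the drift is linear.\<close>

lemma cosh_minus_one_le:
  fixes x :: real
  assumes "0 \<le> x"
  shows "cosh x - 1 \<le> sinh x" "cosh x - 1 \<le> x * sinh x"
proof -
  show "cosh x - 1 \<le> sinh x"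
    using assms cosh_minus_sinh[of x] by (simp add: algebra_simps)
  show "cosh x - 1 \<le> x * sinh x"
  proof (cases "x = 0")
    case False
    then have "0 < x" using assms by simp
    then have "\<exists>z. 0 < z \<and> z < x \<and> cosh x - cosh 0 = (x - 0) * sinh z"
      by (rule MVT2) (auto intro!: derivative_eq_intros)
    then obtain z where z: "0 < z" "z < x" "cosh x - cosh 0 = (x - 0) * sinh z" by blast
    moreover have "x * sinh z \<le> x * sinh x" using z by (intro mult_left_mono) auto
    ultimately show ?thesis by simp
  qed simp
qed

text \<open>Expanding both exponentials to second order leaves a remainder proportional to
  \<open>cosh a\<close>. The expected one-step bound thus involves the Lyapunov function itself and
  the recursion closes.\<close>

lemma cosh_add_le:
  fixes a b :: real
  assumes "\<bar>b\<bar> \<le> B"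
  shows "cosh (a + b) \<le> cosh a + b * sinh a + exp B * b\<^sup>2 * cosh a"
proof -
  have ex: "exp y \<le> 1 + y + exp B * y\<^sup>2" if "\<bar>y\<bar> \<le> B" for y
  proof -
    obtain t where t: "\<bar>t\<bar> \<le> \<bar>y\<bar>" "exp y = (\<Sum>m<2. y ^ m / fact m) + exp t / fact 2 * y ^ 2"
      using Maclaurin_exp_le[of y 2] by blast
    have "exp t / 2 \<le> exp B" using t(1) that exp_ge_zero[of B]
      by (smt (verit, best) exp_le_cancel_iff field_sum_of_halves exp_gt_zero)
    then have "exp t / 2 * y\<^sup>2 \<le> exp B * y\<^sup>2" by (intro mult_right_mono) auto
    with t(2) show ?thesis by (simp add: numeral_2_eq_2)
  qed
  have "cosh (a + b) = (exp a * exp b + exp (-a) * exp (-b)) / 2"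
    by (simp add: cosh_field_def exp_add exp_diff exp_minus field_simps)
  also have "\<dots> \<le> (exp a * (1 + b + exp B * b\<^sup>2) + exp (-a) * (1 + (-b) + exp B * (-b)\<^sup>2)) / 2"
    using assms ex[of b] ex[of "-b"] by (intro divide_right_mono add_mono mult_left_mono) auto
  also have "\<dots> = cosh a + b * sinh a + exp B * b\<^sup>2 * cosh a"
    by (simp add: cosh_field_def sinh_field_def field_simps)
  finally show ?thesis .
qed

lemma cosh_add_le_exp: "cosh (a + b) \<le> exp \<bar>b\<bar> * cosh a" for a b :: real
proof -
  have "exp (a + b) \<le> exp \<bar>b\<bar> * exp a" "exp (- (a + b)) \<le> exp \<bar>b\<bar> * exp (- a)"
    by (auto simp flip: exp_add)
  then show ?thesis by (simp add: cosh_field_def field_simps)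
qed

lemma abs_sinh_le_cosh: "\<bar>sinh x\<bar> \<le> cosh x" for x :: real
  using sinh_le_cosh_real[of "\<bar>x\<bar>"] by simp

text \<open>A number in [0,1] is at most its \<beta>-th power. Applied to the ratio of consecutive
  integers, this bounds the one-step decrease of the target rate by its \<open>Suc n\<close>-th
  part.\<close>

lemma powr_neg_succ_ge:
  fixes \<beta> :: real
  assumes "0 < \<beta>" "\<beta> < 1"
  shows "real (Suc n) powr (-\<beta>) - real (Suc n) powr (-\<beta>) / real (Suc n) \<le> real (Suc (Suc n)) powr (-\<beta>)"
proof -
  have "real (Suc n) powr (-\<beta>) * (1 - 1 / real (Suc n)) \<le> real (Suc n) powr (-\<beta>) * (real (Suc n) / real (Suc (Suc n)))"
    by (intro mult_left_mono) (auto simp: field_simps)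
  also have "\<dots> \<le> real (Suc n) powr (-\<beta>) * (real (Suc n) / real (Suc (Suc n))) powr \<beta>"
    using powr_mono'[of \<beta> 1 "real (Suc n) / real (Suc (Suc n))"] assms
    by (intro mult_left_mono) auto
  also have "\<dots> = real (Suc (Suc n)) powr (-\<beta>)"
    by (simp add: powr_divide powr_minus field_simps)
  finally show ?thesis by (simp add: right_diff_distrib)
qed

text \<open>\<open>A\<close> is chosen before \<open>L\<close>, so one constant serves the
  recursions of all \<open>K\<close>. From some \<open>n0\<close> on, half of the contraction
  absorbs the quadratic term in the factor, and the rest covers the additive noise and the decrease
  of the rate, because \<beta> < 1 makes \<open>1 / n\<close> small against the step. Up to
  \<open>n0\<close> only finitely many values have to be bounded.\<close>

lemma stochastic_approximation_recursion:
  fixes c C L0 g1 \<beta> :: real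
  assumes c: "0 < c" and C: "0 \<le> C" and g1: "0 < g1" and \<beta>: "0 < \<beta>" "\<beta> < 1"
  defines "g \<equiv> \<lambda>n. g1 * real (Suc n) powr (-\<beta>)"
  shows "\<exists>A>0. \<forall>L :: nat \<Rightarrow> real. (\<forall>n. 0 \<le> L n) \<longrightarrow> L 0 \<le> L0 \<longrightarrow>
     (\<forall>n. L (Suc n) \<le> (1 - c * g n + C * (g n)\<^sup>2) * L n + C * (g n)\<^sup>2) \<longrightarrow>
     (\<forall>n. L n \<le> A * real (Suc n) powr (-\<beta>))"
proof -
  define u where "u n = real (Suc n) powr (-\<beta>)" for n
  have u_pos: "0 < u n" for n by (simp add: u_def)
  have S: "filterlim (\<lambda>n. real (Suc n)) at_top sequentially"
    by (rule filterlim_compose[OF filterlim_real_sequentially filterlim_Suc])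
  have u0: "u \<longlonglongrightarrow> 0"
    unfolding u_def[abs_def] using \<beta> by (intro tendsto_neg_powr S) auto
  have g0: "g \<longlonglongrightarrow> 0"
    using tendsto_mult[OF tendsto_const u0, of g1] by (simp add: g_def u_def[abs_def])
  have w0: "(\<lambda>n. real (Suc n) powr (\<beta> - 1)) \<longlonglongrightarrow> 0"
    using \<beta> tendsto_neg_powr[of "\<beta> - 1", OF _ S] by auto
  have "\<forall>\<^sub>F n in sequentially. C * g n < c / 2 \<and> c * g n < 1 \<and> real (Suc n) powr (\<beta> - 1) < c * g1 / 4"
    using c g1 tendsto_mult[OF tendsto_const g0, of C] tendsto_mult[OF tendsto_const g0, of c] w0
    by (intro eventually_conj order_tendstoD(2)[where y=0]) auto
  then obtain n0 where n0: "\<And>n. n \<ge> n0 \<Longrightarrow> C * g n < c / 2 \<and> c * g n < 1 \<and> real (Suc n) powr (\<beta> - 1) < c * g1 / 4"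
    by (auto simp: eventually_sequentially)
  \<comment> \<open>The recursion without contraction, started at the largest admissible value. It
    dominates every \<open>L\<close> even at early indices, where \<open>1 - c * g n\<close> may be
    negative.\<close>
  define b where "b = rec_nat (max 0 L0) (\<lambda>n b. (1 + C * (g n)\<^sup>2) * b + C * (g n)\<^sup>2)"
  have b_Suc: "b (Suc n) = (1 + C * (g n)\<^sup>2) * b n + C * (g n)\<^sup>2" and b_0: "b 0 = max 0 L0" for n
    by (simp_all add: b_def)
  have b_nn: "0 \<le> b n" for n by (induction n) (auto simp: b_Suc b_0 C)
  \<comment> \<open>The summands secure positivity, domination of the additive noise by a quarter of
    the contraction, and the claim at indices up to \<open>n0\<close>.\<close>
  define A where "A = 1 + 4 * C * g1 / c + (\<Sum>n\<le>n0. b n / u n)"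
  have A_sum: "0 \<le> (\<Sum>n\<le>n0. b n / u n)" using b_nn u_pos by (intro sum_nonneg) (simp add: less_imp_le)
  have A_pos: "0 < A" using A_sum C g1 c unfolding A_def by (smt (verit) divide_nonneg_pos mult_nonneg_nonneg)
  have A_ge: "4 * C * g1 / c \<le> A" using A_sum by (simp add: A_def)
  have gn: "0 < g n" for n using g1 by (simp add: g_def)
  have g_u: "g n = g1 * u n" for n by (simp add: g_def u_def)
  have "L n \<le> A * u n" if L0: "\<And>n. 0 \<le> L n" "L 0 \<le> L0"
    and rec: "\<And>n. L (Suc n) \<le> (1 - c * g n + C * (g n)\<^sup>2) * L n + C * (g n)\<^sup>2" for L n
  proof -
    have Lb: "L n \<le> b n" for n
    proof (induction n)
      case 0
      show ?case using L0 by (simp add: b_0)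
    next
      case (Suc n)
      have "L (Suc n) \<le> (1 - c * g n + C * (g n)\<^sup>2) * L n + C * (g n)\<^sup>2" by (rule rec)
      also have "\<dots> \<le> (1 + C * (g n)\<^sup>2) * L n + C * (g n)\<^sup>2"
        using L0(1)[of n] gn[of n] c by (intro add_right_mono mult_right_mono) auto
      also have "\<dots> \<le> b (Suc n)"
        unfolding b_Suc using Suc C by (intro add_right_mono mult_left_mono) auto
      finally show ?case .
    qed
    have small: "L n \<le> A * u n" if "n \<le> n0" for n
    proof -
      have "b n / u n \<le> (\<Sum>n\<le>n0. b n / u n)"
        using that b_nn u_pos by (intro member_le_sum) (auto simp: less_imp_le)
      also have "\<dots> \<le> A" unfolding A_def using C g1 c by simp
      finally have "b n \<le> A * u n" using u_pos[of n] by (simp add: field_simps)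
      with Lb[of n] show ?thesis by linarith
    qed
    show ?thesis
    proof (induction n)
      case 0
      show ?case by (rule small) simp
    next
      case (Suc n)
      show ?case
      proof (cases "Suc n \<le> n0")
        case True
        then show ?thesis by (rule small)
      next
        case False
        then have n: "n \<ge> n0" by simp
        note N = n0[OF n]
        have "L (Suc n) \<le> (1 - c * g n + C * (g n)\<^sup>2) * L n + C * (g n)\<^sup>2" by (rule rec)
        also have "\<dots> \<le> (1 - c / 2 * g n) * L n + C * (g n)\<^sup>2"
        proof (intro add_right_mono mult_right_mono L0)
          have "(C * g n) * g n \<le> (c / 2) * g n" using N gn[of n] by (intro mult_right_mono) auto
          then show "1 - c * g n + C * (g n)\<^sup>2 \<le> 1 - c / 2 * g n" by (simp add: power2_eq_square)
        qed
        also have "\<dots> \<le> (1 - c / 2 * g n) * (A * u n) + C * (g n)\<^sup>2"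
          using N gn[of n] c Suc by (intro add_right_mono mult_left_mono) auto
        \<comment> \<open>The remaining half of the contraction is split into two quarters: one is
          spent on the additive noise, by the choice of \<open>A\<close>, the other on the decrease
          of \<open>u\<close>.\<close>
        also have "\<dots> = A * u n - A * (c * g1 / 4) * (u n)\<^sup>2 - (A * (c * g1 / 4) - C * g1\<^sup>2) * (u n)\<^sup>2"
          by (simp add: g_u power2_eq_square field_simps)
        also have "\<dots> \<le> A * u n - A * (c * g1 / 4) * (u n)\<^sup>2"
        proof -
          have "4 * C * g1 / c * (c * g1 / 4) \<le> A * (c * g1 / 4)"
            using A_ge c g1 by (intro mult_right_mono) auto
          then have "0 \<le> A * (c * g1 / 4) - C * g1\<^sup>2" using c by (simp add: power2_eq_square)
          then show ?thesis by simp
        qed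
        also have "\<dots> \<le> A * u n - A * (u n / real (Suc n))"
        proof -
          have "1 / real (Suc n) = u n * real (Suc n) powr (\<beta> - 1)"
          proof -
            have "u n * real (Suc n) powr (\<beta> - 1) = real (Suc n) powr (- \<beta> + (\<beta> - 1))"
              by (simp only: u_def powr_add)
            then show ?thesis by (simp add: powr_minus_divide)
          qed
          also have "\<dots> \<le> u n * (c * g1 / 4)" using N u_pos[of n] by (intro mult_left_mono) auto
          finally have "u n * (1 / real (Suc n)) \<le> u n * (u n * (c * g1 / 4))"
            using u_pos[of n] by (intro mult_left_mono) auto
          then have "A * (u n / real (Suc n)) \<le> A * (u n * (u n * (c * g1 / 4)))"
            using A_pos by (intro mult_left_mono) auto
          then show ?thesis by (simp add: power2_eq_square mult_ac)
        qed
        also have "\<dots> = A * (u n - u n / real (Suc n))" by (simp add: right_diff_distrib)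
        also have "\<dots> \<le> A * u (Suc n)"
          using powr_neg_succ_ge[OF \<beta>, of n] A_pos unfolding u_def by (intro mult_left_mono) auto
        finally show ?thesis .
      qed
    qed
  qed
  then show ?thesis using A_pos unfolding u_def by blast
qed

section \<open>Drift and Lyapunov recursion of the quantile iterates\<close>

lemma H1_bound: "0 < \<alpha> \<Longrightarrow> \<alpha> < 1 \<Longrightarrow> \<bar>H1 \<alpha> \<xi> x\<bar> \<le> 1 / (1 - \<alpha>)"
proof -
  assume "0 < \<alpha>" "\<alpha> < 1"
  then have "1 \<le> 1 / (1 - \<alpha>)" by simp
  then show ?thesis by (auto simp: H1_def abs_le_iff)
qed

lemma H1_measurable [measurable]:
  assumes [measurable]: "U \<in> borel_measurable L" "W \<in> borel_measurable L"
  shows "(\<lambda>\<omega>. H1 \<alpha> (U \<omega>) (W \<omega>)) \<in> borel_measurable L"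
  unfolding H1_def by measurable

lemma sinh_cosh_measurable [measurable]:
  "(sinh :: real \<Rightarrow> real) \<in> borel_measurable borel" "(cosh :: real \<Rightarrow> real) \<in> borel_measurable borel"
  by (auto intro!: borel_measurable_continuous_onI continuous_intros)

locale nsa_scheme = iid_chain M x0 X \<nu> + nu: lipschitz_density \<nu> f C \<alpha>
  for M :: "'m measure" and x0 X \<nu> f C \<alpha> +
  fixes \<gamma>1 \<beta> \<xi>s c0 :: real
  assumes gamma1: "0 < \<gamma>1" and beta: "1 / 2 < \<beta>" "\<beta> < 1"
    and quantile: "cdf \<nu> \<xi>s = \<alpha>"
    and c0: "0 < c0" and f_ge: "\<And>x. \<bar>x - \<xi>s\<bar> \<le> 1 \<Longrightarrow> c0 \<le> f x"
begin

abbreviation \<gamma> :: "nat \<Rightarrow> real" where "\<gamma> n \<equiv> \<gamma>1 * real n powr (- \<beta>)"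

definition \<xi> :: "nat \<Rightarrow> 'm \<Rightarrow> real" where
  "\<xi> n \<omega> = nsa_xi \<alpha> (\<lambda>n. \<gamma> n) (x0 \<omega>) (\<lambda>k. X k \<omega>) n"

definition D :: "nat \<Rightarrow> 'm \<Rightarrow> real" where "D n \<omega> = \<xi> n \<omega> - \<xi>s"

lemma xi_Suc: "\<xi> (Suc n) \<omega> = \<xi> n \<omega> - \<gamma> (Suc n) * H1 \<alpha> (\<xi> n \<omega>) (X n \<omega>)"
  by (simp add: \<xi>_def)

lemma D_Suc: "D (Suc n) \<omega> = D n \<omega> - \<gamma> (Suc n) * H1 \<alpha> (\<xi> n \<omega>) (X n \<omega>)"
  by (simp add: D_def xi_Suc)

lemma gamma_pos: "0 < \<gamma> (Suc n)" using gamma1 by simp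

lemma gamma_le: "\<gamma> (Suc n) \<le> \<gamma>1"
proof -
  have "real (Suc n) powr (- \<beta>) \<le> 1" using beta powr_mono[of "-\<beta>" 0 "real (Suc n)"] by simp
  then show ?thesis using gamma1 mult_left_mono[of "real (Suc n) powr (- \<beta>)" 1 \<gamma>1] by simp
qed

lemma xi_past_le: "k \<le> n \<Longrightarrow> \<xi> k \<in> borel_measurable (past n)"
proof (induction k)
  case 0
  show ?case using x0_past[of n] by (simp add: \<xi>_def[abs_def])
next
  case (Suc k)
  then have [measurable]: "\<xi> k \<in> borel_measurable (past n)" "X k \<in> borel_measurable (past n)"
    using X_past by auto
  show ?case unfolding xi_Suc[abs_def] by measurable
qed

lemma xi_past: "\<xi> n \<in> borel_measurable (past n)" by (rule xi_past_le) simp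

lemma xi_measurable [measurable]: "\<xi> n \<in> borel_measurable M"
  by (rule measurable_past_imp[OF xi_past])

lemma D_measurable [measurable]: "D n \<in> borel_measurable M"
  unfolding D_def[abs_def] by measurable

text \<open>Within distance 1 of the quantile the density is at least \<open>c0\<close>; farther out
  the cdf is merely monotone, so the lower bound saturates at distance 1.\<close>

lemma V'_growth:
  "0 \<le> d \<Longrightarrow> c0 / (1 - \<alpha>) * min d 1 \<le> nu.V' (\<xi>s + d)"
  "0 \<le> d \<Longrightarrow> nu.V' (\<xi>s - d) \<le> - (c0 / (1 - \<alpha>) * min d 1)"
proof -
  have fb: "c0 \<le> f x \<and> f x \<le> C" if "\<bar>x - \<xi>s\<bar> \<le> 1" for x using f_ge[OF that] nu.f_le by auto
  assume d: "0 \<le> d"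
  have "c0 * (\<xi>s + min d 1 - \<xi>s) \<le> cdf \<nu> (\<xi>s + min d 1) - cdf \<nu> \<xi>s"
    using d by (intro nu.cdf_diff_bounds(1)[of _ _ _ C] fb) auto
  also have "\<dots> \<le> cdf \<nu> (\<xi>s + d) - cdf \<nu> \<xi>s" by (intro diff_right_mono nu.cdf_nondecreasing) auto
  finally show "c0 / (1 - \<alpha>) * min d 1 \<le> nu.V' (\<xi>s + d)"
    using nu.alpha by (simp add: nu.V'_def quantile divide_right_mono)
  have "c0 * (\<xi>s - (\<xi>s - min d 1)) \<le> cdf \<nu> \<xi>s - cdf \<nu> (\<xi>s - min d 1)"
    using d by (intro nu.cdf_diff_bounds(1)[of _ _ _ C] fb) auto
  also have "\<dots> \<le> cdf \<nu> \<xi>s - cdf \<nu> (\<xi>s - d)" by (intro diff_left_mono nu.cdf_nondecreasing) auto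
  finally have "c0 * min d 1 / (1 - \<alpha>) \<le> (\<alpha> - cdf \<nu> (\<xi>s - d)) / (1 - \<alpha>)"
    using nu.alpha by (intro divide_right_mono) (auto simp: quantile)
  then show "nu.V' (\<xi>s - d) \<le> - (c0 / (1 - \<alpha>) * min d 1)"
    by (simp add: nu.V'_def diff_divide_distrib)
qed

text \<open>This is what \<open>cosh\<close> is chosen for: even a drift that saturates at distance
  1, multiplied by \<open>sinh\<close>, dominates a fixed multiple of \<open>cosh - 1\<close>.
  Negative \<open>d\<close> reduces to positive \<open>d\<close> because \<open>sinh\<close> is
  odd.\<close>

lemma drift:
  assumes lam: "0 < lam"
  shows "c0 / (1 - \<alpha>) * min 1 (1 / lam) * (cosh (lam * d) - 1) \<le> sinh (lam * d) * nu.V' (\<xi>s + d)"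
proof -
  have m: "0 \<le> c0 / (1 - \<alpha>)" using c0 nu.alpha by simp
  have aux: "min 1 (1 / lam) * (cosh (lam * y) - 1) \<le> sinh (lam * y) * min y 1" if y: "0 \<le> y" for y
  proof (cases "1 \<le> y")
    case True
    have "min 1 (1 / lam) * (cosh (lam * y) - 1) \<le> 1 * (cosh (lam * y) - 1)"
      using cosh_real_ge_1[of "lam * y"] by (intro mult_right_mono) auto
    also have "\<dots> \<le> sinh (lam * y)" using cosh_minus_one_le(1)[of "lam * y"] lam y by simp
    finally show ?thesis using True by (simp add: min_absorb2)
  next
    case False
    have "min 1 (1 / lam) * (cosh (lam * y) - 1) \<le> (1 / lam) * (cosh (lam * y) - 1)"
      using cosh_real_ge_1[of "lam * y"] by (intro mult_right_mono) auto
    also have "\<dots> \<le> (1 / lam) * (lam * y * sinh (lam * y))"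
      using cosh_minus_one_le(2)[of "lam * y"] lam y by (intro mult_left_mono) auto
    finally show ?thesis using False lam by (simp add: min_absorb1 mult.commute)
  qed
  have main: "c0 / (1 - \<alpha>) * min 1 (1 / lam) * (cosh (lam * y) - 1) \<le> sinh (lam * y) * (c0 / (1 - \<alpha>) * min y 1)"
    if "0 \<le> y" for y
    using mult_left_mono[OF aux[OF that] m] by (simp add: mult_ac)
  show ?thesis
  proof (cases "0 \<le> d")
    case True
    have "sinh (lam * d) * (c0 / (1 - \<alpha>) * min d 1) \<le> sinh (lam * d) * nu.V' (\<xi>s + d)"
      using V'_growth(1)[OF True] True lam by (intro mult_left_mono) auto
    with main[OF True] show ?thesis by linarith
  next
    case False
    then have n: "0 \<le> - d" by simp
    have "sinh (lam * (- d)) * (c0 / (1 - \<alpha>) * min (- d) 1) \<le> sinh (lam * (- d)) * - nu.V' (\<xi>s + d)"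
      using V'_growth(2)[OF n] False lam by (intro mult_left_mono) (auto simp: mult_nonneg_nonpos)
    with main[OF n] show ?thesis by simp
  qed
qed

text \<open>One step moves \<open>D\<close> by at most \<open>\<gamma>1 / (1 - \<alpha>)\<close>,
  which multiplies \<open>cosh\<close> by at most a fixed factor, so integrability propagates from
  the initial value.\<close>

lemma integrable_cosh:
  assumes "integrable M (\<lambda>\<omega>. cosh (lam * D 0 \<omega>))"
  shows "integrable M (\<lambda>\<omega>. cosh (lam * D n \<omega>))"
proof (induction n)
  case (Suc n)
  show ?case
  proof (rule Bochner_Integration.integrable_bound)
    show "integrable M (\<lambda>\<omega>. exp (\<bar>lam\<bar> * \<gamma>1 / (1 - \<alpha>)) * cosh (lam * D n \<omega>))"
      using Suc by simp
    show "AE \<omega> in M. norm (cosh (lam * D (Suc n) \<omega>)) \<le> norm (exp (\<bar>lam\<bar> * \<gamma>1 / (1 - \<alpha>)) * cosh (lam * D n \<omega>))"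
    proof (intro AE_I2)
      fix \<omega>
      let ?b = "- (lam * (\<gamma> (Suc n) * H1 \<alpha> (\<xi> n \<omega>) (X n \<omega>)))"
      have "\<bar>?b\<bar> = \<bar>lam\<bar> * (\<gamma> (Suc n) * \<bar>H1 \<alpha> (\<xi> n \<omega>) (X n \<omega>)\<bar>)"
        unfolding abs_minus_cancel abs_mult[of lam] abs_mult[of "\<gamma> (Suc n)"] abs_of_pos[OF gamma_pos] ..
      also have "\<dots> \<le> \<bar>lam\<bar> * (\<gamma>1 * (1 / (1 - \<alpha>)))"
        using gamma_le[of n] gamma1 H1_bound[OF nu.alpha] by (intro mult_left_mono mult_mono) auto
      finally have "exp \<bar>?b\<bar> \<le> exp (\<bar>lam\<bar> * \<gamma>1 / (1 - \<alpha>))" by simp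
      then have "exp \<bar>?b\<bar> * cosh (lam * D n \<omega>) \<le> exp (\<bar>lam\<bar> * \<gamma>1 / (1 - \<alpha>)) * cosh (lam * D n \<omega>)"
        by (intro mult_right_mono) auto
      moreover have "cosh (lam * D (Suc n) \<omega>) \<le> exp \<bar>?b\<bar> * cosh (lam * D n \<omega>)"
        using cosh_add_le_exp[of "lam * D n \<omega>" ?b] by (simp add: D_Suc right_diff_distrib)
      ultimately have "cosh (lam * D (Suc n) \<omega>) \<le> exp (\<bar>lam\<bar> * \<gamma>1 / (1 - \<alpha>)) * cosh (lam * D n \<omega>)"
        by (rule order_trans[rotated])
      then show "norm (cosh (lam * D (Suc n) \<omega>)) \<le> norm (exp (\<bar>lam\<bar> * \<gamma>1 / (1 - \<alpha>)) * cosh (lam * D n \<omega>))"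
        by simp
    qed
  qed measurable
qed (use assms in simp)

text \<open>The increment of \<open>lam * D\<close> is at most
  \<open>lam * \<gamma> (Suc n) / (1 - \<alpha>)\<close>. Its square gives the second factor of
  \<open>Q\<close>, and its bound over all steps gives the exponential coming from
  \<open>cosh_add_le\<close>.\<close>

lemma Lyapunov_recursion:
  assumes lam: "0 < lam" and int0: "integrable M (\<lambda>\<omega>. cosh (lam * D 0 \<omega>))"
  defines "L \<equiv> \<lambda>n. expectation (\<lambda>\<omega>. cosh (lam * D n \<omega>) - 1)"
    and "Q \<equiv> exp (lam * \<gamma>1 / (1 - \<alpha>)) * (lam / (1 - \<alpha>))\<^sup>2"
  shows "L (Suc n) \<le> (1 - lam * (c0 / (1 - \<alpha>) * min 1 (1 / lam)) * \<gamma> (Suc n) + Q * (\<gamma> (Suc n))\<^sup>2) * L n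
     + Q * (\<gamma> (Suc n))\<^sup>2"
proof -
  define g where "g = \<gamma> (Suc n)"
  have g: "0 < g" "g \<le> \<gamma>1" using gamma_pos gamma_le unfolding g_def by auto
  define k where "k = c0 / (1 - \<alpha>) * min 1 (1 / lam)"
  define h where "h = 1 / (1 - \<alpha>)"
  have h: "0 < h" using nu.alpha by (simp add: h_def)
  have Q: "Q = exp (lam * \<gamma>1 * h) * lam\<^sup>2 * h\<^sup>2" by (simp add: Q_def h_def power_divide)
  note ci = integrable_cosh[OF int0]
  \<comment> \<open>The one-step upper bound as a function of iterate and fresh sample. The sample
    enters only through \<open>H1\<close>, and linearly, so integrating it out puts
    \<open>nu.V'\<close> in its place exactly.\<close>
  define G where "G p = cosh (lam * (fst p - \<xi>s)) - lam * g * H1 \<alpha> (fst p) (snd p) * sinh (lam * (fst p - \<xi>s))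
       + Q * g\<^sup>2 * cosh (lam * (fst p - \<xi>s))" for p :: "real \<times> real"
  have Gm [measurable]: "G \<in> borel_measurable (borel \<Otimes>\<^sub>M borel)" unfolding G_def[abs_def] by measurable
  have pw: "cosh (lam * D (Suc n) \<omega>) \<le> G (\<xi> n \<omega>, X n \<omega>)" for \<omega>
  proof -
    let ?b = "- (lam * g * H1 \<alpha> (\<xi> n \<omega>) (X n \<omega>))"
    have H: "\<bar>H1 \<alpha> (\<xi> n \<omega>) (X n \<omega>)\<bar> \<le> h" unfolding h_def by (rule H1_bound[OF nu.alpha])
    have b: "\<bar>?b\<bar> \<le> lam * g * h" using H lam g by (simp add: abs_mult mult_left_mono)
    also have "\<dots> \<le> lam * \<gamma>1 * h" using lam g h by (intro mult_right_mono mult_left_mono) auto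
    finally have "cosh (lam * D n \<omega> + ?b) \<le> cosh (lam * D n \<omega>) + ?b * sinh (lam * D n \<omega>)
        + exp (lam * \<gamma>1 * h) * ?b\<^sup>2 * cosh (lam * D n \<omega>)" by (rule cosh_add_le)
    also have "\<dots> \<le> cosh (lam * D n \<omega>) + ?b * sinh (lam * D n \<omega>)
        + exp (lam * \<gamma>1 * h) * (lam * g * h)\<^sup>2 * cosh (lam * D n \<omega>)"
    proof (intro add_left_mono mult_right_mono mult_left_mono)
      have "\<bar>?b\<bar>\<^sup>2 \<le> (lam * g * h)\<^sup>2" by (intro power_mono b) auto
      then show "?b\<^sup>2 \<le> (lam * g * h)\<^sup>2" by simp
    qed auto
    finally have "cosh (lam * D n \<omega> + ?b) \<le> G (\<xi> n \<omega>, X n \<omega>)"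
      unfolding G_def fst_conv snd_conv D_def[symmetric] by (simp add: Q power_mult_distrib mult_ac)
    moreover have "lam * D (Suc n) \<omega> = lam * D n \<omega> + ?b"
      unfolding D_Suc g_def by (simp add: algebra_simps)
    ultimately show ?thesis by simp
  qed
  have si: "integrable M (\<lambda>\<omega>. H1 \<alpha> (\<xi> n \<omega>) (X n \<omega>) * sinh (lam * D n \<omega>))"
  proof (rule Bochner_Integration.integrable_bound)
    show "integrable M (\<lambda>\<omega>. h * cosh (lam * D n \<omega>))" using ci by simp
    show "AE \<omega> in M. norm (H1 \<alpha> (\<xi> n \<omega>) (X n \<omega>) * sinh (lam * D n \<omega>)) \<le> norm (h * cosh (lam * D n \<omega>))"
    proof (intro AE_I2)
      fix \<omega>
      have "\<bar>H1 \<alpha> (\<xi> n \<omega>) (X n \<omega>)\<bar> * \<bar>sinh (lam * D n \<omega>)\<bar> \<le> h * cosh (lam * D n \<omega>)"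
        using H1_bound[OF nu.alpha] abs_sinh_le_cosh h unfolding h_def by (intro mult_mono) auto
      then show "norm (H1 \<alpha> (\<xi> n \<omega>) (X n \<omega>) * sinh (lam * D n \<omega>)) \<le> norm (h * cosh (lam * D n \<omega>))"
        using h by (simp add: abs_mult)
    qed
  qed measurable
  have GX: "G (\<xi> n \<omega>, X n \<omega>) = cosh (lam * D n \<omega>) - lam * g * (H1 \<alpha> (\<xi> n \<omega>) (X n \<omega>) * sinh (lam * D n \<omega>))
      + Q * g\<^sup>2 * cosh (lam * D n \<omega>)" for \<omega>
    by (simp add: G_def D_def)
  have Gi: "integrable M (\<lambda>\<omega>. G (\<xi> n \<omega>, X n \<omega>))"
    unfolding GX using ci si by simp
  have inner: "(\<integral>x. G (z, x) \<partial>\<nu>) = cosh (lam * (z - \<xi>s)) - lam * g * nu.V' z * sinh (lam * (z - \<xi>s))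
      + Q * g\<^sup>2 * cosh (lam * (z - \<xi>s))" for z
    unfolding G_def using nu.prob_space by (simp add: nu.integral_H1)
  \<comment> \<open>Writing \<open>cosh\<close> as \<open>(cosh - 1) + 1\<close> splits the
    second-order term into a part of the factor and the additive noise
    \<open>Q * g\<^sup>2\<close>.\<close>
  have inner_le: "(\<integral>x. G (\<xi> n \<omega>, x) \<partial>\<nu>) \<le>
      (1 - lam * k * g + Q * g\<^sup>2) * (cosh (lam * D n \<omega>) - 1) + Q * g\<^sup>2 + 1" for \<omega>
  proof -
    have "lam * g * (k * (cosh (lam * D n \<omega>) - 1)) \<le> lam * g * (sinh (lam * D n \<omega>) * nu.V' (\<xi>s + D n \<omega>))"
      using drift[OF lam, of "D n \<omega>"] lam g unfolding k_def by (intro mult_left_mono) auto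
    then show ?thesis unfolding inner by (simp add: D_def algebra_simps)
  qed
  have "expectation (\<lambda>\<omega>. cosh (lam * D (Suc n) \<omega>)) \<le> expectation (\<lambda>\<omega>. G (\<xi> n \<omega>, X n \<omega>))"
    by (intro integral_mono ci Gi pw)
  also have "\<dots> = expectation (\<lambda>\<omega>. \<integral>x. G (\<xi> n \<omega>, x) \<partial>\<nu>)"
    by (rule expectation_past[OF xi_past Gm Gi])
  also have "\<dots> \<le> expectation (\<lambda>\<omega>. (1 - lam * k * g + Q * g\<^sup>2) * (cosh (lam * D n \<omega>) - 1) + Q * g\<^sup>2 + 1)"
    by (intro integral_mono inner_le integrable_past[OF xi_past Gm Gi]) (use ci in auto)
  also have "\<dots> = (1 - lam * k * g + Q * g\<^sup>2) * L n + Q * g\<^sup>2 + 1"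
    unfolding L_def using ci prob_space by simp
  finally have "expectation (\<lambda>\<omega>. cosh (lam * D (Suc n) \<omega>)) - 1 \<le> (1 - lam * k * g + Q * g\<^sup>2) * L n + Q * g\<^sup>2" by simp
  moreover have "L (Suc n) = expectation (\<lambda>\<omega>. cosh (lam * D (Suc n) \<omega>)) - 1"
    unfolding L_def using ci prob_space by simp
  ultimately show ?thesis unfolding k_def g_def by simp
qed

end

section \<open>Linearization of the scheme\<close>

lemma (in prob_space)
  fixes Z :: "'a \<Rightarrow> real"
  assumes [measurable]: "Z \<in> borel_measurable M" and Z2: "integrable M (\<lambda>\<omega>. (Z \<omega>)\<^sup>2)"
  shows integrable_of_square: "integrable M Z"
    and expectation_abs_le_sqrt: "expectation (\<lambda>\<omega>. \<bar>Z \<omega>\<bar>) \<le> sqrt (expectation (\<lambda>\<omega>. (Z \<omega>)\<^sup>2))"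
proof -
  show i: "integrable M Z" by (rule square_integrable_imp_integrable[OF _ Z2]) simp
  have "0 \<le> variance (\<lambda>\<omega>. \<bar>Z \<omega>\<bar>)" by simp
  also have "variance (\<lambda>\<omega>. \<bar>Z \<omega>\<bar>) = expectation (\<lambda>\<omega>. \<bar>Z \<omega>\<bar>\<^sup>2) - (expectation (\<lambda>\<omega>. \<bar>Z \<omega>\<bar>))\<^sup>2"
    using i Z2 by (intro variance_eq) auto
  finally show "expectation (\<lambda>\<omega>. \<bar>Z \<omega>\<bar>) \<le> sqrt (expectation (\<lambda>\<omega>. (Z \<omega>)\<^sup>2))"
    by (intro real_le_rsqrt) simp
qed

text \<open>Comparison with the integral of the power, carried out increment by increment with the
  mean value theorem.\<close>

lemma sum_powr_le:
  fixes p :: real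
  assumes p: "0 < p" "p < 1"
  shows "(\<Sum>n<N. real (Suc n) powr (-p)) \<le> real N powr (1 - p) / (1 - p)"
proof (induction N)
  case (Suc N)
  have step: "real (Suc N) powr (-p) * (1 - p) \<le> real (Suc N) powr (1 - p) - real N powr (1 - p)"
  proof (cases "N = 0")
    case True
    then show ?thesis using p by simp
  next
    case False
    have "\<exists>z. real N < z \<and> z < real (Suc N) \<and> real (Suc N) powr (1 - p) - real N powr (1 - p) = (real (Suc N) - real N) * ((1 - p) * z powr (1 - p - 1))"
      using False by (intro MVT2) (auto intro!: derivative_eq_intros)
    then obtain z where z: "real N < z" "z < real (Suc N)"
      "real (Suc N) powr (1 - p) - real N powr (1 - p) = (1 - p) * z powr (- p)" by auto
    have "real (Suc N) powr (- p) \<le> z powr (- p)"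
      using z False p by (intro powr_mono2') auto
    then have "(1 - p) * real (Suc N) powr (-p) \<le> (1 - p) * z powr (- p)" using p by (intro mult_left_mono) auto
    then show ?thesis using z(3) by (simp add: mult.commute)
  qed
  have "(\<Sum>n<Suc N. real (Suc n) powr (-p)) \<le> real N powr (1 - p) / (1 - p) + real (Suc N) powr (-p)"
    using Suc by simp
  also have "\<dots> \<le> real N powr (1 - p) / (1 - p) + (real (Suc N) powr (1 - p) - real N powr (1 - p)) / (1 - p)"
    using step p by (intro add_left_mono) (simp add: pos_le_divide_eq)
  also have "\<dots> = real (Suc N) powr (1 - p) / (1 - p)" by (simp add: diff_divide_distrib)
  finally show ?case .
qed simp

lemma summation_by_parts:
  fixes D w :: "nat \<Rightarrow> real"
  assumes "w 0 = 0"
  shows "(\<Sum>n<N. (D n - D (Suc n)) * w (Suc n)) = (\<Sum>n<N. D n * (w (Suc n) - w n)) - D N * w N"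
  by (induction N) (auto simp: assms algebra_simps)

lemma powr_diff_le:
  fixes \<beta> :: real
  assumes "0 < \<beta>" "\<beta> < 1"
  shows "0 \<le> real (Suc n) powr \<beta> - real n powr \<beta>"
    "real (Suc n) powr \<beta> - real n powr \<beta> \<le> real (Suc n) powr (\<beta> - 1)"
proof -
  show "0 \<le> real (Suc n) powr \<beta> - real n powr \<beta>" using assms by (simp add: powr_mono2)
  have "real n / real (Suc n) \<le> (real n / real (Suc n)) powr \<beta>"
    using powr_mono'[of \<beta> 1 "real n / real (Suc n)"] assms by (cases "n = 0") auto
  then have "real (Suc n) powr \<beta> * (real n / real (Suc n)) \<le> real (Suc n) powr \<beta> * (real n / real (Suc n)) powr \<beta>"
    by (intro mult_left_mono) auto
  also have "\<dots> = real n powr \<beta>" by (simp add: powr_divide)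
  finally have "real (Suc n) powr \<beta> - real n powr \<beta> \<le> real (Suc n) powr \<beta> * (1 - real n / real (Suc n))"
    by (simp add: right_diff_distrib)
  also have "1 - real n / real (Suc n) = 1 / real (Suc n)" by (simp add: field_simps)
  also have "real (Suc n) powr \<beta> * (1 / real (Suc n)) = real (Suc n) powr (\<beta> - 1)"
    by (simp add: powr_diff)
  finally show "real (Suc n) powr \<beta> - real n powr \<beta> \<le> real (Suc n) powr (\<beta> - 1)" .
qed

text \<open>With step \<open>1 / (n + 1)\<close> the shortfall recursion is a running mean:
  multiplied by \<open>n + 1\<close> it telescopes, so the iterate is an exact average over the
  quantile iterates.\<close>

lemma nsa_chi_eq_average:
  "real n * nsa_chi \<alpha> \<gamma> x xs n = (\<Sum>k<n. nsa_xi \<alpha> \<gamma> x xs k + max 0 (xs k - nsa_xi \<alpha> \<gamma> x xs k) / (1 - \<alpha>))"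
proof (induction n)
  case (Suc n)
  have "real (Suc n) * nsa_chi \<alpha> \<gamma> x xs (Suc n)
      = real (Suc n) * nsa_chi \<alpha> \<gamma> x xs n - H2 \<alpha> (nsa_xi \<alpha> \<gamma> x xs n) (nsa_chi \<alpha> \<gamma> x xs n) (xs n)"
    by (simp add: right_diff_distrib del: of_nat_Suc)
  also have "\<dots> = real n * nsa_chi \<alpha> \<gamma> x xs n + (nsa_xi \<alpha> \<gamma> x xs n + max 0 (xs n - nsa_xi \<alpha> \<gamma> x xs n) / (1 - \<alpha>))"
    by (simp add: H2_def algebra_simps)
  finally show ?case using Suc by simp
qed simp

text \<open>Records the outcome of the Lyapunov estimate. All remainder bounds below rest on these
  second moments, and \<open>A\<close> is a parameter so that it can be shared by all
  \<open>K\<close>.\<close>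

locale nsa_scheme_L2 = nsa_scheme +
  fixes A :: real
  assumes D2_int: "\<And>n. integrable M (\<lambda>\<omega>. (D n \<omega>)\<^sup>2)"
    and D2_le: "\<And>n. expectation (\<lambda>\<omega>. (D n \<omega>)\<^sup>2) \<le> A * real (Suc n) powr (- \<beta>)"
begin

definition h :: real where "h = 1 / (1 - \<alpha>)"

lemma h_pos: "0 < h" using nu.alpha by (simp add: h_def)

lemma A_nonneg: "0 \<le> A"
proof -
  have "0 \<le> expectation (\<lambda>\<omega>. (D 0 \<omega>)\<^sup>2)" by (intro integral_nonneg_AE) auto
  also have "\<dots> \<le> A" using D2_le[of 0] by simp
  finally show ?thesis .
qed

lemma D_int: "integrable M (D n)"
  by (rule integrable_of_square[OF _ D2_int]) measurable

lemma D_abs_le: "expectation (\<lambda>\<omega>. \<bar>D n \<omega>\<bar>) \<le> sqrt A * real (Suc n) powr (- \<beta> / 2)"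
proof -
  have "expectation (\<lambda>\<omega>. \<bar>D n \<omega>\<bar>) \<le> sqrt (expectation (\<lambda>\<omega>. (D n \<omega>)\<^sup>2))"
    by (rule expectation_abs_le_sqrt[OF _ D2_int]) measurable
  also have "\<dots> \<le> sqrt (A * real (Suc n) powr (- \<beta>))" using D2_le by simp
  also have "\<dots> = sqrt A * real (Suc n) powr (- \<beta> / 2)"
    by (simp add: real_sqrt_mult powr_half_sqrt[symmetric] powr_powr)
  finally show ?thesis .
qed

lemma D_abs_le': "expectation (\<lambda>\<omega>. \<bar>D n \<omega>\<bar>) \<le> sqrt A"
proof -
  have "real (Suc n) powr (- \<beta> / 2) \<le> 1" using beta powr_mono[of "-\<beta>/2" 0 "real (Suc n)"] by simp
  then have "sqrt A * real (Suc n) powr (- \<beta> / 2) \<le> sqrt A * 1" using A_nonneg by (intro mult_left_mono) auto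
  with D_abs_le[of n] show ?thesis by simp
qed

lemma D2_sum: "(\<Sum>n<N. expectation (\<lambda>\<omega>. (D n \<omega>)\<^sup>2)) \<le> A / (1 - \<beta>) * real N powr (1 - \<beta>)"
proof -
  have "(\<Sum>n<N. expectation (\<lambda>\<omega>. (D n \<omega>)\<^sup>2)) \<le> (\<Sum>n<N. A * real (Suc n) powr (- \<beta>))"
    by (intro sum_mono D2_le)
  also have "\<dots> = A * (\<Sum>n<N. real (Suc n) powr (- \<beta>))" by (simp add: sum_distrib_left)
  also have "\<dots> \<le> A * (real N powr (1 - \<beta>) / (1 - \<beta>))"
    using beta A_nonneg by (intro mult_left_mono sum_powr_le) auto
  finally show ?thesis by simp
qed

text \<open>\<open>G1\<close> and \<open>G2\<close> are the martingale noises of the two recursions at \<open>z\<close> minus the noises at the quantile.\<close>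
definition G1 :: "real \<Rightarrow> real \<Rightarrow> real" where
  "G1 z x = H1 \<alpha> z x - nu.V' z - H1 \<alpha> \<xi>s x"

lemma G1_measurable [measurable]: "(\<lambda>p. G1 (fst p) (snd p)) \<in> borel_measurable (borel \<Otimes>\<^sub>M borel)"
  unfolding G1_def by measurable

lemma V'_star: "nu.V' \<xi>s = 0" by (simp add: nu.V'_def quantile)

lemma G1_centered: "(\<integral>x. G1 z x \<partial>\<nu>) = 0"
  unfolding G1_def using nu.prob_space by (simp add: nu.integral_H1 V'_star)

lemma V'_abs_le: "\<bar>nu.V' z\<bar> \<le> h"
proof -
  have "0 \<le> cdf \<nu> z" "cdf \<nu> z \<le> 1" by (auto simp: nu.cdf_nonneg nu.cdf_bounded_prob)
  then have "\<bar>cdf \<nu> z - \<alpha>\<bar> \<le> 1" using nu.alpha by (auto simp: abs_le_iff)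
  then show ?thesis using nu.alpha by (simp add: nu.V'_def h_def abs_divide divide_right_mono)
qed

lemma G1_abs_le: "\<bar>G1 z x\<bar> \<le> 3 * h"
  using V'_abs_le[of z] H1_bound[OF nu.alpha, of z x] H1_bound[OF nu.alpha, of \<xi>s x]
  unfolding G1_def h_def by linarith

lemma G1_square_int: "integrable M (\<lambda>\<omega>. (G1 (\<xi> n \<omega>) (X n \<omega>))\<^sup>2)"
proof (rule integrable_const_bound[where B="(3 * h)\<^sup>2"])
  have "\<bar>G1 z x\<bar>\<^sup>2 \<le> (3 * h)\<^sup>2" for z x by (intro power_mono G1_abs_le) auto
  then show "AE \<omega> in M. norm ((G1 (\<xi> n \<omega>) (X n \<omega>))\<^sup>2) \<le> (3 * h)\<^sup>2" by simp
qed (simp add: G1_def)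

text \<open>The indicators at \<open>z\<close> and at the quantile differ only for samples between
  the two points, an event of probability at most \<open>C * \<bar>z - \<xi>s\<bar>\<close>;
  centering can only lower the second moment. The bound is of first order in the distance, as the
  indicator jumps.\<close>

lemma G1_variance: "(\<integral>x. (G1 z x)\<^sup>2 \<partial>\<nu>) \<le> h\<^sup>2 * C * \<bar>z - \<xi>s\<bar>"
proof -
  define a where "a x = H1 \<alpha> z x - H1 \<alpha> \<xi>s x" for x
  have a_int: "integrable \<nu> a" unfolding a_def[abs_def] by simp
  have a_mean: "integral\<^sup>L \<nu> a = nu.V' z" unfolding a_def[abs_def] by (simp add: nu.integral_H1 V'_star)
  have [measurable]: "a \<in> borel_measurable borel" unfolding a_def[abs_def] by measurable
  have a2: "(a x)\<^sup>2 \<le> h\<^sup>2 * indicator {min \<xi>s z..max \<xi>s z} x" for x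
    by (auto simp: a_def H1_def h_def power_divide split: split_indicator)
  have ind: "integrable \<nu> (\<lambda>x. h\<^sup>2 * indicator {min \<xi>s z..max \<xi>s z} x)"
    by (intro integrable_mult_right integrable_real_indicator) (auto simp: nu.emeasure_eq_measure)
  have a2_int: "integrable \<nu> (\<lambda>x. (a x)\<^sup>2)"
    by (rule Bochner_Integration.integrable_bound[OF ind]) (use a2 in auto)
  have "(\<integral>x. (G1 z x)\<^sup>2 \<partial>\<nu>) = nu.variance a"
    unfolding a_mean by (simp add: G1_def a_def algebra_simps)
  also have "\<dots> \<le> (\<integral>x. (a x)\<^sup>2 \<partial>\<nu>)"
    using a_int a2_int by (simp add: nu.variance_eq)
  also have "\<dots> \<le> (\<integral>x. h\<^sup>2 * indicator {min \<xi>s z..max \<xi>s z} x \<partial>\<nu>)"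
    by (intro integral_mono a2_int ind a2)
  also have "\<dots> = h\<^sup>2 * (cdf \<nu> (max \<xi>s z) - cdf \<nu> (min \<xi>s z))"
    by (simp add: nu.measure_Icc_eq_cdf)
  also have "\<dots> \<le> h\<^sup>2 * (C * \<bar>z - \<xi>s\<bar>)"
    using nu.cdf_Lipschitz[of "max \<xi>s z" "min \<xi>s z"]
    by (intro mult_left_mono) (auto simp: max_def min_def split: if_splits)
  finally show ?thesis by simp
qed

lemma G1_second_moment:
  "expectation (\<lambda>\<omega>. (G1 (\<xi> n \<omega>) (X n \<omega>))\<^sup>2) \<le> h\<^sup>2 * C * sqrt A * real (Suc n) powr (- \<beta> / 2)"
proof -
  let ?G = "\<lambda>p. (G1 (fst p) (snd p))\<^sup>2"
  have Gm: "?G \<in> borel_measurable (borel \<Otimes>\<^sub>M borel)" by measurable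
  have Gi: "integrable M (\<lambda>\<omega>. ?G (\<xi> n \<omega>, X n \<omega>))" using G1_square_int by simp
  have "expectation (\<lambda>\<omega>. (G1 (\<xi> n \<omega>) (X n \<omega>))\<^sup>2) = expectation (\<lambda>\<omega>. \<integral>x. (G1 (\<xi> n \<omega>) x)\<^sup>2 \<partial>\<nu>)"
    using expectation_past[OF xi_past Gm Gi] by simp
  also have "\<dots> \<le> expectation (\<lambda>\<omega>. h\<^sup>2 * C * \<bar>D n \<omega>\<bar>)"
    using integrable_past[OF xi_past Gm Gi] D_int G1_variance unfolding D_def
    by (intro integral_mono) auto
  also have "\<dots> = h\<^sup>2 * C * expectation (\<lambda>\<omega>. \<bar>D n \<omega>\<bar>)" by simp
  also have "\<dots> \<le> h\<^sup>2 * C * (sqrt A * real (Suc n) powr (- \<beta> / 2))"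
    using nu.C_pos by (intro mult_left_mono D_abs_le) auto
  finally show ?thesis by (simp add: mult.assoc)
qed

text \<open>The variances are of order \<open>k powr (- \<beta> / 2)\<close> and add up to order
  \<open>N powr (1 - \<beta> / 2)\<close>; the square root yields an exponent below 1/2.\<close>

lemma G1_sum_bound:
  "integrable M (\<lambda>\<omega>. \<Sum>k<N. G1 (\<xi> k \<omega>) (X k \<omega>))"
  "expectation (\<lambda>\<omega>. \<bar>\<Sum>k<N. G1 (\<xi> k \<omega>) (X k \<omega>)\<bar>)
     \<le> sqrt (h\<^sup>2 * C * sqrt A / (1 - \<beta> / 2)) * real N powr (1 / 2 - \<beta> / 4)"
proof -
  let ?S = "\<lambda>\<omega>. \<Sum>k<N. G1 (\<xi> k \<omega>) (X k \<omega>)"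
  have m: "?S \<in> borel_measurable M" unfolding G1_def by measurable
  note mart = martingale_second_moment[OF xi_past G1_measurable G1_centered G1_square_int G1_second_moment, of N]
  show "integrable M ?S" by (rule integrable_of_square[OF m]) (use mart in blast)
  have "expectation (\<lambda>\<omega>. \<bar>?S \<omega>\<bar>) \<le> sqrt (expectation (\<lambda>\<omega>. (?S \<omega>)\<^sup>2))"
    by (rule expectation_abs_le_sqrt[OF m]) (use mart in blast)
  also have "\<dots> \<le> sqrt (\<Sum>k<N. h\<^sup>2 * C * sqrt A * real (Suc k) powr (- \<beta> / 2))"
    using mart by (intro real_sqrt_le_mono) blast
  also have "(\<Sum>k<N. h\<^sup>2 * C * sqrt A * real (Suc k) powr (- \<beta> / 2)) = h\<^sup>2 * C * sqrt A * (\<Sum>k<N. real (Suc k) powr (- (\<beta> / 2)))"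
    by (simp add: sum_distrib_left)
  also have "sqrt \<dots> \<le> sqrt (h\<^sup>2 * C * sqrt A * (real N powr (1 - \<beta> / 2) / (1 - \<beta> / 2)))"
    using beta nu.C_pos A_nonneg by (intro real_sqrt_le_mono mult_left_mono sum_powr_le) auto
  also have "\<dots> = sqrt (h\<^sup>2 * C * sqrt A / (1 - \<beta> / 2) * real N powr (1 - \<beta> / 2))" by simp
  also have "\<dots> = sqrt (h\<^sup>2 * C * sqrt A / (1 - \<beta> / 2)) * real N powr (1 / 2 - \<beta> / 4)"
    unfolding real_sqrt_mult[of _ "real N powr (1 - \<beta> / 2)"]
    by (simp add: powr_half_sqrt[symmetric] powr_powr diff_divide_distrib)
  finally show "expectation (\<lambda>\<omega>. \<bar>?S \<omega>\<bar>) \<le> sqrt (h\<^sup>2 * C * sqrt A / (1 - \<beta> / 2)) * real N powr (1 / 2 - \<beta> / 4)" .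
qed

definition G2 :: "real \<Rightarrow> real \<Rightarrow> real" where
  "G2 z x = (z + max 0 (x - z) / (1 - \<alpha>) - nu.V z) - (\<xi>s + max 0 (x - \<xi>s) / (1 - \<alpha>) - nu.V \<xi>s)"

lemma V_measurable [measurable]: "nu.V \<in> borel_measurable borel"
proof (intro borel_measurable_continuous_onI lipschitz_on_continuous_on lipschitz_onI)
  show "dist (nu.V x) (nu.V y) \<le> (1 + 1 / (1 - \<alpha>)) * dist x y" for x y
    using nu.V_Lipschitz[of x y] by (simp add: dist_real_def)
  show "0 \<le> 1 + 1 / (1 - \<alpha>)" using nu.alpha by simp
qed

lemma G2_measurable [measurable]: "(\<lambda>p. G2 (fst p) (snd p)) \<in> borel_measurable (borel \<Otimes>\<^sub>M borel)"
  unfolding G2_def by measurable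

lemma G2_centered: "(\<integral>x. G2 z x \<partial>\<nu>) = 0"
  unfolding G2_def using nu.prob_space by (simp add: Vfun_def)

text \<open>Unlike the indicator in \<open>G1\<close>, the positive part is Lipschitz in
  \<open>z\<close>. The variance is therefore of second order in the distance, which explains the
  smaller exponent in \<open>G2_sum_bound\<close>.\<close>

lemma G2_abs_le: "\<bar>G2 z x\<bar> \<le> 2 * (1 + h) * \<bar>z - \<xi>s\<bar>"
proof -
  have "\<bar>max 0 (x - z) - max 0 (x - \<xi>s)\<bar> \<le> \<bar>z - \<xi>s\<bar>" by auto
  then have "\<bar>(max 0 (x - z) - max 0 (x - \<xi>s)) / (1 - \<alpha>)\<bar> \<le> h * \<bar>z - \<xi>s\<bar>"
    using nu.alpha by (simp add: h_def abs_divide divide_right_mono)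
  moreover have "\<bar>nu.V z - nu.V \<xi>s\<bar> \<le> (1 + h) * \<bar>z - \<xi>s\<bar>" using nu.V_Lipschitz unfolding h_def .
  moreover have "G2 z x = (z - \<xi>s) + (max 0 (x - z) - max 0 (x - \<xi>s)) / (1 - \<alpha>) - (nu.V z - nu.V \<xi>s)"
    by (simp add: G2_def diff_divide_distrib)
  moreover have "2 * (1 + h) * \<bar>z - \<xi>s\<bar> = \<bar>z - \<xi>s\<bar> + h * \<bar>z - \<xi>s\<bar> + (1 + h) * \<bar>z - \<xi>s\<bar>"
    by (simp add: algebra_simps)
  ultimately show ?thesis by linarith
qed

lemma G2_square_le: "(G2 (\<xi> n \<omega>) x)\<^sup>2 \<le> (2 * (1 + h))\<^sup>2 * (D n \<omega>)\<^sup>2"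
proof -
  have "\<bar>G2 (\<xi> n \<omega>) x\<bar>\<^sup>2 \<le> (2 * (1 + h) * \<bar>D n \<omega>\<bar>)\<^sup>2"
    using G2_abs_le unfolding D_def by (intro power_mono) auto
  then show ?thesis by (simp add: power_mult_distrib)
qed

lemma G2_square_int: "integrable M (\<lambda>\<omega>. (G2 (\<xi> n \<omega>) (X n \<omega>))\<^sup>2)"
proof (rule Bochner_Integration.integrable_bound)
  show "integrable M (\<lambda>\<omega>. (2 * (1 + h))\<^sup>2 * (D n \<omega>)\<^sup>2)" using D2_int by simp
  show "(\<lambda>\<omega>. (G2 (\<xi> n \<omega>) (X n \<omega>))\<^sup>2) \<in> borel_measurable M" unfolding G2_def by measurable
qed (use G2_square_le in auto)

lemma G2_sum_bound:
  "integrable M (\<lambda>\<omega>. \<Sum>k<N. G2 (\<xi> k \<omega>) (X k \<omega>))"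
  "expectation (\<lambda>\<omega>. \<bar>\<Sum>k<N. G2 (\<xi> k \<omega>) (X k \<omega>)\<bar>)
     \<le> 2 * (1 + h) * sqrt (A / (1 - \<beta>)) * real N powr (1 / 2 - \<beta> / 2)"
proof -
  let ?S = "\<lambda>\<omega>. \<Sum>k<N. G2 (\<xi> k \<omega>) (X k \<omega>)"
  have m: "?S \<in> borel_measurable M" unfolding G2_def by measurable
  have le: "expectation (\<lambda>\<omega>. (G2 (\<xi> n \<omega>) (X n \<omega>))\<^sup>2) \<le> (2 * (1 + h))\<^sup>2 * expectation (\<lambda>\<omega>. (D n \<omega>)\<^sup>2)" for n
  proof -
    have "expectation (\<lambda>\<omega>. (G2 (\<xi> n \<omega>) (X n \<omega>))\<^sup>2) \<le> expectation (\<lambda>\<omega>. (2 * (1 + h))\<^sup>2 * (D n \<omega>)\<^sup>2)"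
      by (intro integral_mono G2_square_int G2_square_le) (use D2_int in simp)
    then show ?thesis by simp
  qed
  note mart = martingale_second_moment[OF xi_past G2_measurable G2_centered G2_square_int le, of N]
  show "integrable M ?S" by (rule integrable_of_square[OF m]) (use mart in blast)
  have "expectation (\<lambda>\<omega>. \<bar>?S \<omega>\<bar>) \<le> sqrt (expectation (\<lambda>\<omega>. (?S \<omega>)\<^sup>2))"
    by (rule expectation_abs_le_sqrt[OF m]) (use mart in blast)
  also have "\<dots> \<le> sqrt (\<Sum>k<N. (2 * (1 + h))\<^sup>2 * expectation (\<lambda>\<omega>. (D k \<omega>)\<^sup>2))"
    using mart by (intro real_sqrt_le_mono) blast
  also have "\<dots> \<le> sqrt ((2 * (1 + h))\<^sup>2 * (A / (1 - \<beta>) * real N powr (1 - \<beta>)))"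
    unfolding sum_distrib_left[symmetric] by (intro real_sqrt_le_mono mult_left_mono D2_sum) auto
  also have "\<dots> = 2 * (1 + h) * (sqrt (A / (1 - \<beta>)) * sqrt (real N powr (1 - \<beta>)))"
    unfolding real_sqrt_mult[of "(2 * (1 + h))\<^sup>2"] real_sqrt_mult[of "A / (1 - \<beta>)"] real_sqrt_abs using h_pos by simp
  also have "sqrt (real N powr (1 - \<beta>)) = real N powr (1 / 2 - \<beta> / 2)"
    by (simp add: powr_half_sqrt[symmetric] powr_powr diff_divide_distrib)
  finally show "expectation (\<lambda>\<omega>. \<bar>?S \<omega>\<bar>) \<le> 2 * (1 + h) * sqrt (A / (1 - \<beta>)) * real N powr (1 / 2 - \<beta> / 2)"
    by (simp add: mult.assoc)
qed

text \<open>\<open>w 0 = 0\<close> because \<open>0 powr \<beta> = 0\<close>, so summation by parts leaves no boundary term at \<open>0\<close>.\<close>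
definition w :: "nat \<Rightarrow> real" where "w n = real n powr \<beta> / \<gamma>1"

lemma w_gamma: "w (Suc n) = 1 / \<gamma> (Suc n)"
  by (simp add: w_def powr_minus_divide)

text \<open>The Taylor remainder of \<open>nu.V'\<close> at the quantile, where
  \<open>f \<xi>s * h\<close> is the second derivative of \<open>V\<close>.\<close>

definition R :: "nat \<Rightarrow> 'a \<Rightarrow> real" where "R n \<omega> = nu.V' (\<xi> n \<omega>) - f \<xi>s * h * D n \<omega>"

lemma R_abs_le: "\<bar>R n \<omega>\<bar> \<le> C * h * (D n \<omega>)\<^sup>2"
proof -
  have "R n \<omega> = (cdf \<nu> (\<xi> n \<omega>) - cdf \<nu> \<xi>s - f \<xi>s * (\<xi> n \<omega> - \<xi>s)) * h"
    by (simp add: R_def nu.V'_def quantile h_def D_def diff_divide_distrib)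
  also have "\<bar>\<dots>\<bar> \<le> C * (\<xi> n \<omega> - \<xi>s)\<^sup>2 * h"
    unfolding abs_mult using nu.cdf_Taylor h_pos nu.C_pos by (intro mult_mono) auto
  finally show ?thesis by (simp add: D_def mult_ac)
qed

lemma f_star: "0 < f \<xi>s" "c0 \<le> f \<xi>s"
  using f_ge[of \<xi>s] c0 by auto

text \<open>Divided by its step, the recursion says that a weighted difference of \<open>D\<close>
  equals \<open>H1\<close>, which splits into slope times \<open>D\<close>, the remainder
  \<open>R\<close>, the noise difference \<open>G1\<close> and \<open>H1\<close> at the quantile.
  Solving for \<open>D n\<close> isolates the i.i.d. term subtracted on the left.\<close>

lemma linearization:
  "D n \<omega> - ((if \<xi>s \<le> X n \<omega> then 1 else 0) - (1 - \<alpha>)) / f \<xi>s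
     = ((D n \<omega> - D (Suc n) \<omega>) * w (Suc n) - G1 (\<xi> n \<omega>) (X n \<omega>) - R n \<omega>) / (f \<xi>s * h)"
proof -
  have "\<gamma> (Suc n) \<noteq> 0" by (rule less_imp_neq[OF gamma_pos, symmetric])
  then have "(D n \<omega> - D (Suc n) \<omega>) * w (Suc n) = H1 \<alpha> (\<xi> n \<omega>) (X n \<omega>)"
    unfolding D_Suc w_gamma by simp
  then have "(D n \<omega> - D (Suc n) \<omega>) * w (Suc n) - G1 (\<xi> n \<omega>) (X n \<omega>) - R n \<omega> = f \<xi>s * h * D n \<omega> + H1 \<alpha> \<xi>s (X n \<omega>)"
    by (simp add: G1_def R_def)
  moreover have "H1 \<alpha> \<xi>s (X n \<omega>) = - (((if \<xi>s \<le> X n \<omega> then 1 else 0) - (1 - \<alpha>)) * h)"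
    using nu.alpha by (simp add: H1_def h_def field_simps)
  ultimately have "(D n \<omega> - D (Suc n) \<omega>) * w (Suc n) - G1 (\<xi> n \<omega>) (X n \<omega>) - R n \<omega>
      = f \<xi>s * h * D n \<omega> - ((if \<xi>s \<le> X n \<omega> then 1 else 0) - (1 - \<alpha>)) * h" by linarith
  then show ?thesis using f_star h_pos by (simp add: diff_divide_distrib)
qed

text \<open>The unnormalized error minus its i.i.d. leading term. The average runs over iterates
  \<open>1..N\<close> while the samples are numbered from 0; this shift is the source of
  \<open>D N - D 0\<close> in \<open>T1_eq\<close>.\<close>

definition T1 :: "nat \<Rightarrow> 'a \<Rightarrow> real" where
  "T1 N \<omega> = (\<Sum>k=1..N. D k \<omega>) - (\<Sum>n<N. ((if \<xi>s \<le> X n \<omega> then 1 else 0) - (1 - \<alpha>)) / f \<xi>s)"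

text \<open>In order: the terms from summation by parts, the noise difference, the Taylor remainder
  and the index shift. \<open>c0\<close> stands in for \<open>f \<xi>s\<close> so that the bound
  does not vary with the law.\<close>

definition \<rho>1 :: "nat \<Rightarrow> real" where
  "\<rho>1 N = 1 / (c0 * h) * (sqrt A / \<gamma>1 * (2 / \<beta> + 1) * real N powr (\<beta> / 2)
     + sqrt (h\<^sup>2 * C * sqrt A / (1 - \<beta> / 2)) * real N powr (1 / 2 - \<beta> / 4)
     + C * h * (A / (1 - \<beta>) * real N powr (1 - \<beta>))) + 2 * sqrt A"

lemma T1_eq: "T1 N \<omega> = ((\<Sum>n<N. D n \<omega> * (w (Suc n) - w n)) - D N \<omega> * w N
     - (\<Sum>n<N. G1 (\<xi> n \<omega>) (X n \<omega>)) - (\<Sum>n<N. R n \<omega>)) / (f \<xi>s * h) + D N \<omega> - D 0 \<omega>"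
proof -
  have "(\<Sum>k=1..N. D k \<omega>) = (\<Sum>n<N. D (Suc n) \<omega>)"
    by (rule sum.reindex_bij_witness[where i=Suc and j="\<lambda>k. k - 1"]) auto
  also have "\<dots> = (\<Sum>n<N. D n \<omega>) + D N \<omega> - D 0 \<omega>"
    by (induction N) auto
  finally have "T1 N \<omega> = (\<Sum>n<N. D n \<omega> - ((if \<xi>s \<le> X n \<omega> then 1 else 0) - (1 - \<alpha>)) / f \<xi>s) + D N \<omega> - D 0 \<omega>"
    by (simp add: T1_def sum_subtractf)
  also have "(\<Sum>n<N. D n \<omega> - ((if \<xi>s \<le> X n \<omega> then 1 else 0) - (1 - \<alpha>)) / f \<xi>s)
      = ((\<Sum>n<N. (D n \<omega> - D (Suc n) \<omega>) * w (Suc n)) - (\<Sum>n<N. G1 (\<xi> n \<omega>) (X n \<omega>)) - (\<Sum>n<N. R n \<omega>)) / (f \<xi>s * h)"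
    unfolding linearization by (simp add: sum_divide_distrib[symmetric] sum_subtractf)
  also have "(\<Sum>n<N. (D n \<omega> - D (Suc n) \<omega>) * w (Suc n)) = (\<Sum>n<N. D n \<omega> * (w (Suc n) - w n)) - D N \<omega> * w N"
    by (rule summation_by_parts) (simp add: w_def)
  finally show ?thesis .
qed

lemma T1_bound: "integrable M (T1 N)" "expectation (\<lambda>\<omega>. \<bar>T1 N \<omega>\<bar>) \<le> \<rho>1 N"
proof -
  define v where "v n = real (Suc n) powr (\<beta> - 1) / \<gamma>1" for n
  have b01: "0 < \<beta>" "\<beta> < 1" using beta by auto
  have w_diff: "\<bar>w (Suc n) - w n\<bar> \<le> v n" for n
    using powr_diff_le[OF b01, of n] gamma1
    by (simp add: w_def v_def diff_divide_distrib[symmetric] abs_of_nonneg divide_right_mono)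
  have w_nn: "0 \<le> w n" for n using gamma1 by (simp add: w_def)
  define S where "S \<omega> = (\<Sum>n<N. G1 (\<xi> n \<omega>) (X n \<omega>))" for \<omega>
  note S = G1_sum_bound[of N, folded S_def]
  define B where "B \<omega> = 1 / (c0 * h) * ((\<Sum>n<N. \<bar>D n \<omega>\<bar> * v n) + \<bar>D N \<omega>\<bar> * w N
     + \<bar>S \<omega>\<bar> + (\<Sum>n<N. C * h * (D n \<omega>)\<^sup>2)) + \<bar>D N \<omega>\<bar> + \<bar>D 0 \<omega>\<bar>" for \<omega>
  have B_int: "integrable M B"
    unfolding B_def[abs_def] using D_int D2_int S(1) 
    by (intro Bochner_Integration.integrable_add integrable_mult_right Bochner_Integration.integrable_sum
        integrable_mult_left integrable_abs) auto
  have pw: "\<bar>T1 N \<omega>\<bar> \<le> B \<omega>" for \<omega>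
  proof -
    define a where "a = (\<Sum>n<N. D n \<omega> * (w (Suc n) - w n)) - D N \<omega> * w N - S \<omega> - (\<Sum>n<N. R n \<omega>)"
    define bb where "bb = (\<Sum>n<N. \<bar>D n \<omega>\<bar> * v n) + \<bar>D N \<omega>\<bar> * w N + \<bar>S \<omega>\<bar> + (\<Sum>n<N. C * h * (D n \<omega>)\<^sup>2)"
    have 1: "\<bar>\<Sum>n<N. D n \<omega> * (w (Suc n) - w n)\<bar> \<le> (\<Sum>n<N. \<bar>D n \<omega>\<bar> * v n)"
      using w_diff by (intro order_trans[OF sum_abs] sum_mono) (auto simp: abs_mult intro!: mult_left_mono)
    have 2: "\<bar>\<Sum>n<N. R n \<omega>\<bar> \<le> (\<Sum>n<N. C * h * (D n \<omega>)\<^sup>2)"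
      by (intro order_trans[OF sum_abs] sum_mono R_abs_le)
    have 3: "\<bar>D N \<omega> * w N\<bar> = \<bar>D N \<omega>\<bar> * w N" using w_nn by (simp add: abs_mult)
    have ab: "\<bar>a\<bar> \<le> bb" unfolding a_def bb_def using 1 2 3 by linarith
    then have "\<bar>a / (f \<xi>s * h)\<bar> \<le> bb / (c0 * h)"
      using f_star c0 h_pos unfolding abs_divide by (intro frac_le) (auto simp: abs_mult)
    moreover have "T1 N \<omega> = a / (f \<xi>s * h) + D N \<omega> - D 0 \<omega>" by (simp add: T1_eq a_def S_def)
    moreover have "B \<omega> = bb / (c0 * h) + \<bar>D N \<omega>\<bar> + \<bar>D 0 \<omega>\<bar>" by (simp add: B_def bb_def)
    ultimately show ?thesis by linarith
  qed
  have T1m: "T1 N \<in> borel_measurable M" unfolding T1_def[abs_def] by measurable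
  show T1i: "integrable M (T1 N)"
  proof (rule Bochner_Integration.integrable_bound[OF B_int T1m])
    show "AE \<omega> in M. norm (T1 N \<omega>) \<le> norm (B \<omega>)" using pw by (intro AE_I2) (auto intro: order_trans[OF _ abs_ge_self])
  qed
  \<comment> \<open>\<open>\<bar>D n\<bar>\<close> is of order \<open>n powr (- \<beta> / 2)\<close>
    and the weight increments of order \<open>n powr (\<beta> - 1)\<close>; their products sum to
    order \<open>N powr (\<beta> / 2)\<close>, the same as the boundary term in
    \<open>e2\<close>.\<close>
  have e1: "(\<Sum>n<N. expectation (\<lambda>\<omega>. \<bar>D n \<omega>\<bar>) * v n) \<le> sqrt A / \<gamma>1 * (2 / \<beta> * real N powr (\<beta> / 2))"
  proof -
    have "(\<Sum>n<N. expectation (\<lambda>\<omega>. \<bar>D n \<omega>\<bar>) * v n) \<le> (\<Sum>n<N. sqrt A * real (Suc n) powr (- \<beta> / 2) * v n)"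
      using gamma1 by (intro sum_mono mult_right_mono D_abs_le) (auto simp: v_def)
    also have "\<dots> = (\<Sum>n<N. sqrt A / \<gamma>1 * real (Suc n) powr (- (1 - \<beta> / 2)))"
    proof (rule sum.cong)
      fix n
      have "real (Suc n) powr (- \<beta> / 2) * real (Suc n) powr (\<beta> - 1) = real (Suc n) powr (- (1 - \<beta> / 2))"
      proof -
        have "- \<beta> / 2 + (\<beta> - 1) = - (1 - \<beta> / 2)" by simp
        then show ?thesis unfolding powr_add[symmetric] by (simp only:)
      qed
      then show "sqrt A * real (Suc n) powr (- \<beta> / 2) * v n = sqrt A / \<gamma>1 * real (Suc n) powr (- (1 - \<beta> / 2))"
        unfolding v_def by (metis (no_types, opaque_lifting) mult.assoc times_divide_eq_left times_divide_eq_right mult.commute)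
    qed simp
    also have "\<dots> = sqrt A / \<gamma>1 * (\<Sum>n<N. real (Suc n) powr (- (1 - \<beta> / 2)))" by (simp add: sum_distrib_left)
    also have "\<dots> \<le> sqrt A / \<gamma>1 * (real N powr (1 - (1 - \<beta> / 2)) / (1 - (1 - \<beta> / 2)))"
      using A_nonneg gamma1 b01 by (intro mult_left_mono sum_powr_le) auto
    finally show ?thesis by (simp add: mult.commute)
  qed
  have e2: "expectation (\<lambda>\<omega>. \<bar>D N \<omega>\<bar>) * w N \<le> sqrt A / \<gamma>1 * real N powr (\<beta> / 2)"
  proof (cases "N = 0")
    case False
    have "expectation (\<lambda>\<omega>. \<bar>D N \<omega>\<bar>) * w N \<le> sqrt A * real (Suc N) powr (- \<beta> / 2) * w N"
      using w_nn by (intro mult_right_mono D_abs_le) auto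
    also have "\<dots> \<le> sqrt A * real N powr (- \<beta> / 2) * w N"
      using w_nn A_nonneg b01 False by (intro mult_right_mono mult_left_mono powr_mono2') auto
    also have "\<dots> = sqrt A / \<gamma>1 * (real N powr (- \<beta> / 2) * real N powr \<beta>)" by (simp add: w_def)
    also have "real N powr (- \<beta> / 2) * real N powr \<beta> = real N powr (\<beta> / 2)"
      by (simp add: powr_add[symmetric])
    finally show ?thesis .
  qed (use b01 in \<open>simp add: w_def\<close>)
  have e3: "(\<Sum>n<N. C * h * expectation (\<lambda>\<omega>. (D n \<omega>)\<^sup>2)) \<le> C * h * (A / (1 - \<beta>) * real N powr (1 - \<beta>))"
    unfolding sum_distrib_left[symmetric] using nu.C_pos h_pos by (intro mult_left_mono D2_sum) auto
  have "expectation (\<lambda>\<omega>. \<bar>T1 N \<omega>\<bar>) \<le> expectation B"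
    using T1i B_int pw by (intro integral_mono) auto
  also have "\<dots> = 1 / (c0 * h) * ((\<Sum>n<N. expectation (\<lambda>\<omega>. \<bar>D n \<omega>\<bar>) * v n) + expectation (\<lambda>\<omega>. \<bar>D N \<omega>\<bar>) * w N
     + expectation (\<lambda>\<omega>. \<bar>S \<omega>\<bar>) + (\<Sum>n<N. C * h * expectation (\<lambda>\<omega>. (D n \<omega>)\<^sup>2)))
     + expectation (\<lambda>\<omega>. \<bar>D N \<omega>\<bar>) + expectation (\<lambda>\<omega>. \<bar>D 0 \<omega>\<bar>)"
  proof -
    have i: "integrable M (\<lambda>\<omega>. \<bar>D n \<omega>\<bar>)" "integrable M (\<lambda>\<omega>. \<bar>S \<omega>\<bar>)" for n using D_int S(1) by auto
    show ?thesis unfolding B_def[abs_def] using i D2_int by (simp add: Bochner_Integration.integral_sum)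
  qed
  also have "\<dots> \<le> 1 / (c0 * h) * (sqrt A / \<gamma>1 * (2 / \<beta> * real N powr (\<beta> / 2)) + sqrt A / \<gamma>1 * real N powr (\<beta> / 2)
     + sqrt (h\<^sup>2 * C * sqrt A / (1 - \<beta> / 2)) * real N powr (1 / 2 - \<beta> / 4)
     + C * h * (A / (1 - \<beta>) * real N powr (1 - \<beta>))) + sqrt A + sqrt A"
    using c0 h_pos by (intro add_mono mult_left_mono e1 e2 e3 S(2) D_abs_le') auto
  also have "\<dots> = \<rho>1 N" by (simp add: \<rho>1_def algebra_simps)
  finally show "expectation (\<lambda>\<omega>. \<bar>T1 N \<omega>\<bar>) \<le> \<rho>1 N" .
qed

text \<open>The counterpart of \<open>T1\<close> for expected shortfall. As \<open>V\<close> is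
  stationary at the quantile, errors of the quantile iterates enter its mean only quadratically and
  leave no first-order contribution.\<close>

definition T2 :: "nat \<Rightarrow> 'a \<Rightarrow> real" where
  "T2 N \<omega> = real N * (nsa_chi \<alpha> (\<lambda>n. \<gamma> n) (x0 \<omega>) (\<lambda>k. X k \<omega>) N - nu.V \<xi>s)
     - (\<Sum>n<N. (max 0 (X n \<omega> - \<xi>s) - (\<integral>x. max 0 (x - \<xi>s) \<partial>\<nu>)) / (1 - \<alpha>))"

text \<open>The first term bounds the noise difference \<open>G2\<close>, the second the quadratic
  excess of \<open>V\<close> over its minimum.\<close>

definition \<rho>2 :: "nat \<Rightarrow> real" where
  "\<rho>2 N = 2 * (1 + h) * sqrt (A / (1 - \<beta>)) * real N powr (1 / 2 - \<beta> / 2)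
     + C * h * (A / (1 - \<beta>) * real N powr (1 - \<beta>))"

lemma T2_eq: "T2 N \<omega> = (\<Sum>n<N. G2 (\<xi> n \<omega>) (X n \<omega>)) + (\<Sum>n<N. nu.V (\<xi> n \<omega>) - nu.V \<xi>s)"
proof -
  have "T2 N \<omega> = (\<Sum>n<N. \<xi> n \<omega> + max 0 (X n \<omega> - \<xi> n \<omega>) / (1 - \<alpha>)) - (\<Sum>n<N. nu.V \<xi>s)
     - (\<Sum>n<N. (max 0 (X n \<omega> - \<xi>s) - (\<integral>x. max 0 (x - \<xi>s) \<partial>\<nu>)) / (1 - \<alpha>))"
    unfolding T2_def right_diff_distrib nsa_chi_eq_average \<xi>_def by simp
  also have "\<dots> = (\<Sum>n<N. (\<xi> n \<omega> + max 0 (X n \<omega> - \<xi> n \<omega>) / (1 - \<alpha>)) - nu.V \<xi>s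
     - (max 0 (X n \<omega> - \<xi>s) - (\<integral>x. max 0 (x - \<xi>s) \<partial>\<nu>)) / (1 - \<alpha>))"
    by (simp add: sum_subtractf)
  also have "\<dots> = (\<Sum>n<N. G2 (\<xi> n \<omega>) (X n \<omega>) + (nu.V (\<xi> n \<omega>) - nu.V \<xi>s))"
    by (intro sum.cong refl) (simp add: G2_def Vfun_def diff_divide_distrib)
  finally show ?thesis by (simp add: sum.distrib)
qed

lemma T2_bound: "integrable M (T2 N)" "expectation (\<lambda>\<omega>. \<bar>T2 N \<omega>\<bar>) \<le> \<rho>2 N"
proof -
  define S where "S \<omega> = (\<Sum>n<N. G2 (\<xi> n \<omega>) (X n \<omega>))" for \<omega>
  note S = G2_sum_bound[of N, folded S_def]
  define B where "B \<omega> = \<bar>S \<omega>\<bar> + (\<Sum>n<N. C * h * (D n \<omega>)\<^sup>2)" for \<omega>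
  have B_int: "integrable M B"
    unfolding B_def[abs_def] using D2_int S(1) by auto
  have V: "\<bar>nu.V (\<xi> n \<omega>) - nu.V \<xi>s\<bar> \<le> C * h * (D n \<omega>)\<^sup>2" for n \<omega>
    using nu.V_Taylor[of "\<xi> n \<omega>" \<xi>s] by (simp add: V'_star h_def D_def)
  have pw: "\<bar>T2 N \<omega>\<bar> \<le> B \<omega>" for \<omega>
  proof -
    have "\<bar>\<Sum>n<N. nu.V (\<xi> n \<omega>) - nu.V \<xi>s\<bar> \<le> (\<Sum>n<N. C * h * (D n \<omega>)\<^sup>2)"
      by (intro order_trans[OF sum_abs] sum_mono V)
    then show ?thesis unfolding T2_eq B_def S_def by linarith
  qed
  have T2m: "T2 N \<in> borel_measurable M"
    unfolding T2_eq[abs_def] S_def[symmetric] using S(1) by measurable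
  show T2i: "integrable M (T2 N)"
  proof (rule Bochner_Integration.integrable_bound[OF B_int T2m])
    show "AE \<omega> in M. norm (T2 N \<omega>) \<le> norm (B \<omega>)" using pw by (intro AE_I2) (auto intro: order_trans[OF _ abs_ge_self])
  qed
  have "expectation (\<lambda>\<omega>. \<bar>T2 N \<omega>\<bar>) \<le> expectation B"
    using T2i B_int pw by (intro integral_mono) auto
  also have "\<dots> = expectation (\<lambda>\<omega>. \<bar>S \<omega>\<bar>) + C * h * (\<Sum>n<N. expectation (\<lambda>\<omega>. (D n \<omega>)\<^sup>2))"
    unfolding B_def[abs_def] using S(1) D2_int by (simp add: sum_distrib_left)
  also have "\<dots> \<le> \<rho>2 N"
    unfolding \<rho>2_def using nu.C_pos h_pos by (intro add_mono S(2) mult_left_mono D2_sum) auto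
  finally show "expectation (\<lambda>\<omega>. \<bar>T2 N \<omega>\<bar>) \<le> \<rho>2 N" .
qed

end

section \<open>Moments, densities and Gaussian limits\<close>

lemma one_plus_powr_le:
  fixes y p :: real
  assumes "0 \<le> y" "0 \<le> p"
  shows "(1 + y) powr p \<le> 2 powr p * (1 + y powr p)"
proof -
  have "(1 + y) powr p \<le> (2 * max 1 y) powr p" using assms by (intro powr_mono2) auto
  also have "\<dots> = 2 powr p * max 1 y powr p" by (simp add: powr_mult)
  also have "\<dots> \<le> 2 powr p * (1 + y powr p)"
    by (intro mult_left_mono) (auto simp: max_def)
  finally show ?thesis .
qed

text \<open>Jensen's inequality for the power function. Adding 1 to each absolute value keeps the
  arguments strictly positive, at the price of the factor \<open>2 powr p\<close>.\<close>

lemma powr_mean_le: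
  fixes a :: "nat \<Rightarrow> real"
  assumes p: "1 \<le> p" and K: "1 \<le> K"
  shows "\<bar>(\<Sum>k<K. a k) / real K\<bar> powr p \<le> (\<Sum>k<K. 2 powr p * (1 + \<bar>a k\<bar> powr p)) / real K"
proof -
  have "\<bar>(\<Sum>k<K. a k) / real K\<bar> \<le> (\<Sum>k<K. (1 / real K) * (1 + \<bar>a k\<bar>))"
  proof -
    have "\<bar>\<Sum>k<K. a k\<bar> \<le> (\<Sum>k<K. 1 + \<bar>a k\<bar>)" by (intro order_trans[OF sum_abs] sum_mono) auto
    then show ?thesis by (simp add: abs_divide divide_right_mono sum_divide_distrib[symmetric])
  qed
  then have "\<bar>(\<Sum>k<K. a k) / real K\<bar> powr p \<le> (\<Sum>k<K. (1 / real K) * (1 + \<bar>a k\<bar>)) powr p"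
    using p by (intro powr_mono2) auto
  also have "\<dots> \<le> (\<Sum>k<K. (1 / real K) * (1 + \<bar>a k\<bar>) powr p)"
    using convex_on_sum[OF _ _ powr_convex[OF p], of "{..<K}" "\<lambda>_. 1 / real K" "\<lambda>k. 1 + \<bar>a k\<bar>"] K
    by (auto simp: lessThan_empty_iff add_pos_nonneg)
  also have "\<dots> \<le> (\<Sum>k<K. (1 / real K) * (2 powr p * (1 + \<bar>a k\<bar> powr p)))"
    using p by (intro sum_mono mult_left_mono one_plus_powr_le) auto
  finally show ?thesis by (simp add: sum_divide_distrib)
qed

text \<open>The map \<open>g\<close> allows a projection: independence from a whole sequence of
  copies yields the joint law with a single copy.\<close>

lemma (in prob_space) distr_pair_indep_var2:
  assumes ind: "indep_var2 M Ma A Mb B" and g [measurable]: "g \<in> measurable Mb Mc"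
  shows "distr M Ma A \<Otimes>\<^sub>M distr M Mc (\<lambda>\<omega>. g (B \<omega>)) = distr M (Ma \<Otimes>\<^sub>M Mc) (\<lambda>\<omega>. (A \<omega>, g (B \<omega>)))"
proof (rule pair_measure_eqI)
  have [measurable]: "A \<in> measurable M Ma" "B \<in> measurable M Mb"
    and iset: "indep_set (sigma_sets (space M) {A -` S \<inter> space M | S. S \<in> sets Ma})
       (sigma_sets (space M) {B -` S \<inter> space M | S. S \<in> sets Mb})"
    using ind by (auto simp: indep_var2_def)
  interpret A: prob_space "distr M Ma A" by (rule prob_space_distr) simp
  interpret B: prob_space "distr M Mc (\<lambda>\<omega>. g (B \<omega>))" by (rule prob_space_distr) simp
  show "sigma_finite_measure (distr M Ma A)" "sigma_finite_measure (distr M Mc (\<lambda>\<omega>. g (B \<omega>)))" by unfold_locales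
  show "sets (distr M Ma A \<Otimes>\<^sub>M distr M Mc (\<lambda>\<omega>. g (B \<omega>))) = sets (distr M (Ma \<Otimes>\<^sub>M Mc) (\<lambda>\<omega>. (A \<omega>, g (B \<omega>))))"
    by (simp cong: sets_pair_measure_cong)
  fix S T assume "S \<in> sets (distr M Ma A)" "T \<in> sets (distr M Mc (\<lambda>\<omega>. g (B \<omega>)))"
  then have S [measurable]: "S \<in> sets Ma" and T [measurable]: "T \<in> sets Mc" by auto
  have eq: "(\<lambda>\<omega>. g (B \<omega>)) -` T \<inter> space M = B -` (g -` T \<inter> space Mb) \<inter> space M"
    using measurable_space[of B M Mb] by auto
  have "(\<lambda>\<omega>. (A \<omega>, g (B \<omega>))) -` (S \<times> T) \<inter> space M = (A -` S \<inter> space M) \<inter> ((\<lambda>\<omega>. g (B \<omega>)) -` T \<inter> space M)"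
    by auto
  moreover have "prob ((A -` S \<inter> space M) \<inter> ((\<lambda>\<omega>. g (B \<omega>)) -` T \<inter> space M))
      = prob (A -` S \<inter> space M) * prob ((\<lambda>\<omega>. g (B \<omega>)) -` T \<inter> space M)"
    unfolding eq using S measurable_sets[OF g T] by (intro indep_setD[OF iset] sigma_sets.Basic) blast+
  ultimately show "emeasure (distr M Ma A) S * emeasure (distr M Mc (\<lambda>\<omega>. g (B \<omega>))) T
      = emeasure (distr M (Ma \<Otimes>\<^sub>M Mc) (\<lambda>\<omega>. (A \<omega>, g (B \<omega>)))) (S \<times> T)"
    by (simp add: emeasure_distr emeasure_eq_measure ennreal_mult)
qed

lemma (in prob_space) average_moment_le:
  fixes U :: "nat \<Rightarrow> 'a \<Rightarrow> real"
  assumes [measurable]: "\<And>k. U k \<in> borel_measurable M"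
    and p: "1 \<le> p" and K: "1 \<le> K"
    and int: "\<And>k. integrable M (\<lambda>\<omega>. \<bar>U k \<omega>\<bar> powr p)"
    and m: "\<And>k. expectation (\<lambda>\<omega>. \<bar>U k \<omega>\<bar> powr p) = m"
  shows "(\<integral>\<^sup>+\<omega>. ennreal (\<bar>(\<Sum>k<K. U k \<omega>) / real K\<bar> powr p) \<partial>M) \<le> ennreal (2 powr p * (1 + m))"
proof -
  let ?B = "\<lambda>\<omega>. (\<Sum>k<K. 2 powr p * (1 + \<bar>U k \<omega>\<bar> powr p)) / real K"
  have Bi: "integrable M ?B" using int by simp
  have "(\<integral>\<^sup>+\<omega>. ennreal (\<bar>(\<Sum>k<K. U k \<omega>) / real K\<bar> powr p) \<partial>M) \<le> (\<integral>\<^sup>+\<omega>. ennreal (?B \<omega>) \<partial>M)"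
    using powr_mean_le[OF p K] by (intro nn_integral_mono ennreal_leI)
  also have "\<dots> = ennreal (expectation ?B)"
    by (intro nn_integral_eq_integral[OF Bi] AE_I2 divide_nonneg_nonneg sum_nonneg) auto
  also have "expectation ?B = 2 powr p * (1 + m)"
    using int K by (simp add: m prob_space)
  finally show ?thesis .
qed

text \<open>Fatou's lemma carries the uniform moment bound over to the limit law. Index 0 denotes
  the limit here, not the start of the sequence.\<close>

lemma lborel_density_moment_Fatou:
  fixes f :: "nat \<Rightarrow> real \<Rightarrow> real"
  assumes [measurable]: "\<And>K. f K \<in> borel_measurable borel"
    and lim: "\<And>x. (\<lambda>K. f K x) \<longlonglongrightarrow> f 0 x"
    and m: "\<And>K. K \<ge> 1 \<Longrightarrow> (\<integral>\<^sup>+x. ennreal (f K x) * ennreal (\<bar>x\<bar> powr p) \<partial>lborel) \<le> m"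
  shows "(\<integral>\<^sup>+x. ennreal (f 0 x) * ennreal (\<bar>x\<bar> powr p) \<partial>lborel) \<le> m"
proof -
  have "(\<integral>\<^sup>+x. ennreal (f 0 x) * ennreal (\<bar>x\<bar> powr p) \<partial>lborel)
      = (\<integral>\<^sup>+x. liminf (\<lambda>K. ennreal (f K x) * ennreal (\<bar>x\<bar> powr p)) \<partial>lborel)"
  proof (intro nn_integral_cong lim_imp_Liminf[symmetric])
    show "(\<lambda>K. ennreal (f K x) * ennreal (\<bar>x\<bar> powr p)) \<longlonglongrightarrow> ennreal (f 0 x) * ennreal (\<bar>x\<bar> powr p)" for x
      by (rule tendsto_mult_ennreal) (auto intro!: tendsto_ennrealI lim)
  qed simp
  also have "\<dots> \<le> liminf (\<lambda>K. \<integral>\<^sup>+x. ennreal (f K x) * ennreal (\<bar>x\<bar> powr p) \<partial>lborel)"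
    by (rule nn_integral_liminf) measurable
  also have "\<dots> \<le> liminf (\<lambda>K. m)"
    by (rule Liminf_mono) (use m in \<open>auto simp: eventually_sequentially intro!: exI[of _ 1]\<close>)
  finally show ?thesis by (simp add: Liminf_const)
qed

text \<open>On a bounded interval the densities are bounded by \<open>C\<close> and dominated
  convergence applies. Beyond \<open>R \<ge> 1\<close> one has
  \<open>1 + x\<^sup>2 \<le> 2 * x\<^sup>2\<close>, and the moment of order \<open>p > 2\<close>
  makes the tail at most of order \<open>R powr (2 - p)\<close>, uniformly in
  \<open>K\<close>.\<close>

lemma density_integral_tendsto:
  fixes f :: "nat \<Rightarrow> real \<Rightarrow> real" and \<nu> :: "nat \<Rightarrow> real measure" and g :: "real \<Rightarrow> real"
  assumes fm [measurable]: "\<And>K. f K \<in> borel_measurable borel"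
    and f0: "\<And>K x. 0 \<le> f K x" and fC: "\<And>K x. f K x \<le> C"
    and \<nu>: "\<And>K. \<nu> K = density lborel (\<lambda>x. ennreal (f K x))" "\<And>K. prob_space (\<nu> K)"
    and lim: "\<And>x. (\<lambda>K. f K x) \<longlonglongrightarrow> f 0 x"
    and p: "2 < p"
    and m_int: "\<And>K. integrable (\<nu> K) (\<lambda>x. \<bar>x\<bar> powr p)"
    and m: "\<And>K. (\<integral>x. \<bar>x\<bar> powr p \<partial>\<nu> K) \<le> m"
    and gm [measurable]: "g \<in> borel_measurable borel" and g: "\<And>x. \<bar>g x\<bar> \<le> a * (1 + x\<^sup>2)" and g_int: "\<And>K. integrable (\<nu> K) g"
  shows "(\<lambda>K. \<integral>x. g x \<partial>\<nu> K) \<longlonglongrightarrow> (\<integral>x. g x \<partial>\<nu> 0)"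
proof -
  interpret prob_space "\<nu> K" for K by fact
  have sets\<nu> [measurable_cong]: "sets (\<nu> K) = sets borel" for K by (simp add: \<nu>(1))
  have a0: "0 \<le> a" using g[of 0] by simp
  have m0: "0 \<le> m" using m[of 0] by (rule order_trans[rotated]) simp
  define gR where "gR R x = g x * indicator {-R..R} x" for R x
  have gRm [measurable]: "gR R \<in> borel_measurable borel" for R unfolding gR_def[abs_def] by measurable
  have gR_int: "integrable (\<nu> K) (gR R)" for K R
    by (rule Bochner_Integration.integrable_bound[OF g_int]) (auto simp: gR_def split: split_indicator)
  have C0: "0 \<le> C" using f0[of 0 0] fC[of 0 0] by linarith
  have conv: "(\<lambda>K. \<integral>x. gR R x \<partial>\<nu> K) \<longlonglongrightarrow> (\<integral>x. gR R x \<partial>\<nu> 0)" for R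
  proof -
    have "(\<lambda>K. \<integral>x. f K x * gR R x \<partial>lborel) \<longlonglongrightarrow> (\<integral>x. f 0 x * gR R x \<partial>lborel)"
    proof (rule integral_dominated_convergence[where w="\<lambda>x. C * (a * (1 + R\<^sup>2)) * indicator {-R..R} x"])
      show "AE x in lborel. (\<lambda>K. f K x * gR R x) \<longlonglongrightarrow> f 0 x * gR R x"
        by (intro AE_I2 tendsto_intros lim)
      show "AE x in lborel. norm (f K x * gR R x) \<le> C * (a * (1 + R\<^sup>2)) * indicator {-R..R} x" for K
      proof (intro AE_I2)
        fix x
        show "norm (f K x * gR R x) \<le> C * (a * (1 + R\<^sup>2)) * indicator {-R..R} x"
        proof (cases "x \<in> {-R..R}")
          case True
          then have "x\<^sup>2 \<le> R\<^sup>2" by (intro abs_le_square_iff[THEN iffD1]) auto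
          then have "\<bar>g x\<bar> \<le> a * (1 + R\<^sup>2)" using g[of x] a0 by (meson add_left_mono mult_left_mono order_trans)
          then have "f K x * \<bar>g x\<bar> \<le> C * (a * (1 + R\<^sup>2))" using fC f0 C0 by (intro mult_mono) auto
          then show ?thesis using True f0 by (simp add: gR_def abs_mult)
        qed (simp add: gR_def)
      qed
      show "integrable lborel (\<lambda>x. C * (a * (1 + R\<^sup>2)) * indicator {-R..R} x)"
        by (intro integrable_mult_right integrable_real_indicator) (auto simp: emeasure_lborel_Icc_eq)
    qed measurable
    then show ?thesis unfolding \<nu>(1) using f0 by (simp add: integral_density)
  qed
  have tail: "\<bar>(\<integral>x. g x \<partial>\<nu> K) - (\<integral>x. gR R x \<partial>\<nu> K)\<bar> \<le> 2 * a * R powr (2 - p) * m" if R: "1 \<le> R" for K R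
  proof -
    have "\<bar>(\<integral>x. g x \<partial>\<nu> K) - (\<integral>x. gR R x \<partial>\<nu> K)\<bar> = \<bar>\<integral>x. g x - gR R x \<partial>\<nu> K\<bar>"
      using g_int gR_int by simp
    also have "\<dots> \<le> (\<integral>x. \<bar>g x - gR R x\<bar> \<partial>\<nu> K)" by (rule integral_abs_bound)
    also have "\<dots> \<le> (\<integral>x. 2 * a * R powr (2 - p) * \<bar>x\<bar> powr p \<partial>\<nu> K)"
    proof (rule integral_mono)
      fix x
      show "\<bar>g x - gR R x\<bar> \<le> 2 * a * R powr (2 - p) * \<bar>x\<bar> powr p"
      proof (cases "x \<in> {-R..R}")
        case True
        then show ?thesis using a0 by (simp add: gR_def)
      next
        case False
        then have x: "R \<le> \<bar>x\<bar>" "1 \<le> \<bar>x\<bar>" using R by auto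
        have "1 \<le> x\<^sup>2" using x(2) by (simp add: abs_square_le_1 one_le_power abs_le_square_iff[of 1 x, simplified])
        have "\<bar>x\<bar> powr (2 - p) \<le> R powr (2 - p)" using x R p by (intro powr_mono2') auto
        then have "\<bar>x\<bar> powr (2 - p) * \<bar>x\<bar> powr p \<le> R powr (2 - p) * \<bar>x\<bar> powr p" by (intro mult_right_mono) auto
        then have "x\<^sup>2 \<le> R powr (2 - p) * \<bar>x\<bar> powr p" using x by (simp add: powr_add[symmetric])
        then have "2 * a * x\<^sup>2 \<le> 2 * a * (R powr (2 - p) * \<bar>x\<bar> powr p)" using a0 by (intro mult_left_mono) auto
        moreover have "\<bar>g x\<bar> \<le> 2 * a * x\<^sup>2"
        proof -
          have "a * (1 + x\<^sup>2) \<le> a * (2 * x\<^sup>2)" using a0 \<open>1 \<le> x\<^sup>2\<close> by (intro mult_left_mono) auto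
          with g[of x] show ?thesis by simp
        qed
        ultimately show ?thesis using False by (simp add: gR_def mult.assoc)
      qed
    qed (use g_int gR_int m_int in auto)
    also have "\<dots> = 2 * a * R powr (2 - p) * (\<integral>x. \<bar>x\<bar> powr p \<partial>\<nu> K)" by simp
    also have "\<dots> \<le> 2 * a * R powr (2 - p) * m" using a0 m by (intro mult_left_mono) auto
    finally show ?thesis .
  qed
  show ?thesis
  proof (rule LIMSEQ_I)
    fix r :: real assume r: "0 < r"
    have "(\<lambda>n. 2 * a * real n powr (2 - p) * m) \<longlonglongrightarrow> 2 * a * 0 * m"
      using p by (intro tendsto_intros tendsto_neg_powr filterlim_real_sequentially) auto
    then have "\<forall>\<^sub>F n in sequentially. 2 * a * real n powr (2 - p) * m < r / 3"
      using r by (intro order_tendstoD(2)) auto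
    then obtain n where n: "1 \<le> n" "2 * a * real n powr (2 - p) * m < r / 3"
      using eventually_happens'[OF sequentially_bot eventually_conj[OF eventually_ge_at_top[of 1]]] by blast
    have t: "\<bar>(\<integral>x. g x \<partial>\<nu> K) - (\<integral>x. gR (real n) x \<partial>\<nu> K)\<bar> < r / 3" for K
      using tail[of "real n" K] n by simp
    obtain N where N: "\<And>K. K \<ge> N \<Longrightarrow> \<bar>(\<integral>x. gR (real n) x \<partial>\<nu> K) - (\<integral>x. gR (real n) x \<partial>\<nu> 0)\<bar> < r / 3"
      using LIMSEQ_D[OF conv[of "real n"], of "r / 3"] r by auto
    have "norm ((\<integral>x. g x \<partial>\<nu> K) - (\<integral>x. g x \<partial>\<nu> 0)) < r" if "K \<ge> N" for K
    proof -
      have "\<bar>a - b\<bar> < r" if "\<bar>a - a'\<bar> < r / 3" "\<bar>b - b'\<bar> < r / 3" "\<bar>a' - b'\<bar> < r / 3" for a b a' b' :: real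
        using that by linarith
      from this[OF t[of K] t[of 0] N[OF that]] show ?thesis by simp
    qed
    then show "\<exists>no. \<forall>K\<ge>no. norm ((\<integral>x. g x \<partial>\<nu> K) - (\<integral>x. g x \<partial>\<nu> 0)) < r" by blast
  qed
qed

text \<open>The condition \<open>psd\<close> makes the radicand of the second Cholesky entry
  nonnegative, so that \<open>c\<^sup>2 = s22 - b\<^sup>2\<close>; the two independent factors then
  combine to the quadratic form.\<close>

lemma gauss2_char:
  fixes s11 s12 s22 s t :: real
  assumes s11: "0 < s11" and psd: "s12\<^sup>2 / s11 \<le> s22"
  shows "(\<integral>p. iexp (s * fst p + t * snd p) \<partial>gauss2 s11 s12 s22)
      = complex_of_real (exp (- (s\<^sup>2 * s11 + 2 * s * t * s12 + t\<^sup>2 * s22) / 2))"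
    and "prob_space (gauss2 s11 s12 s22)" "sets (gauss2 s11 s12 s22) = sets borel"
proof -
  define a where "a = sqrt s11"
  define b where "b = s12 / a"
  define c where "c = sqrt (s22 - b\<^sup>2)"
  have a: "0 < a" "a\<^sup>2 = s11" "a * b = s12" using s11 by (auto simp: a_def b_def)
  have b2: "b\<^sup>2 = s12\<^sup>2 / s11" using a by (simp add: b_def power_divide)
  have c2: "c\<^sup>2 = s22 - b\<^sup>2" using psd b2 by (simp add: c_def)
  interpret N: prob_space std_normal unfolding std_normal_def by (rule prob_space_normal_density) simp
  interpret P: pair_prob_space std_normal std_normal ..
  have sn [measurable_cong]: "sets std_normal = sets borel" by (simp add: std_normal_def)
  have m: "(\<lambda>(g1, g2). (a * g1, b * g1 + c * g2)) \<in> borel_measurable (std_normal \<Otimes>\<^sub>M std_normal)"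
    unfolding borel_prod[symmetric] by measurable
  have g: "gauss2 s11 s12 s22 = distr (std_normal \<Otimes>\<^sub>M std_normal) borel (\<lambda>(g1, g2). (a * g1, b * g1 + c * g2))"
    by (simp add: gauss2_def Let_def a_def b_def c_def)
  show "prob_space (gauss2 s11 s12 s22)" unfolding g by (rule P.prob_space_distr[OF m])
  show "sets (gauss2 s11 s12 s22) = sets borel" unfolding g by simp
  let ?u = "s * a + t * b" and ?v = "t * c"
  have char: "(\<integral>x. iexp (z * x) \<partial>std_normal) = complex_of_real (exp (- (z\<^sup>2) / 2))" for z
    using char_std_normal_distribution by (simp add: char_def std_normal_def fun_eq_iff)
  have int: "integrable (std_normal \<Otimes>\<^sub>M std_normal) (\<lambda>p. iexp (?u * fst p) * iexp (?v * snd p))"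
    by (rule P.integrable_const_bound[where B=1]) (auto simp: norm_mult)
  have "(\<integral>p. iexp (s * fst p + t * snd p) \<partial>gauss2 s11 s12 s22)
      = (\<integral>p. iexp (s * fst (case p of (g1, g2) \<Rightarrow> (a * g1, b * g1 + c * g2)) + t * snd (case p of (g1, g2) \<Rightarrow> (a * g1, b * g1 + c * g2))) \<partial>(std_normal \<Otimes>\<^sub>M std_normal))"
    unfolding g by (subst integral_distr[OF m]) (auto intro!: borel_measurable_continuous_onI continuous_intros)
  also have "\<dots> = (\<integral>p. iexp (?u * fst p) * iexp (?v * snd p) \<partial>(std_normal \<Otimes>\<^sub>M std_normal))"
    by (intro Bochner_Integration.integral_cong) (auto simp: exp_add[symmetric] algebra_simps)
  also have "\<dots> = (\<integral>x. (\<integral>y. iexp (?u * x) * iexp (?v * y) \<partial>std_normal) \<partial>std_normal)"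
    using P.integral_fst'[OF int] by simp
  also have "\<dots> = (\<integral>x. iexp (?u * x) * complex_of_real (exp (- (?v\<^sup>2) / 2)) \<partial>std_normal)"
    by (simp only: char integral_mult_right_zero)
  also have "\<dots> = complex_of_real (exp (- (?u\<^sup>2) / 2)) * complex_of_real (exp (- (?v\<^sup>2) / 2))"
    by (simp only: char integral_mult_left_zero)
  also have "\<dots> = complex_of_real (exp (- (?u\<^sup>2 + ?v\<^sup>2) / 2))"
    unfolding of_real_mult[symmetric] exp_add[symmetric] by (simp add: add_divide_distrib)
  also have "?u\<^sup>2 + ?v\<^sup>2 = s\<^sup>2 * a\<^sup>2 + 2 * s * t * (a * b) + t\<^sup>2 * (b\<^sup>2 + c\<^sup>2)"
    by (simp add: power2_eq_square algebra_simps)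
  also have "\<dots> = s\<^sup>2 * s11 + 2 * s * t * s12 + t\<^sup>2 * s22" by (simp add: a c2)
  finally show "(\<integral>p. iexp (s * fst p + t * snd p) \<partial>gauss2 s11 s12 s22)
      = complex_of_real (exp (- (s\<^sup>2 * s11 + 2 * s * t * s12 + t\<^sup>2 * s22) / 2))" .
qed

text \<open>Dividing by \<open>K\<close> means dividing by the square root of the sample size
  \<open>K\<^sup>2\<close>, so exponents below 1/2 are negligible.\<close>

lemma powr_square_over_tendsto_0:
  assumes "q < 1 / 2"
  shows "(\<lambda>K. real (K\<^sup>2) powr q / real K) \<longlonglongrightarrow> 0"
proof -
  have "(\<lambda>K. real K powr (2 * q - 1)) \<longlonglongrightarrow> 0"
    using assms by (intro tendsto_neg_powr filterlim_real_sequentially) auto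
  moreover have "\<forall>\<^sub>F K in sequentially. real K powr (2 * q - 1) = real (K\<^sup>2) powr q / real K"
    using eventually_gt_at_top[of 0]
  proof eventually_elim
    case (elim K)
    then have "real (K\<^sup>2) = real K powr 2" by (simp add: powr_numeral)
    then have "real (K\<^sup>2) powr q = real K powr (2 * q)" by (simp only: powr_powr)
    then show ?case using elim by (simp only: powr_diff) simp
  qed
  ultimately show ?thesis by (rule Lim_transform_eventually)
qed

section \<open>Influence function of quantile and expected shortfall\<close>

context lipschitz_density
begin

text \<open>\<open>(s, t)\<close> times the influence function of the pair (quantile, expected shortfall).\<close>
definition influence :: "real \<Rightarrow> real \<Rightarrow> real \<Rightarrow> real \<Rightarrow> real" where
  "influence \<xi> s t x = s * (((if \<xi> \<le> x then 1 else 0) - (1 - \<alpha>)) / f \<xi>)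
     + t * ((max 0 (x - \<xi>) - (\<integral>x. max 0 (x - \<xi>) \<partial>\<nu>)) / (1 - \<alpha>))"

lemma influence_measurable [measurable]: "influence \<xi> s t \<in> borel_measurable borel"
  unfolding influence_def[abs_def] by measurable

lemma influence_moments:
  assumes q: "cdf \<nu> \<xi> = \<alpha>" and x2: "integrable \<nu> (\<lambda>x. x\<^sup>2)"
  shows "integrable \<nu> (influence \<xi> s t)" "(\<integral>x. influence \<xi> s t x \<partial>\<nu>) = 0"
    "integrable \<nu> (\<lambda>x. (influence \<xi> s t x)\<^sup>2)"
    "(\<integral>x. (influence \<xi> s t x)\<^sup>2 \<partial>\<nu>) = s\<^sup>2 * (\<alpha> * (1 - \<alpha>) / (f \<xi>)\<^sup>2)
      + 2 * s * t * (\<alpha> / (1 - \<alpha>) * (\<integral>x. max 0 (x - \<xi>) \<partial>\<nu>) / f \<xi>)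
      + t\<^sup>2 * (variance (\<lambda>x. max 0 (x - \<xi>)) / (1 - \<alpha>)\<^sup>2)"
proof -
  define m where "m = (\<integral>x. max 0 (x - \<xi>) \<partial>\<nu>)"
  define I where "I x = (if \<xi> \<le> x then 1 else 0 :: real)" for x
  define P where "P x = max 0 (x - \<xi>)" for x
  have [measurable]: "I \<in> borel_measurable borel" "P \<in> borel_measurable borel"
    unfolding I_def[abs_def] P_def[abs_def] by measurable
  have I_int: "integrable \<nu> I" unfolding I_def[abs_def] by simp
  have I_mean: "(\<integral>x. I x \<partial>\<nu>) = 1 - \<alpha>" unfolding I_def by (simp add: integral_tail_indicator q)
  have P_int: "integrable \<nu> P" unfolding P_def[abs_def] by simp
  have P_mean: "(\<integral>x. P x \<partial>\<nu>) = m" by (simp add: P_def m_def)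
  have P2_int: "integrable \<nu> (\<lambda>x. (P x)\<^sup>2)"
  proof (rule Bochner_Integration.integrable_bound)
    show "integrable \<nu> (\<lambda>x. 2 * x\<^sup>2 + 2 * \<xi>\<^sup>2)" using x2 by simp
    have "(P x)\<^sup>2 \<le> 2 * x\<^sup>2 + 2 * \<xi>\<^sup>2" for x
    proof -
      have "(P x)\<^sup>2 \<le> (x - \<xi>)\<^sup>2" by (simp add: P_def max_def)
      also have "\<dots> \<le> (x - \<xi>)\<^sup>2 + (x + \<xi>)\<^sup>2" by simp
      also have "\<dots> = 2 * x\<^sup>2 + 2 * \<xi>\<^sup>2" by (simp add: power2_eq_square algebra_simps)
      finally show ?thesis .
    qed
    then show "AE x in \<nu>. norm ((P x)\<^sup>2) \<le> norm (2 * x\<^sup>2 + 2 * \<xi>\<^sup>2)" by simp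
  qed measurable
  \<comment> \<open>These identities linearize the square; the mixed moment becomes
    \<open>m\<close>, whence the covariance \<open>\<alpha> * m\<close> of indicator and
    excess.\<close>
  have I2: "(I x)\<^sup>2 = I x" and IP: "I x * P x = P x" for x by (auto simp: I_def P_def)
  define A where "A = s / f \<xi>"
  define B where "B = t / (1 - \<alpha>)"
  have inf: "influence \<xi> s t x = A * (I x - (1 - \<alpha>)) + B * (P x - m)" for x
    by (simp add: influence_def A_def B_def I_def P_def m_def)
  show "integrable \<nu> (influence \<xi> s t)" unfolding inf[abs_def] using I_int P_int by simp
  show "(\<integral>x. influence \<xi> s t x \<partial>\<nu>) = 0" unfolding inf using I_int P_int prob_space by (simp add: I_mean P_mean)
  have sq: "(influence \<xi> s t x)\<^sup>2 = A\<^sup>2 * ((1 - 2 * (1 - \<alpha>)) * I x + (1 - \<alpha>)\<^sup>2)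
      + 2 * A * B * (\<alpha> * P x - m * I x + (1 - \<alpha>) * m) + B\<^sup>2 * ((P x)\<^sup>2 - 2 * m * P x + m\<^sup>2)" for x
  proof -
    have "(influence \<xi> s t x)\<^sup>2 = A\<^sup>2 * ((I x)\<^sup>2 - 2 * (1 - \<alpha>) * I x + (1 - \<alpha>)\<^sup>2)
      + 2 * A * B * (I x * P x - (1 - \<alpha>) * P x - m * I x + (1 - \<alpha>) * m) + B\<^sup>2 * ((P x)\<^sup>2 - 2 * m * P x + m\<^sup>2)"
      unfolding inf by (simp add: power2_eq_square algebra_simps)
    then show ?thesis unfolding I2 IP by (simp add: algebra_simps)
  qed
  show "integrable \<nu> (\<lambda>x. (influence \<xi> s t x)\<^sup>2)" unfolding sq using I_int P_int P2_int by simp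
  have "(\<integral>x. (influence \<xi> s t x)\<^sup>2 \<partial>\<nu>) = A\<^sup>2 * ((1 - 2 * (1 - \<alpha>)) * (1 - \<alpha>) + (1 - \<alpha>)\<^sup>2)
      + 2 * A * B * (\<alpha> * m - m * (1 - \<alpha>) + (1 - \<alpha>) * m) + B\<^sup>2 * ((\<integral>x. (P x)\<^sup>2 \<partial>\<nu>) - 2 * m * m + m\<^sup>2)"
    unfolding sq using I_int P_int P2_int prob_space by (simp add: I_mean P_mean)
  also have "\<dots> = A\<^sup>2 * (\<alpha> * (1 - \<alpha>)) + 2 * A * B * (\<alpha> * m) + B\<^sup>2 * ((\<integral>x. (P x)\<^sup>2 \<partial>\<nu>) - m\<^sup>2)"
    by (simp add: power2_eq_square algebra_simps)
  also have "(\<integral>x. (P x)\<^sup>2 \<partial>\<nu>) - m\<^sup>2 = variance P"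
    using variance_eq[OF P_int P2_int] by (simp only: P_mean)
  finally show "(\<integral>x. (influence \<xi> s t x)\<^sup>2 \<partial>\<nu>) = s\<^sup>2 * (\<alpha> * (1 - \<alpha>) / (f \<xi>)\<^sup>2)
      + 2 * s * t * (\<alpha> / (1 - \<alpha>) * (\<integral>x. max 0 (x - \<xi>) \<partial>\<nu>) / f \<xi>)
      + t\<^sup>2 * (variance (\<lambda>x. max 0 (x - \<xi>)) / (1 - \<alpha>)\<^sup>2)"
    unfolding m_def[symmetric] P_def[symmetric] by (simp add: A_def B_def power_divide mult_ac P_mean)
qed

end

section \<open>Limits of the asymptotic covariances\<close>

lemma powr_ge_of_le:
  fixes x p q :: real
  assumes "0 \<le> x" "0 \<le> q" "q \<le> p"
  shows "x powr q \<le> 1 + x powr p"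
proof (cases "1 \<le> x")
  case True
  then have "x powr q \<le> x powr p" using assms by (intro powr_mono) auto
  then show ?thesis by simp
next
  case False
  then have "x powr q \<le> 1" using assms by (intro powr_le1) auto
  then show ?thesis by (smt (verit) powr_ge_zero)
qed

text \<open>Index 0 stands for h = 0 and \<open>K \<ge> 1\<close> for h = 1/K, so sequences converge
  to their own value at 0. The bounds \<open>C\<close>, \<open>m\<close> and \<open>c0\<close> are
  common to all indices, and \<open>p \<le> 3\<close> matches the exponent \<open>d \<le> 1\<close>
  of the central limit theorem.\<close>

locale density_family =
  fixes \<nu> :: "nat \<Rightarrow> real measure" and f :: "nat \<Rightarrow> real \<Rightarrow> real" and C \<alpha> p m :: real
    and xs :: "nat \<Rightarrow> real" and c0 :: real
  assumes dens: "\<And>K. lipschitz_density (\<nu> K) (f K) C \<alpha>"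
    and f_lim: "\<And>x. (\<lambda>K. f K x) \<longlonglongrightarrow> f 0 x"
    and p: "2 < p" "p \<le> 3"
    and m_int: "\<And>K. integrable (\<nu> K) (\<lambda>x. \<bar>x\<bar> powr p)"
    and m_le: "\<And>K. (\<integral>x. \<bar>x\<bar> powr p \<partial>\<nu> K) \<le> m"
    and quantile: "\<And>K. cdf (\<nu> K) (xs K) = \<alpha>"
    and xs_lim: "xs \<longlonglongrightarrow> xs 0"
    and c0: "0 < c0" and f_ge: "\<And>K x. \<bar>x - xs K\<bar> \<le> 1 \<Longrightarrow> c0 \<le> f K x"
begin

sublocale L: lipschitz_density "\<nu> K" "f K" C \<alpha> for K by (rule dens)

abbreviation Infl :: "nat \<Rightarrow> real \<Rightarrow> real \<Rightarrow> real \<Rightarrow> real" where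
  "Infl K \<equiv> L.influence K (xs K)"

definition mean_excess :: "nat \<Rightarrow> real" where
  "mean_excess K = (\<integral>x. max 0 (x - xs K) \<partial>\<nu> K)"

lemma f_star_pos: "0 < f K (xs K)" "c0 \<le> f K (xs K)"
  using f_ge[of "xs K" K] c0 by auto

lemma f_star_lim: "(\<lambda>K. f K (xs K)) \<longlonglongrightarrow> f 0 (xs 0)"
proof -
  have "(\<lambda>K. f K (xs K) - f K (xs 0)) \<longlonglongrightarrow> 0"
  proof (rule Lim_null_comparison)
    show "\<forall>\<^sub>F K in sequentially. norm (f K (xs K) - f K (xs 0)) \<le> C * \<bar>xs K - xs 0\<bar>"
      using L.f_Lipschitz by simp
    have "(\<lambda>K. C * \<bar>xs K - xs 0\<bar>) \<longlonglongrightarrow> C * \<bar>xs 0 - xs 0\<bar>" by (intro tendsto_intros xs_lim)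
    then show "(\<lambda>K. C * \<bar>xs K - xs 0\<bar>) \<longlonglongrightarrow> 0" by simp
  qed
  from tendsto_add[OF this f_lim[of "xs 0"]] show ?thesis by simp
qed

lemma x_int: "integrable (\<nu> K) (\<lambda>x. x)" by (rule L.mean_finite)

lemma abs_x_le: "(\<integral>x. \<bar>x\<bar> \<partial>\<nu> K) \<le> 1 + m"
proof -
  have "(\<integral>x. \<bar>x\<bar> \<partial>\<nu> K) \<le> (\<integral>x. 1 + \<bar>x\<bar> powr p \<partial>\<nu> K)"
  proof (rule integral_mono)
    show "\<bar>x\<bar> \<le> 1 + \<bar>x\<bar> powr p" for x :: real using powr_ge_of_le[of "\<bar>x\<bar>" 1 p] p by simp
  qed (use x_int m_int in auto)
  also have "\<dots> \<le> 1 + m" using m_int m_le L.prob_space by simp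
  finally show ?thesis .
qed

lemma x2_int: "integrable (\<nu> K) (\<lambda>x. x\<^sup>2)"
proof (rule Bochner_Integration.integrable_bound)
  show "integrable (\<nu> K) (\<lambda>x. 1 + \<bar>x\<bar> powr p)" using m_int by simp
  have "x\<^sup>2 \<le> 1 + \<bar>x\<bar> powr p" for x :: real
    using powr_ge_of_le[of "\<bar>x\<bar>" 2 p] p by simp
  then show "AE x in \<nu> K. norm (x\<^sup>2) \<le> norm (1 + \<bar>x\<bar> powr p)" by simp
qed measurable

lemma xs_bounded: obtains B where "0 \<le> B" "\<And>K. \<bar>xs K\<bar> \<le> B"
proof -
  from xs_lim have "Bseq xs" by (rule convergentI[THEN convergent_imp_Bseq])
  then show thesis using that by (auto simp: Bseq_def intro: less_imp_le)
qed

lemma pos_part_square_le: "(max 0 (x - a))\<^sup>2 \<le> (2 + 2 * a\<^sup>2) * (1 + x\<^sup>2)" for x a :: real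
proof -
  have "(max 0 (x - a))\<^sup>2 \<le> (x - a)\<^sup>2" by (simp add: max_def)
  also have "\<dots> \<le> (x - a)\<^sup>2 + (x + a)\<^sup>2" by simp
  also have "\<dots> = 2 * x\<^sup>2 + 2 * a\<^sup>2" by (simp add: power2_eq_square algebra_simps)
  also have "\<dots> \<le> (2 + 2 * a\<^sup>2) * (1 + x\<^sup>2)" by (simp add: algebra_simps)
  finally show ?thesis .
qed

lemma pos_part_square_int: "integrable (\<nu> K) (\<lambda>x. (max 0 (x - a))\<^sup>2)"
proof (rule Bochner_Integration.integrable_bound)
  show "integrable (\<nu> K) (\<lambda>x. (2 + 2 * a\<^sup>2) * (1 + x\<^sup>2))" using x2_int by simp
  show "AE x in \<nu> K. norm ((max 0 (x - a))\<^sup>2) \<le> norm ((2 + 2 * a\<^sup>2) * (1 + x\<^sup>2))"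
    using pos_part_square_le by (intro AE_I2) (smt (verit) real_norm_def zero_le_power2)
qed measurable

lemma integral_lim:
  assumes "g \<in> borel_measurable borel" "\<And>x. \<bar>g x\<bar> \<le> a * (1 + x\<^sup>2)" "\<And>K. integrable (\<nu> K) g"
  shows "(\<lambda>K. \<integral>x. g x \<partial>\<nu> K) \<longlonglongrightarrow> (\<integral>x. g x \<partial>\<nu> 0)"
  by (rule density_integral_tendsto[of f C \<nu> p m g a])
     (use L.f_measurable L.f_nonneg L.f_le L.density L.prob_space_axioms f_lim p m_int m_le assms in auto)

text \<open>Law and threshold move simultaneously. Freezing the threshold at its limit costs at most
  \<open>\<bar>xs K - xs 0\<bar>\<close> under every law, and \<open>integral_lim\<close> treats the
  fixed integrand; \<open>square_excess_lim\<close> proceeds alike, with a first moment as extra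
  factor.\<close>

lemma mean_excess_lim: "mean_excess \<longlonglongrightarrow> mean_excess 0"
proof -
  have 1: "(\<lambda>K. \<integral>x. max 0 (x - xs 0) \<partial>\<nu> K) \<longlonglongrightarrow> mean_excess 0"
    unfolding mean_excess_def
  proof (rule integral_lim[where a="2 + \<bar>xs 0\<bar>"])
    fix x :: real
    have "\<bar>x\<bar> \<le> 1 + x\<^sup>2" using powr_ge_of_le[of "\<bar>x\<bar>" 1 2] by simp
    moreover have "\<bar>xs 0\<bar> * 1 \<le> \<bar>xs 0\<bar> * (1 + x\<^sup>2)" by (intro mult_left_mono) auto
    ultimately show "\<bar>max 0 (x - xs 0)\<bar> \<le> (2 + \<bar>xs 0\<bar>) * (1 + x\<^sup>2)"
      unfolding distrib_right by (smt (verit) zero_le_power2)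
  qed auto
  have "(\<lambda>K. mean_excess K - (\<integral>x. max 0 (x - xs 0) \<partial>\<nu> K)) \<longlonglongrightarrow> 0"
  proof (rule Lim_null_comparison)
    show "\<forall>\<^sub>F K in sequentially. norm (mean_excess K - (\<integral>x. max 0 (x - xs 0) \<partial>\<nu> K)) \<le> \<bar>xs K - xs 0\<bar>"
    proof (intro always_eventually allI)
      fix K
      have "mean_excess K - (\<integral>x. max 0 (x - xs 0) \<partial>\<nu> K) = (\<integral>x. max 0 (x - xs K) - max 0 (x - xs 0) \<partial>\<nu> K)"
        unfolding mean_excess_def by simp
      also have "\<bar>\<dots>\<bar> \<le> (\<integral>x. \<bar>max 0 (x - xs K) - max 0 (x - xs 0)\<bar> \<partial>\<nu> K)" by (rule integral_abs_bound)
      also have "\<dots> \<le> (\<integral>x. \<bar>xs K - xs 0\<bar> \<partial>\<nu> K)" by (intro integral_mono) auto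
      also have "\<dots> = \<bar>xs K - xs 0\<bar>" using L.prob_space by simp
      finally show "norm (mean_excess K - (\<integral>x. max 0 (x - xs 0) \<partial>\<nu> K)) \<le> \<bar>xs K - xs 0\<bar>" by simp
    qed
    have "(\<lambda>K. \<bar>xs K - xs 0\<bar>) \<longlonglongrightarrow> \<bar>xs 0 - xs 0\<bar>" by (intro tendsto_intros xs_lim)
    then show "(\<lambda>K. \<bar>xs K - xs 0\<bar>) \<longlonglongrightarrow> 0" by simp
  qed
  from tendsto_add[OF this 1] show ?thesis by simp
qed

lemma square_excess_lim: "(\<lambda>K. \<integral>x. (max 0 (x - xs K))\<^sup>2 \<partial>\<nu> K) \<longlonglongrightarrow> (\<integral>x. (max 0 (x - xs 0))\<^sup>2 \<partial>\<nu> 0)"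
proof -
  have 1: "(\<lambda>K. \<integral>x. (max 0 (x - xs 0))\<^sup>2 \<partial>\<nu> K) \<longlonglongrightarrow> (\<integral>x. (max 0 (x - xs 0))\<^sup>2 \<partial>\<nu> 0)"
    by (rule integral_lim[where a="2 + 2 * (xs 0)\<^sup>2"]) (use pos_part_square_le pos_part_square_int in auto)
  obtain B where B: "0 \<le> B" "\<And>K. \<bar>xs K\<bar> \<le> B" using xs_bounded by blast
  have "(\<lambda>K. (\<integral>x. (max 0 (x - xs K))\<^sup>2 \<partial>\<nu> K) - (\<integral>x. (max 0 (x - xs 0))\<^sup>2 \<partial>\<nu> K)) \<longlonglongrightarrow> 0"
  proof (rule Lim_null_comparison)
    show "\<forall>\<^sub>F K in sequentially. norm ((\<integral>x. (max 0 (x - xs K))\<^sup>2 \<partial>\<nu> K) - (\<integral>x. (max 0 (x - xs 0))\<^sup>2 \<partial>\<nu> K))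
        \<le> \<bar>xs K - xs 0\<bar> * (2 * (1 + m) + 2 * B)"
    proof (intro always_eventually allI)
      fix K
      have pw: "\<bar>(max 0 (x - xs K))\<^sup>2 - (max 0 (x - xs 0))\<^sup>2\<bar> \<le> \<bar>xs K - xs 0\<bar> * (2 * \<bar>x\<bar> + 2 * B)" for x
      proof -
        have "\<bar>(max 0 (x - xs K))\<^sup>2 - (max 0 (x - xs 0))\<^sup>2\<bar>
            = \<bar>max 0 (x - xs K) - max 0 (x - xs 0)\<bar> * \<bar>max 0 (x - xs K) + max 0 (x - xs 0)\<bar>"
          unfolding abs_mult[symmetric] by (simp add: power2_eq_square algebra_simps)
        also have "\<dots> \<le> \<bar>xs K - xs 0\<bar> * (2 * \<bar>x\<bar> + 2 * B)"
          using B(2)[of K] B(2)[of 0] B(1) by (intro mult_mono) auto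
        finally show ?thesis .
      qed
      have "\<bar>(\<integral>x. (max 0 (x - xs K))\<^sup>2 \<partial>\<nu> K) - (\<integral>x. (max 0 (x - xs 0))\<^sup>2 \<partial>\<nu> K)\<bar>
          = \<bar>\<integral>x. (max 0 (x - xs K))\<^sup>2 - (max 0 (x - xs 0))\<^sup>2 \<partial>\<nu> K\<bar>"
        using pos_part_square_int by simp
      also have "\<dots> \<le> (\<integral>x. \<bar>(max 0 (x - xs K))\<^sup>2 - (max 0 (x - xs 0))\<^sup>2\<bar> \<partial>\<nu> K)" by (rule integral_abs_bound)
      also have "\<dots> \<le> (\<integral>x. \<bar>xs K - xs 0\<bar> * (2 * \<bar>x\<bar> + 2 * B) \<partial>\<nu> K)"
        using pos_part_square_int x_int pw by (intro integral_mono) auto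
      also have "\<dots> = \<bar>xs K - xs 0\<bar> * (2 * (\<integral>x. \<bar>x\<bar> \<partial>\<nu> K) + 2 * B)"
        using x_int[of K] L.prob_space[of K] by simp
      also have "\<dots> \<le> \<bar>xs K - xs 0\<bar> * (2 * (1 + m) + 2 * B)"
        using abs_x_le[of K] by (intro mult_left_mono) auto
      finally show "norm ((\<integral>x. (max 0 (x - xs K))\<^sup>2 \<partial>\<nu> K) - (\<integral>x. (max 0 (x - xs 0))\<^sup>2 \<partial>\<nu> K))
        \<le> \<bar>xs K - xs 0\<bar> * (2 * (1 + m) + 2 * B)" by simp
    qed
    have "(\<lambda>K. \<bar>xs K - xs 0\<bar> * (2 * (1 + m) + 2 * B)) \<longlonglongrightarrow> \<bar>xs 0 - xs 0\<bar> * (2 * (1 + m) + 2 * B)" by (intro tendsto_intros xs_lim)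
    then show "(\<lambda>K. \<bar>xs K - xs 0\<bar> * (2 * (1 + m) + 2 * B)) \<longlonglongrightarrow> 0" by simp
  qed
  from tendsto_add[OF this 1] show ?thesis by simp
qed

definition S11 :: "nat \<Rightarrow> real" where "S11 K = \<alpha> * (1 - \<alpha>) / (f K (xs K))\<^sup>2"
definition S12 :: "nat \<Rightarrow> real" where "S12 K = \<alpha> / (1 - \<alpha>) * mean_excess K / f K (xs K)"
definition S22 :: "nat \<Rightarrow> real" where
  "S22 K = prob_space.variance (\<nu> K) (\<lambda>x. max 0 (x - xs K)) / (1 - \<alpha>)\<^sup>2"

definition Q :: "real \<Rightarrow> real \<Rightarrow> nat \<Rightarrow> real" where
  "Q s t K = s\<^sup>2 * S11 K + 2 * s * t * S12 K + t\<^sup>2 * S22 K"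

lemma Infl_moments:
  "integrable (\<nu> K) (Infl K s t)" "(\<integral>x. Infl K s t x \<partial>\<nu> K) = 0"
  "integrable (\<nu> K) (\<lambda>x. (Infl K s t x)\<^sup>2)" "(\<integral>x. (Infl K s t x)\<^sup>2 \<partial>\<nu> K) = Q s t K"
  using L.influence_moments[OF quantile x2_int, of K s t]
  by (auto simp: Q_def S11_def S12_def S22_def mean_excess_def)

lemma Q_lim: "Q s t \<longlonglongrightarrow> Q s t 0"
proof -
  have "S11 \<longlonglongrightarrow> S11 0"
    unfolding S11_def[abs_def] using f_star_pos(1)[of 0] by (intro tendsto_intros f_star_lim) auto
  moreover have "S12 \<longlonglongrightarrow> S12 0"
    unfolding S12_def[abs_def] using f_star_pos(1)[of 0] by (intro tendsto_intros f_star_lim mean_excess_lim) auto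
  moreover have "S22 \<longlonglongrightarrow> S22 0"
  proof -
    have v: "prob_space.variance (\<nu> K) (\<lambda>x. max 0 (x - xs K)) = (\<integral>x. (max 0 (x - xs K))\<^sup>2 \<partial>\<nu> K) - (mean_excess K)\<^sup>2" for K
      unfolding mean_excess_def by (rule L.variance_eq) (use pos_part_square_int in auto)
    show ?thesis
      unfolding S22_def[abs_def] v using L.alpha by (intro tendsto_intros square_excess_lim mean_excess_lim) auto
  qed
  ultimately show ?thesis unfolding Q_def[abs_def] by (intro tendsto_intros)
qed

lemma Q_nonneg: "0 \<le> Q s t K"
  unfolding Infl_moments(4)[symmetric] by (intro integral_nonneg_AE) auto

lemma S11_pos: "0 < S11 K" using L.alpha f_star_pos[of K] by (simp add: S11_def)

lemma S_psd: "(S12 K)\<^sup>2 / S11 K \<le> S22 K"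
proof -
  \<comment> \<open>This value of the first argument minimizes the quadratic form when the second is
    1 and leaves the Schur complement.\<close>
  have "0 \<le> Q (- S12 K / S11 K) 1 K" by (rule Q_nonneg)
  also have "\<dots> = S22 K - (S12 K)\<^sup>2 / S11 K"
    using S11_pos[of K] by (simp add: Q_def power2_eq_square field_simps)
  finally show ?thesis by simp
qed

text \<open>The influence function grows at most linearly, with a slope \<open>b\<close> independent
  of \<open>K\<close>: the density at the quantile is at least \<open>c0\<close>, and quantiles and
  mean excesses are bounded. The moment of order \<open>p\<close> of the law therefore controls
  it.\<close>

lemma Infl_Lyapunov:
  obtains B where "\<And>K. integrable (\<nu> K) (\<lambda>x. \<bar>Infl K s t x\<bar> powr p)" "\<And>K. (\<integral>x. \<bar>Infl K s t x\<bar> powr p \<partial>\<nu> K) \<le> B"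
proof -
  obtain B where B: "0 \<le> B" "\<And>K. \<bar>xs K\<bar> \<le> B" using xs_bounded by blast
  have m0: "0 \<le> m" using m_le[of 0] by (rule order_trans[rotated]) simp
  define b where "b = \<bar>s\<bar> / c0 + \<bar>t\<bar> * ((2 + m + 2 * B) / (1 - \<alpha>))"
  have b0: "0 \<le> b" using c0 L.alpha m0 B(1) by (simp add: b_def)
  have me: "0 \<le> mean_excess K" "mean_excess K \<le> 1 + m + B" for K
  proof -
    show "0 \<le> mean_excess K" unfolding mean_excess_def by (intro integral_nonneg_AE) auto
    have "mean_excess K \<le> (\<integral>x. \<bar>x\<bar> + B \<partial>\<nu> K)"
      unfolding mean_excess_def using x_int
    proof (intro integral_mono)
      show "max 0 (x - xs K) \<le> \<bar>x\<bar> + B" for x using B(2)[of K] by (auto simp: abs_le_iff)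
    qed auto
    also have "\<dots> = (\<integral>x. \<bar>x\<bar> \<partial>\<nu> K) + B" using x_int[of K] L.prob_space[of K] by simp
    finally show "mean_excess K \<le> 1 + m + B" using abs_x_le[of K] by linarith
  qed
  have pw: "\<bar>Infl K s t x\<bar> \<le> b * (1 + \<bar>x\<bar>)" for K x
  proof -
    let ?a = "((if xs K \<le> x then 1 else 0) - (1 - \<alpha>)) / f K (xs K)"
    let ?e = "(max 0 (x - xs K) - mean_excess K) / (1 - \<alpha>)"
    have "\<bar>?a\<bar> \<le> 1 / c0"
      unfolding abs_divide using L.alpha f_star_pos[of K] c0 by (intro frac_le) auto
    then have a: "\<bar>s * ?a\<bar> \<le> \<bar>s\<bar> / c0" unfolding abs_mult using mult_left_mono[of "\<bar>?a\<bar>" "1 / c0" "\<bar>s\<bar>"] by simp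
    have "\<bar>max 0 (x - xs K) - mean_excess K\<bar> \<le> (2 + m + 2 * B) * (1 + \<bar>x\<bar>)"
    proof -
      have "\<bar>max 0 (x - xs K) - mean_excess K\<bar> \<le> \<bar>x\<bar> + B + (1 + m + B)"
        using B(2)[of K] me[of K] B(1) m0 by (auto simp: abs_le_iff)
      also have "\<dots> \<le> (2 + m + 2 * B) * (1 + \<bar>x\<bar>)"
        using m0 B(1) by (simp add: algebra_simps add_nonneg_nonneg)
      finally show ?thesis .
    qed
    then have "\<bar>?e\<bar> \<le> (2 + m + 2 * B) / (1 - \<alpha>) * (1 + \<bar>x\<bar>)"
      using L.alpha by (simp add: abs_divide divide_right_mono)
    then have e: "\<bar>t * ?e\<bar> \<le> \<bar>t\<bar> * ((2 + m + 2 * B) / (1 - \<alpha>) * (1 + \<bar>x\<bar>))"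
      unfolding abs_mult by (intro mult_left_mono) auto
    have "\<bar>s\<bar> / c0 * 1 \<le> \<bar>s\<bar> / c0 * (1 + \<bar>x\<bar>)" using c0 by (intro mult_left_mono) auto
    moreover have "Infl K s t x = s * ?a + t * ?e" by (simp only: L.influence_def mean_excess_def)
    moreover have "b * (1 + \<bar>x\<bar>) = \<bar>s\<bar> / c0 * (1 + \<bar>x\<bar>) + \<bar>t\<bar> * ((2 + m + 2 * B) / (1 - \<alpha>) * (1 + \<bar>x\<bar>))"
      by (simp add: b_def distrib_right mult.assoc)
    moreover have "\<bar>z\<bar> \<le> r" if "u * 1 \<le> u'" "z = z1 + z2" "r = u' + u2" "\<bar>z1\<bar> \<le> u" "\<bar>z2\<bar> \<le> u2"
      for z r u u' z1 z2 u2 :: real using that unfolding mult_1_right by linarith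
    ultimately show ?thesis using a e by blast
  qed
  have pw2: "\<bar>Infl K s t x\<bar> powr p \<le> b powr p * (2 powr p * (1 + \<bar>x\<bar> powr p))" for K x
  proof -
    have "\<bar>Infl K s t x\<bar> powr p \<le> (b * (1 + \<bar>x\<bar>)) powr p" using pw p by (intro powr_mono2) auto
    also have "\<dots> = b powr p * (1 + \<bar>x\<bar>) powr p" using b0 by (simp add: powr_mult)
    also have "\<dots> \<le> b powr p * (2 powr p * (1 + \<bar>x\<bar> powr p))"
      using p by (intro mult_left_mono one_plus_powr_le) auto
    finally show ?thesis .
  qed
  have Bi: "integrable (\<nu> K) (\<lambda>x. b powr p * (2 powr p * (1 + \<bar>x\<bar> powr p)))" for K using m_int by simp
  have i: "integrable (\<nu> K) (\<lambda>x. \<bar>Infl K s t x\<bar> powr p)" for K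
    by (rule Bochner_Integration.integrable_bound[OF Bi[of K]]) (use pw2 in \<open>auto intro!: AE_I2\<close>)
  have "(\<integral>x. \<bar>Infl K s t x\<bar> powr p \<partial>\<nu> K) \<le> b powr p * (2 powr p * (1 + m))" for K
  proof -
    have "(\<integral>x. \<bar>Infl K s t x\<bar> powr p \<partial>\<nu> K) \<le> (\<integral>x. b powr p * (2 powr p * (1 + \<bar>x\<bar> powr p)) \<partial>\<nu> K)"
      by (intro integral_mono i Bi pw2)
    also have "\<dots> = b powr p * (2 powr p * (1 + (\<integral>x. \<bar>x\<bar> powr p \<partial>\<nu> K)))"
      using m_int[of K] L.prob_space[of K] by simp
    also have "\<dots> \<le> b powr p * (2 powr p * (1 + m))" using m_le[of K] by (intro mult_left_mono) auto
    finally show ?thesis .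
  qed
  with i show thesis using that by blast
qed

end

text \<open>Takes the role of Slutsky's theorem: a perturbation that is small in L1 does not change
  the limit of characteristic functions.\<close>

lemma (in prob_space) iexp_perturbation:
  fixes a b :: "'a \<Rightarrow> real"
  assumes [measurable]: "a \<in> borel_measurable M" and b: "integrable M b"
  shows "cmod (expectation (\<lambda>\<omega>. iexp (a \<omega> + b \<omega>)) - expectation (\<lambda>\<omega>. iexp (a \<omega>))) \<le> expectation (\<lambda>\<omega>. \<bar>b \<omega>\<bar>)"
proof -
  have [measurable]: "b \<in> borel_measurable M" using b by simp
  have i: "integrable M (\<lambda>\<omega>. iexp (a \<omega> + b \<omega>))" "integrable M (\<lambda>\<omega>. iexp (a \<omega>))"
    by (auto intro!: integrable_const_bound[where B=1])
  have pw: "cmod (iexp (a \<omega> + b \<omega>) - iexp (a \<omega>)) \<le> \<bar>b \<omega>\<bar>" for \<omega>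
  proof -
    have "iexp (a \<omega> + b \<omega>) - iexp (a \<omega>) = iexp (a \<omega>) * (iexp (b \<omega>) - 1)"
      by (simp add: exp_add distrib_left right_diff_distrib)
    then show ?thesis using iexp_approx1[of "b \<omega>" 0] by (simp add: norm_mult)
  qed
  have "cmod (expectation (\<lambda>\<omega>. iexp (a \<omega> + b \<omega>)) - expectation (\<lambda>\<omega>. iexp (a \<omega>)))
      = cmod (expectation (\<lambda>\<omega>. iexp (a \<omega> + b \<omega>) - iexp (a \<omega>)))" using i by simp
  also have "\<dots> \<le> expectation (\<lambda>\<omega>. cmod (iexp (a \<omega> + b \<omega>) - iexp (a \<omega>)))" by (rule integral_norm_bound)
  also have "\<dots> \<le> expectation (\<lambda>\<omega>. \<bar>b \<omega>\<bar>)" using i b pw by (intro integral_mono) auto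
  finally show ?thesis .
qed

section \<open>Measurability and convergence of the normalized errors\<close>

lemma nsa_xi_measurable:
  assumes [measurable]: "x0 \<in> borel_measurable M" "\<And>n. X n \<in> borel_measurable M"
  shows "(\<lambda>\<omega>. nsa_xi \<alpha> \<gamma> (x0 \<omega>) (\<lambda>n. X n \<omega>) n) \<in> borel_measurable M"
proof (induction n)
  case (Suc n)
  note [measurable] = Suc
  show ?case unfolding nsa_xi.simps by measurable
qed simp

lemma nsa_chi_measurable:
  assumes [measurable]: "x0 \<in> borel_measurable M" "\<And>n. X n \<in> borel_measurable M"
  shows "(\<lambda>\<omega>. nsa_chi \<alpha> \<gamma> (x0 \<omega>) (\<lambda>n. X n \<omega>) n) \<in> borel_measurable M"
proof (induction n)
  case (Suc n)
  note [measurable] = Suc nsa_xi_measurable[OF assms]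
  show ?case unfolding nsa_chi.simps H2_def by measurable
qed simp

text \<open>A lower bound for the density in a window lets one read off distances from differences
  of the cdf, up to saturation at 1. It yields both uniqueness and convergence of quantiles.\<close>

lemma (in lipschitz_density) cdf_diff_ge:
  assumes c: "0 \<le> c" and f_ge: "\<And>x. \<bar>x - a\<bar> \<le> 1 \<Longrightarrow> c \<le> f x"
  shows "c * min \<bar>b - a\<bar> 1 \<le> \<bar>cdf \<nu> b - cdf \<nu> a\<bar>"
proof (cases "a \<le> b")
  case True
  have "c * (a + min \<bar>b - a\<bar> 1 - a) \<le> cdf \<nu> (a + min \<bar>b - a\<bar> 1) - cdf \<nu> a"
    using f_ge f_le by (intro cdf_diff_bounds(1)[of _ _ _ C]) auto
  also have "\<dots> \<le> cdf \<nu> b - cdf \<nu> a" using True by (intro diff_right_mono cdf_nondecreasing) auto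
  finally show ?thesis by simp
next
  case False
  have "c * (a - (a - min \<bar>b - a\<bar> 1)) \<le> cdf \<nu> a - cdf \<nu> (a - min \<bar>b - a\<bar> 1)"
    using f_ge f_le by (intro cdf_diff_bounds(1)[of _ _ _ C]) auto
  also have "\<dots> \<le> cdf \<nu> a - cdf \<nu> b" using False by (intro diff_left_mono cdf_nondecreasing) auto
  finally show ?thesis by simp
qed

text \<open>For each linear combination the normalized error is the sum \<open>S K\<close> of i.i.d.
  influence terms plus \<open>T1\<close> and \<open>T2\<close> over \<open>K\<close>. The central
  limit theorem handles the former, the rates kill the latter.\<close>

lemma (in density_family) nsa_conv_law:
  fixes M :: "'m measure" and x0 :: "nat \<Rightarrow> 'm \<Rightarrow> real" and Xn :: "nat \<Rightarrow> nat \<Rightarrow> 'm \<Rightarrow> real"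
  assumes ps: "prob_space M"
    and x0m: "\<And>K. x0 K \<in> borel_measurable M" and Xnm: "\<And>K n. Xn K n \<in> borel_measurable M"
    and iid: "\<And>K. K \<ge> 1 \<Longrightarrow> prob_space.indep_vars M (\<lambda>_. borel) (Xn K) UNIV"
    and scheme: "\<And>K. K \<ge> 1 \<Longrightarrow> nsa_scheme_L2 M (x0 K) (Xn K) (\<nu> K) (f K) C \<alpha> \<gamma>1 \<beta> (xs K) c0 A"
  shows "conv_law (\<lambda>K. distr M borel (\<lambda>\<omega>.
       (real K * (nsa_xibar \<alpha> (\<lambda>n. \<gamma>1 * real n powr (-\<beta>)) (x0 K \<omega>) (\<lambda>n. Xn K n \<omega>) (K\<^sup>2) - xs K),
        real K * (nsa_chi \<alpha> (\<lambda>n. \<gamma>1 * real n powr (-\<beta>)) (x0 K \<omega>) (\<lambda>n. Xn K n \<omega>) (K\<^sup>2)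
          - Vfun (\<nu> K) \<alpha> (\<lambda>x. x) (xs K)))))
     (gauss2 (S11 0) (S12 0) (S22 0))"
proof -
  interpret M: prob_space M by fact
  note [measurable] = x0m Xnm
  let ?\<gamma> = "\<lambda>n. \<gamma>1 * real n powr (-\<beta>)"
  define W1 where "W1 K \<omega> = real K * (nsa_xibar \<alpha> ?\<gamma> (x0 K \<omega>) (\<lambda>n. Xn K n \<omega>) (K\<^sup>2) - xs K)" for K \<omega>
  define W2 where "W2 K \<omega> = real K * (nsa_chi \<alpha> ?\<gamma> (x0 K \<omega>) (\<lambda>n. Xn K n \<omega>) (K\<^sup>2) - Vfun (\<nu> K) \<alpha> (\<lambda>x. x) (xs K))" for K \<omega>
  have xim: "(\<lambda>\<omega>. nsa_xi \<alpha> ?\<gamma> (x0 K \<omega>) (\<lambda>n. Xn K n \<omega>) n) \<in> borel_measurable M" for K n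
    by (rule nsa_xi_measurable) measurable
  have chim: "(\<lambda>\<omega>. nsa_chi \<alpha> ?\<gamma> (x0 K \<omega>) (\<lambda>n. Xn K n \<omega>) n) \<in> borel_measurable M" for K n
    by (rule nsa_chi_measurable) measurable
  note [measurable] = xim chim
  have W1m [measurable]: "W1 K \<in> borel_measurable M" for K
    unfolding W1_def[abs_def] nsa_xibar_def by measurable
  have W2m [measurable]: "W2 K \<in> borel_measurable M" for K
    unfolding W2_def[abs_def] by measurable
  have Wm: "(\<lambda>\<omega>. (W1 K \<omega>, W2 K \<omega>)) \<in> borel_measurable M" for K
    unfolding borel_prod[symmetric] by measurable
  \<comment> \<open>The rates mention neither law nor quantile, so those of the instance at 1 are
    the very bounds that hold at every \<open>K \<ge> 1\<close>.\<close>
  interpret N1: nsa_scheme_L2 M "x0 1" "Xn 1" "\<nu> 1" "f 1" C \<alpha> \<gamma>1 \<beta> "xs 1" c0 A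
    by (rule scheme) simp
  note gauss = gauss2_char[OF S11_pos S_psd, of 0]
  have rate: "(\<lambda>K. N1.\<rho>1 (K\<^sup>2) / real K) \<longlonglongrightarrow> 0" "(\<lambda>K. N1.\<rho>2 (K\<^sup>2) / real K) \<longlonglongrightarrow> 0"
  proof -
    have q: "(\<lambda>K. real (K\<^sup>2) powr (\<beta> / 2) / real K) \<longlonglongrightarrow> 0"
      "(\<lambda>K. real (K\<^sup>2) powr (1 / 2 - \<beta> / 4) / real K) \<longlonglongrightarrow> 0"
      "(\<lambda>K. real (K\<^sup>2) powr (1 / 2 - \<beta> / 2) / real K) \<longlonglongrightarrow> 0"
      "(\<lambda>K. real (K\<^sup>2) powr (1 - \<beta>) / real K) \<longlonglongrightarrow> 0"
      using N1.beta by (auto intro!: powr_square_over_tendsto_0 simp del: of_nat_power)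
    have "(\<lambda>K. 1 / (c0 * N1.h) * (sqrt A / \<gamma>1 * (2 / \<beta> + 1) * (real (K\<^sup>2) powr (\<beta> / 2) / real K)
     + sqrt (N1.h\<^sup>2 * C * sqrt A / (1 - \<beta> / 2)) * (real (K\<^sup>2) powr (1 / 2 - \<beta> / 4) / real K)
     + C * N1.h * (A / (1 - \<beta>) * (real (K\<^sup>2) powr (1 - \<beta>) / real K))) + 2 * sqrt A / real K)
     \<longlonglongrightarrow> 1 / (c0 * N1.h) * (sqrt A / \<gamma>1 * (2 / \<beta> + 1) * 0
     + sqrt (N1.h\<^sup>2 * C * sqrt A / (1 - \<beta> / 2)) * 0 + C * N1.h * (A / (1 - \<beta>) * 0)) + 0"
      by (intro tendsto_add tendsto_mult tendsto_const q lim_const_over_n)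
    then show "(\<lambda>K. N1.\<rho>1 (K\<^sup>2) / real K) \<longlonglongrightarrow> 0"
      unfolding N1.\<rho>1_def by (simp add: add_divide_distrib distrib_left)
    have "(\<lambda>K. 2 * (1 + N1.h) * sqrt (A / (1 - \<beta>)) * (real (K\<^sup>2) powr (1 / 2 - \<beta> / 2) / real K)
     + C * N1.h * (A / (1 - \<beta>) * (real (K\<^sup>2) powr (1 - \<beta>) / real K)))
     \<longlonglongrightarrow> 2 * (1 + N1.h) * sqrt (A / (1 - \<beta>)) * 0 + C * N1.h * (A / (1 - \<beta>) * 0)"
      by (intro tendsto_add tendsto_mult tendsto_const q)
    then show "(\<lambda>K. N1.\<rho>2 (K\<^sup>2) / real K) \<longlonglongrightarrow> 0"
      unfolding N1.\<rho>2_def by (simp add: add_divide_distrib)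
  qed
  have "conv_law (\<lambda>K. distr M borel (\<lambda>\<omega>. (W1 K \<omega>, W2 K \<omega>))) (gauss2 (S11 0) (S12 0) (S22 0))"
  proof (rule levy_continuity_plane)
    show "prob_space (distr M borel (\<lambda>\<omega>. (W1 K \<omega>, W2 K \<omega>)))" for K by (rule M.prob_space_distr[OF Wm])
    show "sets (distr M borel (\<lambda>\<omega>. (W1 K \<omega>, W2 K \<omega>))) = sets borel" for K by simp
    show "prob_space (gauss2 (S11 0) (S12 0) (S22 0))" "sets (gauss2 (S11 0) (S12 0) (S22 0)) = sets borel"
      by (rule gauss)+
    fix s t
    define S where "S K \<omega> = (\<Sum>n<K\<^sup>2. Infl K s t (Xn K n \<omega>)) / real K" for K \<omega>
    have Sm [measurable]: "S K \<in> borel_measurable M" for K unfolding S_def[abs_def] by measurable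
    obtain B where B: "\<And>K. integrable (\<nu> K) (\<lambda>x. \<bar>Infl K s t x\<bar> powr p)" "\<And>K. (\<integral>x. \<bar>Infl K s t x\<bar> powr p \<partial>\<nu> K) \<le> B"
      using Infl_Lyapunov by blast
    have dist: "distr M borel (Xn K n) = \<nu> K" if "K \<ge> 1" for K n
      using scheme[OF that] by (simp add: nsa_scheme_L2_def nsa_scheme_def iid_chain_def iid_chain_axioms_def)
    have tr: "integrable M (\<lambda>\<omega>. g (Xn K 0 \<omega>)) \<longleftrightarrow> integrable (\<nu> K) g" "M.expectation (\<lambda>\<omega>. g (Xn K 0 \<omega>)) = (\<integral>x. g x \<partial>\<nu> K)"
      if "K \<ge> 1" "g \<in> borel_measurable borel" for K and g :: "real \<Rightarrow> real"
      unfolding dist[OF that(1), of 0, symmetric] using that(2) by (simp_all add: integrable_distr_eq integral_distr)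
    \<comment> \<open>Frequency 1 is enough because \<open>s\<close> and \<open>t\<close> are
      already built into the influence function.\<close>
    have "(\<lambda>K. M.expectation (\<lambda>\<omega>. iexp (1 * ((\<Sum>n<K\<^sup>2. Infl K s t (Xn K n \<omega>)) / real K))))
        \<longlonglongrightarrow> complex_of_real (exp (- (1\<^sup>2 * Q s t 0) / 2))"
    proof (rule M.char_triangular_array_tendsto[where v="Q s t" and d="p - 2" and C=B])
      fix K :: nat assume K: "K \<ge> 1"
      show "M.indep_vars (\<lambda>_. borel) (\<lambda>n \<omega>. Infl K s t (Xn K n \<omega>)) UNIV"
        by (rule M.indep_vars_compose2[OF iid[OF K]]) auto
      show "distr M borel (\<lambda>\<omega>. Infl K s t (Xn K n \<omega>)) = distr M borel (\<lambda>\<omega>. Infl K s t (Xn K 0 \<omega>))" for n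
      proof -
        have "distr M borel (\<lambda>\<omega>. Infl K s t (Xn K k \<omega>)) = distr (\<nu> K) borel (Infl K s t)" for k
        proof -
          have "distr (distr M borel (Xn K k)) borel (Infl K s t) = distr M borel (\<lambda>\<omega>. Infl K s t (Xn K k \<omega>))"
            by (subst distr_distr) (auto simp: comp_def)
          then show ?thesis by (simp add: dist[OF K])
        qed
        then show ?thesis by simp
      qed
      show "integrable M (\<lambda>\<omega>. Infl K s t (Xn K 0 \<omega>))" "integrable M (\<lambda>\<omega>. (Infl K s t (Xn K 0 \<omega>))\<^sup>2)"
        "M.expectation (\<lambda>\<omega>. Infl K s t (Xn K 0 \<omega>)) = 0" "M.expectation (\<lambda>\<omega>. (Infl K s t (Xn K 0 \<omega>))\<^sup>2) = Q s t K"
        using tr(1)[OF K, of "Infl K s t"] tr(1)[OF K, of "\<lambda>x. (Infl K s t x)\<^sup>2"]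
          tr(2)[OF K, of "Infl K s t"] tr(2)[OF K, of "\<lambda>x. (Infl K s t x)\<^sup>2"] Infl_moments[of K s t] by auto
      show "integrable M (\<lambda>\<omega>. \<bar>Infl K s t (Xn K 0 \<omega>)\<bar> powr (2 + (p - 2)))"
        "M.expectation (\<lambda>\<omega>. \<bar>Infl K s t (Xn K 0 \<omega>)\<bar> powr (2 + (p - 2))) \<le> B"
        using tr[OF K, of "\<lambda>x. \<bar>Infl K s t x\<bar> powr p"] B[of K] by auto
    qed (use p Q_lim in auto)
    then have limS: "(\<lambda>K. M.expectation (\<lambda>\<omega>. iexp (S K \<omega>))) \<longlonglongrightarrow> complex_of_real (exp (- Q s t 0 / 2))"
      by (simp add: S_def)
    have diff: "cmod (M.expectation (\<lambda>\<omega>. iexp (s * W1 K \<omega> + t * W2 K \<omega>)) - M.expectation (\<lambda>\<omega>. iexp (S K \<omega>)))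
        \<le> \<bar>s\<bar> * (N1.\<rho>1 (K\<^sup>2) / real K) + \<bar>t\<bar> * (N1.\<rho>2 (K\<^sup>2) / real K)" if K: "K \<ge> 1" for K
    proof -
      interpret N: nsa_scheme_L2 M "x0 K" "Xn K" "\<nu> K" "f K" C \<alpha> \<gamma>1 \<beta> "xs K" c0 A by (rule scheme[OF K])
      define r where "r \<omega> = s * (N.T1 (K\<^sup>2) \<omega> / real K) + t * (N.T2 (K\<^sup>2) \<omega> / real K)" for \<omega>
      have K0: "real K \<noteq> 0" using K by simp
      have KK: "real K * (z / real (K\<^sup>2)) = z / real K" for z using K0 by (simp add: power2_eq_square)
      have w1: "W1 K \<omega> = (\<Sum>k=1..K\<^sup>2. N.D k \<omega>) / real K" for \<omega>
      proof -
        have "(\<Sum>k=1..K\<^sup>2. N.D k \<omega>) = (\<Sum>k=1..K\<^sup>2. N.\<xi> k \<omega>) - real (K\<^sup>2) * xs K"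
          by (simp add: N.D_def sum_subtractf)
        then have "(\<Sum>k=1..K\<^sup>2. N.D k \<omega>) / real K = real K * ((\<Sum>k=1..K\<^sup>2. N.\<xi> k \<omega>) / real (K\<^sup>2)) - real (K\<^sup>2) * xs K / real K"
          unfolding KK by (simp only: diff_divide_distrib)
        also have "real (K\<^sup>2) * xs K / real K = real K * xs K" using K0 by (simp add: power2_eq_square)
        finally show ?thesis by (simp add: W1_def nsa_xibar_def N.\<xi>_def right_diff_distrib)
      qed
      have w2: "W2 K \<omega> = real (K\<^sup>2) * (nsa_chi \<alpha> ?\<gamma> (x0 K \<omega>) (\<lambda>n. Xn K n \<omega>) (K\<^sup>2) - Vfun (\<nu> K) \<alpha> (\<lambda>x. x) (xs K)) / real K" for \<omega>
        using K0 by (simp add: W2_def power2_eq_square)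
      have eq: "s * W1 K \<omega> + t * W2 K \<omega> = S K \<omega> + r \<omega>" for \<omega>
      proof -
        let ?p = "\<Sum>n<K\<^sup>2. ((if xs K \<le> Xn K n \<omega> then 1 else 0) - (1 - \<alpha>)) / f K (xs K)"
        let ?q = "\<Sum>n<K\<^sup>2. (max 0 (Xn K n \<omega> - xs K) - (\<integral>x. max 0 (x - xs K) \<partial>\<nu> K)) / (1 - \<alpha>)"
        have "S K \<omega> = (s * ?p + t * ?q) / real K"
          unfolding S_def L.influence_def sum.distrib sum_distrib_left ..
        moreover have "W1 K \<omega> = N.T1 (K\<^sup>2) \<omega> / real K + ?p / real K"
          unfolding w1 N.T1_def by (simp add: diff_divide_distrib)
        moreover have "W2 K \<omega> = N.T2 (K\<^sup>2) \<omega> / real K + ?q / real K"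
          unfolding w2 N.T2_def by (simp add: diff_divide_distrib)
        ultimately show ?thesis by (simp only: r_def add_divide_distrib) (simp add: algebra_simps)
      qed
      have ri: "integrable M r" unfolding r_def[abs_def] using N.T1_bound(1) N.T2_bound(1) by simp
      have "cmod (M.expectation (\<lambda>\<omega>. iexp (s * W1 K \<omega> + t * W2 K \<omega>)) - M.expectation (\<lambda>\<omega>. iexp (S K \<omega>)))
          \<le> M.expectation (\<lambda>\<omega>. \<bar>r \<omega>\<bar>)"
        unfolding eq by (rule M.iexp_perturbation[OF Sm ri])
      also have "\<dots> \<le> M.expectation (\<lambda>\<omega>. \<bar>s\<bar> * (\<bar>N.T1 (K\<^sup>2) \<omega>\<bar> / real K) + \<bar>t\<bar> * (\<bar>N.T2 (K\<^sup>2) \<omega>\<bar> / real K))"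
      proof (rule integral_mono)
        show "\<bar>r \<omega>\<bar> \<le> \<bar>s\<bar> * (\<bar>N.T1 (K\<^sup>2) \<omega>\<bar> / real K) + \<bar>t\<bar> * (\<bar>N.T2 (K\<^sup>2) \<omega>\<bar> / real K)" for \<omega>
          unfolding r_def by (rule order_trans[OF abs_triangle_ineq]) (simp add: abs_mult)
      qed (use ri N.T1_bound(1) N.T2_bound(1) in auto)
      also have "\<dots> = \<bar>s\<bar> * (M.expectation (\<lambda>\<omega>. \<bar>N.T1 (K\<^sup>2) \<omega>\<bar>) / real K) + \<bar>t\<bar> * (M.expectation (\<lambda>\<omega>. \<bar>N.T2 (K\<^sup>2) \<omega>\<bar>) / real K)"
        using N.T1_bound(1) N.T2_bound(1) by simp
      also have "\<dots> \<le> \<bar>s\<bar> * (N1.\<rho>1 (K\<^sup>2) / real K) + \<bar>t\<bar> * (N1.\<rho>2 (K\<^sup>2) / real K)"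
        by (intro add_mono mult_left_mono divide_right_mono N.T1_bound(2) N.T2_bound(2)) auto
      finally show ?thesis .
    qed
    have "(\<lambda>K. M.expectation (\<lambda>\<omega>. iexp (s * W1 K \<omega> + t * W2 K \<omega>)) - M.expectation (\<lambda>\<omega>. iexp (S K \<omega>))) \<longlonglongrightarrow> 0"
    proof (rule Lim_null_comparison)
      show "\<forall>\<^sub>F K in sequentially. norm (M.expectation (\<lambda>\<omega>. iexp (s * W1 K \<omega> + t * W2 K \<omega>)) - M.expectation (\<lambda>\<omega>. iexp (S K \<omega>)))
          \<le> \<bar>s\<bar> * (N1.\<rho>1 (K\<^sup>2) / real K) + \<bar>t\<bar> * (N1.\<rho>2 (K\<^sup>2) / real K)"
        using eventually_ge_at_top[of 1] by eventually_elim (rule diff)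
      have "(\<lambda>K. \<bar>s\<bar> * (N1.\<rho>1 (K\<^sup>2) / real K) + \<bar>t\<bar> * (N1.\<rho>2 (K\<^sup>2) / real K)) \<longlonglongrightarrow> \<bar>s\<bar> * 0 + \<bar>t\<bar> * 0"
        by (intro tendsto_add tendsto_mult tendsto_const rate)
      then show "(\<lambda>K. \<bar>s\<bar> * (N1.\<rho>1 (K\<^sup>2) / real K) + \<bar>t\<bar> * (N1.\<rho>2 (K\<^sup>2) / real K)) \<longlonglongrightarrow> 0" by simp
    qed
    from Lim_transform[OF limS this]
    have "(\<lambda>K. M.expectation (\<lambda>\<omega>. iexp (s * W1 K \<omega> + t * W2 K \<omega>))) \<longlonglongrightarrow> complex_of_real (exp (- Q s t 0 / 2))" .
    moreover have "(\<integral>p. iexp (s * fst p + t * snd p) \<partial>distr M borel (\<lambda>\<omega>. (W1 K \<omega>, W2 K \<omega>)))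
        = M.expectation (\<lambda>\<omega>. iexp (s * W1 K \<omega> + t * W2 K \<omega>))" for K
      by (subst integral_distr[OF Wm]) (auto intro!: borel_measurable_continuous_onI continuous_intros)
    ultimately show "(\<lambda>K. \<integral>p. iexp (s * fst p + t * snd p) \<partial>distr M borel (\<lambda>\<omega>. (W1 K \<omega>, W2 K \<omega>)))
        \<longlonglongrightarrow> (\<integral>p. iexp (s * fst p + t * snd p) \<partial>gauss2 (S11 0) (S12 0) (S22 0))"
      by (simp only: gauss(1) Q_def)
  qed
  then show ?thesis by (simp add: W1_def W2_def)
qed

section \<open>The limit theorem\<close>

text \<open>Assumption B bounds an exponential moment with a quadratic weight. Where the weight is
  below 1 the exponential is at most \<open>exp l\<close>, so the unweighted moment is bounded
  too.\<close>

lemma exp_abs_le_square: "0 \<le> l \<Longrightarrow> exp (l * \<bar>x\<bar>) \<le> exp l + \<bar>x\<bar>\<^sup>2 * exp (l * \<bar>x\<bar>)" for x l :: real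
proof -
  assume l: "0 \<le> l"
  show ?thesis
  proof (cases "\<bar>x\<bar> \<le> 1")
    case True
    then have "exp (l * \<bar>x\<bar>) \<le> exp l" using l mult_left_mono[of "\<bar>x\<bar>" 1 l] by simp
    then show ?thesis by (simp add: add_increasing2)
  next
    case False
    then have "1 \<le> \<bar>x\<bar>\<^sup>2" by (intro one_le_power) auto
    then have "1 * exp (l * \<bar>x\<bar>) \<le> \<bar>x\<bar>\<^sup>2 * exp (l * \<bar>x\<bar>)" by (intro mult_right_mono) auto
    then show ?thesis by (simp add: add_increasing)
  qed
qed

lemma cosh_le_exp_abs: "cosh (l * (x - a)) \<le> exp (l * b) * exp (l * \<bar>x\<bar>)"
  if "0 \<le> l" "\<bar>a\<bar> \<le> b" for l x a b :: real
proof -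
  have "cosh (l * (x - a)) \<le> exp \<bar>l * (x - a)\<bar>"
    using cosh_add_le_exp[of 0 "l * (x - a)"] by simp
  also have "\<bar>l * (x - a)\<bar> \<le> l * b + l * \<bar>x\<bar>"
  proof -
    have "l * \<bar>x - a\<bar> \<le> l * (b + \<bar>x\<bar>)" using that by (intro mult_left_mono) auto
    then show ?thesis using that by (simp add: abs_mult distrib_left)
  qed
  finally show ?thesis by (simp add: exp_add)
qed

text \<open>The index \<open>K\<close> encodes h = 1/K and index 0 encodes h = 0. Thus the
  normalization is \<open>K\<close>, the number of iterations is \<open>K\<^sup>2\<close>, and h
  tending to 0 becomes \<open>K\<close> tending to infinity.\<close>

theorem mainTheorem3:
  fixes M :: "'m measure"
    and \<alpha> \<delta> \<gamma>1 \<beta> :: real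
    and \<phi> :: "'a::euclidean_space \<Rightarrow> 'b::euclidean_space \<Rightarrow> real"
    and Y :: "'m \<Rightarrow> 'a" and Z :: "'m \<Rightarrow> 'b" and Zs :: "nat \<Rightarrow> 'm \<Rightarrow> 'b"
    and X :: "nat \<Rightarrow> 'm \<Rightarrow> real"
    and f :: "nat \<Rightarrow> real \<Rightarrow> real"
    and Xn :: "nat \<Rightarrow> nat \<Rightarrow> 'm \<Rightarrow> real"
    and xi0 :: "nat \<Rightarrow> 'm \<Rightarrow> real"
  assumes P: "prob_space M"
    and alpha: "0 < \<alpha>" "\<alpha> < 1"
    \<comment> \<open>the model Y, Z, phi\<close>
    and Ymeas: "Y \<in> borel_measurable M" and Zmeas: "Z \<in> borel_measurable M"
    and YZ_indep: "indep_var2 M borel Y borel Z"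
    and phi_meas: "(\<lambda>(y, z). \<phi> y z) \<in> borel_measurable borel"
    and phi_L1: "integrable M (\<lambda>\<omega>. \<phi> (Y \<omega>) (Z \<omega>))"
    and delta: "\<delta> > 0"
    and phi_moment: "integrable M (\<lambda>\<omega>. \<bar>\<phi> (Y \<omega>) (Z \<omega>)\<bar> powr (2 + \<delta>))"
    \<comment> \<open>i.i.d. copies of Z, independent of Y\<close>
    and Zs_meas: "\<And>k. Zs k \<in> borel_measurable M"
    and Zs_iid: "prob_space.indep_vars M (\<lambda>_. borel) Zs UNIV"
    and Zs_dist: "\<And>k. distr M borel (Zs k) = distr M borel Z"
    and Y_Zs_indep: "indep_var2 M borel Y (\<Pi>\<^sub>M k\<in>UNIV. borel) (\<lambda>\<omega> k. Zs k \<omega>)"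
    \<comment> \<open>X 0 = E[phi(Y,Z) | Y];  X K = X_h for h = 1/K, K >= 1\<close>
    and X0_def: "X 0 = real_cond_exp M (vimage_algebra (space M) Y borel) (\<lambda>\<omega>. \<phi> (Y \<omega>) (Z \<omega>))"
    and XK_def: "\<And>K. K \<ge> 1 \<Longrightarrow> X K = Xinner \<phi> Y Zs K"
    \<comment> \<open>Assumption A (ii): continuous pdfs, locally uniform convergence\<close>
    and f_nonneg: "\<And>K x. f K x \<ge> 0"
    and f_pdf: "\<And>K. distributed M lborel (X K) (\<lambda>x. ennreal (f K x))"
    and f_cont: "\<And>K. continuous_on UNIV (f K)"
    and f_loc_unif: "\<And>a b. uniform_limit {a..b} f (f 0) sequentially"
    \<comment> \<open>Assumption A (i)\<close>
    and A1: "\<exists>v w. (\<forall>K\<ge>1. \<forall>\<xi>. cdf (distr M borel (X K)) \<xi> - cdf (distr M borel (X 0)) \<xi>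
                          = v \<xi> * (1 / real K) + w \<xi> K * (1 / real K))
            \<and> (\<forall>\<xi>0. (\<forall>\<eta>. Vfun M \<alpha> (X 0) \<xi>0 \<le> Vfun M \<alpha> (X 0) \<eta>) \<longrightarrow>
                  set_integrable lborel {\<xi>0..} v
                \<and> (\<forall>K\<ge>1. set_integrable lborel {\<xi>0..} (\<lambda>\<xi>. w \<xi> K))
                \<and> (\<lambda>K. w \<xi>0 K) \<longlonglongrightarrow> 0
                \<and> (\<lambda>K. LINT \<xi>:{\<xi>0..}|lborel. w \<xi> K) \<longlonglongrightarrow> 0)"
    \<comment> \<open>Assumption A (iii)\<close>
    and A3: "\<And>\<xi>0. (\<forall>\<eta>. Vfun M \<alpha> (X 0) \<xi>0 \<le> Vfun M \<alpha> (X 0) \<eta>) \<Longrightarrow>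
               \<forall>R>0. \<exists>c>0. \<forall>K \<xi>. \<bar>\<xi> - \<xi>0\<bar> < R \<longrightarrow> f K \<xi> \<ge> c"
    \<comment> \<open>Assumption A (iv)\<close>
    and A4: "\<exists>C. \<forall>K. (\<forall>x. \<bar>f K x\<bar> \<le> C) \<and> (\<forall>x y. \<bar>f K x - f K y\<bar> \<le> C * \<bar>x - y\<bar>)"
    \<comment> \<open>NSA data: for each K >= 1, Xn K n (n = 0,1,...) are i.i.d. copies of X K
        (Xn K n = X_h^{(n+1)}), and xi0 K is independent of them\<close>
    and Xn_meas: "\<And>K n. Xn K n \<in> borel_measurable M"
    and Xn_iid: "\<And>K. K \<ge> 1 \<Longrightarrow> prob_space.indep_vars M (\<lambda>_. borel) (Xn K) UNIV"
    and Xn_dist: "\<And>K n. K \<ge> 1 \<Longrightarrow> distr M borel (Xn K n) = distr M borel (X K)"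
    and xi0_meas: "\<And>K. xi0 K \<in> borel_measurable M"
    and xi0_indep: "\<And>K. K \<ge> 1 \<Longrightarrow>
          indep_var2 M borel (xi0 K) (\<Pi>\<^sub>M n\<in>UNIV. borel) (\<lambda>\<omega> n. Xn K n \<omega>)"
    \<comment> \<open>Assumption B\<close>
    and B: "(SUP K\<in>{1..}. \<integral>\<^sup>+ \<omega>. ennreal (\<bar>xi0 K \<omega>\<bar>\<^sup>2 *
               exp (4 / (1 - \<alpha>) * max 1 (\<alpha> / (1 - \<alpha>)) *
                    (SUP K'\<in>{1..}. SUP x. \<bar>f K' x\<bar>) * \<bar>xi0 K \<omega>\<bar>)) \<partial>M) < \<infinity>"
    \<comment> \<open>step sizes\<close>
    and gamma1: "\<gamma>1 > 0" and beta: "1/2 < \<beta>" "\<beta> < 1"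
  shows "conv_law
           (\<lambda>K. distr M borel (\<lambda>\<omega>.
              (real K * (nsa_xibar \<alpha> (\<lambda>n. \<gamma>1 * real n powr (-\<beta>)) (xi0 K \<omega>) (\<lambda>n. Xn K n \<omega>) (K\<^sup>2)
                          - xi_star M \<alpha> (X K)),
               real K * (nsa_chi \<alpha> (\<lambda>n. \<gamma>1 * real n powr (-\<beta>)) (xi0 K \<omega>) (\<lambda>n. Xn K n \<omega>) (K\<^sup>2)
                          - chi_star M \<alpha> (X K)))))
           (gauss2
              (\<alpha> * (1 - \<alpha>) / (f 0 (xi_star M \<alpha> (X 0)))\<^sup>2)
              (\<alpha> / (1 - \<alpha>) * (\<integral>\<omega>. max 0 (X 0 \<omega> - xi_star M \<alpha> (X 0)) \<partial>M)
                 / f 0 (xi_star M \<alpha> (X 0)))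
              (prob_space.variance M (\<lambda>\<omega>. max 0 (X 0 \<omega> - xi_star M \<alpha> (X 0))) / (1 - \<alpha>)\<^sup>2))"
proof -
  interpret prob_space M by fact
  note [measurable] = Ymeas Zmeas Zs_meas Xn_meas xi0_meas
  obtain C0 where C0: "\<And>K x. \<bar>f K x\<bar> \<le> C0" "\<And>K x y. \<bar>f K x - f K y\<bar> \<le> C0 * \<bar>x - y\<bar>"
    using A4 by blast
  \<comment> \<open>The maximum with 1 ensures positivity and preserves both bounds.\<close>
  define C where "C = max C0 1"
  have C: "0 < C" "\<And>K x. f K x \<le> C" "\<And>K x y. \<bar>f K x - f K y\<bar> \<le> C * \<bar>x - y\<bar>"
  proof -
    show "0 < C" by (simp add: C_def)
    show "f K x \<le> C" for K x using C0(1)[of K x] by (simp add: C_def)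
    show "\<bar>f K x - f K y\<bar> \<le> C * \<bar>x - y\<bar>" for K x y
      using C0(2)[of K x y] mult_right_mono[of C0 C "\<bar>x - y\<bar>"] by (simp add: C_def)
  qed
  have fm [measurable]: "f K \<in> borel_measurable borel" for K
    by (rule borel_measurable_continuous_onI[OF f_cont])
  have Xm [measurable]: "X K \<in> borel_measurable M" for K
    using distributed_measurable[OF f_pdf[of K]] by simp
  define \<nu> where "\<nu> K = distr M borel (X K)" for K
  have \<nu>_dens: "\<nu> K = density lborel (\<lambda>x. ennreal (f K x))" for K
    unfolding \<nu>_def distributed_distr_eq_density[OF f_pdf[of K], symmetric]
    by (rule distr_cong) auto
  have f_lim: "(\<lambda>K. f K x) \<longlonglongrightarrow> f 0 x" for x
    by (rule tendsto_uniform_limitI[OF f_loc_unif[of x x]]) simp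

  \<comment> \<open>The central limit theorem works with an exponent at most 1, so larger
    integrability is reduced to \<open>p \<le> 3\<close>.\<close>
  define d where "d = min \<delta> 1"
  define p where "p = 2 + d"
  have p: "2 < p" "p \<le> 3" "p \<le> 2 + \<delta>" using delta by (auto simp: p_def d_def)
  have phim: "(\<lambda>(y, z). \<phi> y z) \<in> borel_measurable (borel \<Otimes>\<^sub>M borel)"
    using phi_meas by (simp add: borel_prod)
  have phi_comp: "(\<lambda>\<omega>. \<phi> (Y \<omega>) (U \<omega>)) \<in> borel_measurable M" if "U \<in> borel_measurable M" for U
    using measurable_compose[OF measurable_Pair[OF Ymeas that] phim] by simp
  have phi_p: "integrable M (\<lambda>\<omega>. \<bar>\<phi> (Y \<omega>) (Z \<omega>)\<bar> powr p)"
  proof (rule Bochner_Integration.integrable_bound)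
    show "integrable M (\<lambda>\<omega>. 1 + \<bar>\<phi> (Y \<omega>) (Z \<omega>)\<bar> powr (2 + \<delta>))" using phi_moment by simp
    show "AE \<omega> in M. norm (\<bar>\<phi> (Y \<omega>) (Z \<omega>)\<bar> powr p) \<le> norm (1 + \<bar>\<phi> (Y \<omega>) (Z \<omega>)\<bar> powr (2 + \<delta>))"
      using p powr_ge_of_le[of _ p "2 + \<delta>"] by (intro AE_I2) simp
  qed (use phi_comp[OF Zmeas] in measurable)
  define m0 where "m0 = expectation (\<lambda>\<omega>. \<bar>\<phi> (Y \<omega>) (Z \<omega>)\<bar> powr p)"
  have law: "distr M (borel \<Otimes>\<^sub>M borel) (\<lambda>\<omega>. (Y \<omega>, Zs k \<omega>)) = distr M (borel \<Otimes>\<^sub>M borel) (\<lambda>\<omega>. (Y \<omega>, Z \<omega>))" for k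
  proof -
    have "distr M borel Y \<Otimes>\<^sub>M distr M borel (Zs k) = distr M (borel \<Otimes>\<^sub>M borel) (\<lambda>\<omega>. (Y \<omega>, Zs k \<omega>))"
      using distr_pair_indep_var2[OF Y_Zs_indep, of "\<lambda>x. x k" borel] by simp
    moreover have "distr M borel Y \<Otimes>\<^sub>M distr M borel Z = distr M (borel \<Otimes>\<^sub>M borel) (\<lambda>\<omega>. (Y \<omega>, Z \<omega>))"
      using distr_pair_indep_var2[OF YZ_indep, of "\<lambda>x. x" borel] by simp
    ultimately show ?thesis by (simp add: Zs_dist)
  qed
  have Zs_p: "integrable M (\<lambda>\<omega>. \<bar>\<phi> (Y \<omega>) (Zs k \<omega>)\<bar> powr p)"
    "expectation (\<lambda>\<omega>. \<bar>\<phi> (Y \<omega>) (Zs k \<omega>)\<bar> powr p) = m0" for k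
  proof -
    let ?g = "\<lambda>q. \<bar>case q of (y, z) \<Rightarrow> \<phi> y z\<bar> powr p"
    have gm: "?g \<in> borel_measurable (borel \<Otimes>\<^sub>M borel)" using phim by measurable
    have YZm: "(\<lambda>\<omega>. (Y \<omega>, Z \<omega>)) \<in> measurable M (borel \<Otimes>\<^sub>M borel)"
      "(\<lambda>\<omega>. (Y \<omega>, Zs k \<omega>)) \<in> measurable M (borel \<Otimes>\<^sub>M borel)" by measurable
    show "integrable M (\<lambda>\<omega>. \<bar>\<phi> (Y \<omega>) (Zs k \<omega>)\<bar> powr p)"
      using integrable_distr_eq[OF YZm(1) gm] integrable_distr_eq[OF YZm(2) gm] phi_p by (simp add: law)
    show "expectation (\<lambda>\<omega>. \<bar>\<phi> (Y \<omega>) (Zs k \<omega>)\<bar> powr p) = m0"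
      using integral_distr[OF YZm(1) gm] integral_distr[OF YZm(2) gm] by (simp add: law m0_def)
  qed
  define m where "m = 2 powr p * (1 + m0)"
  have m_nn: "0 \<le> m" unfolding m_def m0_def by (intro mult_nonneg_nonneg add_nonneg_nonneg integral_nonneg_AE) auto
  have mom1: "(\<integral>\<^sup>+x. ennreal (f K x) * ennreal (\<bar>x\<bar> powr p) \<partial>lborel) \<le> ennreal m" if K: "K \<ge> 1" for K
  proof -
    have "(\<integral>\<^sup>+x. ennreal (f K x) * ennreal (\<bar>x\<bar> powr p) \<partial>lborel) = (\<integral>\<^sup>+x. ennreal (\<bar>x\<bar> powr p) \<partial>\<nu> K)"
      unfolding \<nu>_dens by (subst nn_integral_density) auto
    also have "\<dots> = (\<integral>\<^sup>+\<omega>. ennreal (\<bar>X K \<omega>\<bar> powr p) \<partial>M)"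
      unfolding \<nu>_def by (subst nn_integral_distr) auto
    also have "\<dots> = (\<integral>\<^sup>+\<omega>. ennreal (\<bar>(\<Sum>k<K. \<phi> (Y \<omega>) (Zs k \<omega>)) / real K\<bar> powr p) \<partial>M)"
      unfolding XK_def[OF K] Xinner_def ..
    also have "\<dots> \<le> ennreal m"
      unfolding m_def using p Zs_p by (intro average_moment_le[OF phi_comp _ K]) auto
    finally show ?thesis .
  qed
  \<comment> \<open>For \<open>K = 0\<close> the bound is inherited from the approximating
    densities; for \<open>K \<ge> 1\<close> it is Jensen's inequality for the inner average.\<close>
  have mom: "(\<integral>\<^sup>+x. ennreal (\<bar>x\<bar> powr p) \<partial>\<nu> K) \<le> ennreal m" for K
  proof -
    have "(\<integral>\<^sup>+x. ennreal (f K x) * ennreal (\<bar>x\<bar> powr p) \<partial>lborel) \<le> ennreal m"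
      using mom1[of K] lborel_density_moment_Fatou[OF fm f_lim mom1] by (cases "K = 0") auto
    then show ?thesis unfolding \<nu>_dens by (subst nn_integral_density) auto
  qed
  have sets\<nu> [measurable_cong]: "sets (\<nu> K) = sets borel" for K by (simp add: \<nu>_def)
  have m_int: "integrable (\<nu> K) (\<lambda>x. \<bar>x\<bar> powr p)" for K
    using mom[of K] by (intro integrableI_bounded) (auto intro: le_less_trans)
  have m_le: "(\<integral>x. \<bar>x\<bar> powr p \<partial>\<nu> K) \<le> m" for K
  proof -
    have "ennreal (\<integral>x. \<bar>x\<bar> powr p \<partial>\<nu> K) \<le> ennreal m"
      using mom[of K] by (subst nn_integral_eq_integral[OF m_int, symmetric]) auto
    then show ?thesis using m_nn by simp
  qed
  have rd: "real_distribution (\<nu> K)" for K unfolding \<nu>_def by (rule real_distribution_distr) simp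
  have L: "lipschitz_density (\<nu> K) (f K) C \<alpha>" for K
  proof -
    interpret R: real_distribution "\<nu> K" by (rule rd)
    have "integrable (\<nu> K) (\<lambda>x. x)"
    proof (rule Bochner_Integration.integrable_bound)
      show "integrable (\<nu> K) (\<lambda>x. 1 + \<bar>x\<bar> powr p)" using m_int by simp
      have "\<bar>x\<bar> \<le> 1 + \<bar>x\<bar> powr p" for x :: real using powr_ge_of_le[of "\<bar>x\<bar>" 1 p] p by simp
      then show "AE x in \<nu> K. norm x \<le> norm (1 + \<bar>x\<bar> powr p)" by simp
    qed measurable
    then show ?thesis
      unfolding lipschitz_density_def lipschitz_density_axioms_def
      using rd alpha \<nu>_dens fm f_nonneg C by blast
  qed
  interpret L: lipschitz_density "\<nu> K" "f K" C \<alpha> for K by (rule L)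

  have V_eq: "Vfun M \<alpha> (X K) = Vfun (\<nu> K) \<alpha> (\<lambda>x. x)" for K
    unfolding Vfun_def \<nu>_def by (simp add: integral_distr)
  have min_iff: "(\<forall>\<eta>. Vfun M \<alpha> (X K) \<xi> \<le> Vfun M \<alpha> (X K) \<eta>) \<longleftrightarrow> cdf (\<nu> K) \<xi> = \<alpha>" for K \<xi>
    unfolding V_eq by (rule L.V_minimizer_iff)
  obtain z0 where z0: "cdf (\<nu> 0) z0 = \<alpha>" using L.quantile_exists by blast
  have f_loc: "\<exists>c>0. \<forall>K \<xi>. \<bar>\<xi> - z0\<bar> < R \<longrightarrow> f K \<xi> \<ge> c" if "0 < R" for R
    using A3[of z0] min_iff[of 0 z0] z0 that by blast
  \<comment> \<open>The ball of radius \<open>\<bar>a - z0\<bar> + 2\<close> around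
    \<open>z0\<close> contains the unit window around \<open>a\<close>, where
    \<open>cdf_diff_ge\<close> needs a positive lower bound for the density.\<close>
  have uniq: "a = b" if ab: "cdf (\<nu> K) a = \<alpha>" "cdf (\<nu> K) b = \<alpha>" for K a b
  proof -
    obtain c where c: "c > 0" "\<And>K \<xi>. \<bar>\<xi> - z0\<bar> < \<bar>a - z0\<bar> + 2 \<Longrightarrow> f K \<xi> \<ge> c"
      using f_loc[of "\<bar>a - z0\<bar> + 2"] by fastforce
    have "c * min \<bar>b - a\<bar> 1 \<le> \<bar>cdf (\<nu> K) b - cdf (\<nu> K) a\<bar>"
      using c by (intro L.cdf_diff_ge) auto
    then have "min \<bar>b - a\<bar> 1 \<le> 0" using ab c(1) by (simp add: mult_le_0_iff)
    then show ?thesis by (auto simp: min_def split: if_splits)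
  qed
  define xs where "xs K = xi_star M \<alpha> (X K)" for K
  have quantile: "cdf (\<nu> K) (xs K) = \<alpha>" for K
  proof -
    obtain z where z: "cdf (\<nu> K) z = \<alpha>" using L.quantile_exists by blast
    have "xs K = z" unfolding xs_def xi_star_def min_iff using z uniq by (intro the_equality) auto
    with z show ?thesis by simp
  qed
  have xs0: "xs 0 = z0" using uniq[OF quantile z0] .

  obtain c where c: "c > 0" "\<And>K \<xi>. \<bar>\<xi> - z0\<bar> < 2 \<Longrightarrow> f K \<xi> \<ge> c" using f_loc[of 2] by auto
  obtain v w where vw: "\<And>K \<xi>. K \<ge> 1 \<Longrightarrow> cdf (\<nu> K) \<xi> - cdf (\<nu> 0) \<xi> = v \<xi> * (1 / real K) + w \<xi> K * (1 / real K)"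
    and w0: "(\<lambda>K. w z0 K) \<longlonglongrightarrow> 0"
    using A1 min_iff[of 0 z0] z0 unfolding \<nu>_def by blast
  \<comment> \<open>Assumption A (i) at the limit quantile shows that the cdf bias there vanishes
    with \<open>1 / K\<close>, which forces the quantiles to converge.\<close>
  have cdf_z0: "(\<lambda>K. cdf (\<nu> K) z0) \<longlonglongrightarrow> \<alpha>"
  proof -
    have "(\<lambda>K. \<alpha> + (v z0 * (1 / real K) + w z0 K * (1 / real K))) \<longlonglongrightarrow> \<alpha> + (v z0 * 0 + 0 * 0)"
      by (intro tendsto_intros w0 lim_const_over_n)
    moreover have "\<forall>\<^sub>F K in sequentially. \<alpha> + (v z0 * (1 / real K) + w z0 K * (1 / real K)) = cdf (\<nu> K) z0"
      using eventually_ge_at_top[of 1] by eventually_elim (use vw[of _ z0] z0 in force)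
    ultimately show ?thesis by (auto intro: Lim_transform_eventually)
  qed
  have xs_lim: "xs \<longlonglongrightarrow> xs 0"
  proof -
    \<comment> \<open>The density bound controls the distance only up to saturation. Once the
      minimum is below 1 it equals the distance.\<close>
    have mn: "(\<lambda>K. min \<bar>xs K - z0\<bar> 1) \<longlonglongrightarrow> 0"
    proof (rule Lim_null_comparison)
      show "\<forall>\<^sub>F K in sequentially. norm (min \<bar>xs K - z0\<bar> 1) \<le> \<bar>\<alpha> - cdf (\<nu> K) z0\<bar> / c"
      proof (intro always_eventually allI)
        fix K
        have "c * min \<bar>xs K - z0\<bar> 1 \<le> \<bar>cdf (\<nu> K) (xs K) - cdf (\<nu> K) z0\<bar>"
          using c by (intro L.cdf_diff_ge) auto
        then show "norm (min \<bar>xs K - z0\<bar> 1) \<le> \<bar>\<alpha> - cdf (\<nu> K) z0\<bar> / c"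
          using c(1) by (simp add: quantile pos_le_divide_eq mult.commute)
      qed
      have "(\<lambda>K. \<bar>\<alpha> - cdf (\<nu> K) z0\<bar> / c) \<longlonglongrightarrow> \<bar>\<alpha> - \<alpha>\<bar> / c" using c(1) by (intro tendsto_intros cdf_z0) auto
      then show "(\<lambda>K. \<bar>\<alpha> - cdf (\<nu> K) z0\<bar> / c) \<longlonglongrightarrow> 0" by simp
    qed
    have "(\<lambda>K. \<bar>xs K - z0\<bar>) \<longlonglongrightarrow> 0"
    proof (rule Lim_transform_eventually[OF mn])
      show "\<forall>\<^sub>F K in sequentially. min \<bar>xs K - z0\<bar> 1 = \<bar>xs K - z0\<bar>"
        using order_tendstoD(2)[OF mn zero_less_one] by eventually_elim (auto simp: min_def split: if_splits)
    qed
    then show ?thesis unfolding xs0 by (simp add: LIM_zero_iff tendsto_rabs_zero_iff)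
  qed
  obtain B0 where B0: "0 < B0" "\<And>K. \<bar>xs K\<bar> \<le> B0"
    using xs_lim[THEN convergentI[THEN convergent_imp_Bseq]] by (auto simp: Bseq_def)
  obtain c0 where c0: "c0 > 0" "\<And>K x. \<bar>x - xs K\<bar> \<le> 1 \<Longrightarrow> c0 \<le> f K x"
  proof -
    \<comment> \<open>\<open>B0\<close> bounds all quantiles, so their unit windows lie in one ball
      around \<open>z0\<close> and share a lower bound for the densities.\<close>
    obtain c0 where c0: "c0 > 0" "\<And>K \<xi>. \<bar>\<xi> - z0\<bar> < B0 + \<bar>z0\<bar> + 2 \<Longrightarrow> f K \<xi> \<ge> c0"
      using f_loc[of "B0 + \<bar>z0\<bar> + 2"] B0(1) by fastforce
    have "c0 \<le> f K x" if "\<bar>x - xs K\<bar> \<le> 1" for K x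
      using that B0(2)[of K] by (intro c0(2)) linarith
    with c0(1) show thesis using that by blast
  qed
  interpret F: density_family \<nu> f C \<alpha> p m xs c0
    unfolding density_family_def using L f_lim p m_int m_le quantile xs_lim c0 by blast

  define Sf where "Sf = (SUP K'\<in>{1..}. SUP x. \<bar>f K' x\<bar>)"
  have Sf: "0 < Sf"
  proof -
    have fC: "\<bar>f K x\<bar> \<le> C" for K x using C(2) f_nonneg by simp
    have "0 < f 1 (xs 1)" by (rule F.f_star_pos)
    also have "\<dots> \<le> \<bar>f 1 (xs 1)\<bar>" by (rule abs_ge_self)
    also have "\<dots> \<le> (SUP x. \<bar>f 1 x\<bar>)"
      by (rule cSUP_upper) (auto intro!: bdd_aboveI2[where M=C] fC)
    also have "\<dots> \<le> Sf"
      unfolding Sf_def by (rule cSUP_upper) (auto intro!: bdd_aboveI2[where M=C] cSUP_least fC)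
    finally show ?thesis .
  qed
  \<comment> \<open>The exponent of Assumption B is taken as the rate of the Lyapunov function, so
    that the assumption bounds its initial expectation. Positivity of \<open>Sf\<close> makes the
    rate positive.\<close>
  define lam where "lam = 4 / (1 - \<alpha>) * max 1 (\<alpha> / (1 - \<alpha>)) * Sf"
  have lam: "0 < lam" using alpha Sf by (auto simp: lam_def intro!: mult_pos_pos)
  obtain Bb where Bb: "0 \<le> Bb" "\<And>K. K \<ge> 1 \<Longrightarrow> (\<integral>\<^sup>+\<omega>. ennreal (\<bar>xi0 K \<omega>\<bar>\<^sup>2 * exp (lam * \<bar>xi0 K \<omega>\<bar>)) \<partial>M) \<le> ennreal Bb"
  proof -
    let ?S = "SUP K\<in>{1..}. \<integral>\<^sup>+\<omega>. ennreal (\<bar>xi0 K \<omega>\<bar>\<^sup>2 * exp (lam * \<bar>xi0 K \<omega>\<bar>)) \<partial>M"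
    have "?S < \<infinity>" using B unfolding lam_def Sf_def by simp
    moreover have "\<exists>b. 0 \<le> b \<and> x = ennreal b" if "x < \<infinity>" for x :: ennreal
      using that by (cases x) auto
    ultimately obtain b where b: "0 \<le> b" "?S = ennreal b" by blast
    have "(\<integral>\<^sup>+\<omega>. ennreal (\<bar>xi0 K \<omega>\<bar>\<^sup>2 * exp (lam * \<bar>xi0 K \<omega>\<bar>)) \<partial>M) \<le> ennreal b" if "K \<ge> 1" for K
      unfolding b(2)[symmetric] using that by (intro SUP_upper) auto
    with b(1) show thesis using that by blast
  qed
  have exp_int: "integrable M (\<lambda>\<omega>. exp (lam * \<bar>xi0 K \<omega>\<bar>))"
    and exp_le: "expectation (\<lambda>\<omega>. exp (lam * \<bar>xi0 K \<omega>\<bar>)) \<le> exp lam + Bb" if K: "K \<ge> 1" for K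
  proof -
    have "(\<integral>\<^sup>+\<omega>. ennreal (exp (lam * \<bar>xi0 K \<omega>\<bar>)) \<partial>M)
        \<le> (\<integral>\<^sup>+\<omega>. ennreal (exp lam) + ennreal (\<bar>xi0 K \<omega>\<bar>\<^sup>2 * exp (lam * \<bar>xi0 K \<omega>\<bar>)) \<partial>M)"
      using exp_abs_le_square[of lam] lam
      by (intro nn_integral_mono) (simp flip: ennreal_plus)
    also have "\<dots> = ennreal (exp lam) + (\<integral>\<^sup>+\<omega>. ennreal (\<bar>xi0 K \<omega>\<bar>\<^sup>2 * exp (lam * \<bar>xi0 K \<omega>\<bar>)) \<partial>M)"
      by (subst nn_integral_add) (auto simp: emeasure_space_1)
    also have "\<dots> \<le> ennreal (exp lam) + ennreal Bb" by (intro add_left_mono Bb(2) K)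
    also have "\<dots> = ennreal (exp lam + Bb)" using Bb(1) by (simp add: ennreal_plus)
    finally have le: "(\<integral>\<^sup>+\<omega>. ennreal (exp (lam * \<bar>xi0 K \<omega>\<bar>)) \<partial>M) \<le> ennreal (exp lam + Bb)" .
    show i: "integrable M (\<lambda>\<omega>. exp (lam * \<bar>xi0 K \<omega>\<bar>))"
      using le by (intro integrableI_bounded) (auto intro: le_less_trans)
    have "ennreal (expectation (\<lambda>\<omega>. exp (lam * \<bar>xi0 K \<omega>\<bar>))) \<le> ennreal (exp lam + Bb)"
      using le by (subst nn_integral_eq_integral[OF i, symmetric]) auto
    then show "expectation (\<lambda>\<omega>. exp (lam * \<bar>xi0 K \<omega>\<bar>)) \<le> exp lam + Bb"
      using Bb(1) by (subst (asm) ennreal_le_iff) (auto intro: add_nonneg_nonneg)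
  qed

  have scheme: "nsa_scheme M (xi0 K) (Xn K) (\<nu> K) (f K) C \<alpha> \<gamma>1 \<beta> (xs K) c0" if K: "K \<ge> 1" for K
  proof -
    have "iid_chain M (xi0 K) (Xn K) (\<nu> K)"
      using indep_vars_case_nat[OF Xn_iid[OF K] xi0_indep[OF K]] Xn_dist[OF K]
      by unfold_locales (auto simp: \<nu>_def)
    then show ?thesis
      unfolding nsa_scheme_def nsa_scheme_axioms_def using L gamma1 beta quantile c0 by blast
  qed
  define ck where "ck = lam * (c0 / (1 - \<alpha>) * min 1 (1 / lam))"
  define Qk where "Qk = exp (lam * \<gamma>1 / (1 - \<alpha>)) * (lam / (1 - \<alpha>))\<^sup>2"
  \<comment> \<open>The first factor pays for measuring the initial value from the quantile instead
    of from 0; the second bounds its exponential moment.\<close>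
  define L0 where "L0 = exp (lam * B0) * (exp lam + Bb)"
  have "0 < ck" "0 \<le> Qk" using lam c0(1) alpha by (auto simp: ck_def Qk_def)
  then obtain A where A: "0 < A" "\<And>L :: nat \<Rightarrow> real. (\<forall>n. 0 \<le> L n) \<Longrightarrow> L 0 \<le> L0 \<Longrightarrow>
     (\<forall>n. L (Suc n) \<le> (1 - ck * (\<gamma>1 * real (Suc n) powr (-\<beta>)) + Qk * (\<gamma>1 * real (Suc n) powr (-\<beta>))\<^sup>2) * L n
        + Qk * (\<gamma>1 * real (Suc n) powr (-\<beta>))\<^sup>2) \<Longrightarrow>
     (\<forall>n. L n \<le> A * real (Suc n) powr (-\<beta>))"
    using stochastic_approximation_recursion[of ck Qk \<gamma>1 \<beta> L0] gamma1 beta by fastforce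
  \<comment> \<open>The factor \<open>2 / lam\<^sup>2\<close> translates \<open>cosh - 1\<close>
    back to squares by \<open>cosh_minus_one_ge\<close>; \<open>A\<close> was obtained before
    \<open>K\<close>, so the constant is common to all schemes.\<close>
  have scheme_L2: "nsa_scheme_L2 M (xi0 K) (Xn K) (\<nu> K) (f K) C \<alpha> \<gamma>1 \<beta> (xs K) c0 (2 / lam\<^sup>2 * A)" if K: "K \<ge> 1" for K
  proof -
    interpret N: nsa_scheme M "xi0 K" "Xn K" "\<nu> K" "f K" C \<alpha> \<gamma>1 \<beta> "xs K" c0 by (rule scheme[OF K])
    have D0: "N.D 0 \<omega> = xi0 K \<omega> - xs K" for \<omega> by (simp add: N.D_def N.\<xi>_def)
    have c_le: "cosh (lam * N.D 0 \<omega>) \<le> exp (lam * B0) * exp (lam * \<bar>xi0 K \<omega>\<bar>)" for \<omega>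
      unfolding D0 using lam B0(2) by (intro cosh_le_exp_abs) auto
    have int0: "integrable M (\<lambda>\<omega>. cosh (lam * N.D 0 \<omega>))"
    proof (rule Bochner_Integration.integrable_bound)
      show "integrable M (\<lambda>\<omega>. exp (lam * B0) * exp (lam * \<bar>xi0 K \<omega>\<bar>))" using exp_int[OF K] by simp
      show "AE \<omega> in M. norm (cosh (lam * N.D 0 \<omega>)) \<le> norm (exp (lam * B0) * exp (lam * \<bar>xi0 K \<omega>\<bar>))"
        using c_le by (intro AE_I2) simp
    qed measurable
    note ci = N.integrable_cosh[OF int0]
    define Ly where "Ly n = expectation (\<lambda>\<omega>. cosh (lam * N.D n \<omega>) - 1)" for n
    have Ly_le: "Ly n \<le> A * real (Suc n) powr (-\<beta>)" for n
    proof -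
      have "0 \<le> Ly n" for n
        unfolding Ly_def using cosh_real_ge_1 by (intro integral_nonneg_AE) auto
      moreover have "Ly 0 \<le> L0"
      proof -
        have "Ly 0 \<le> expectation (\<lambda>\<omega>. exp (lam * B0) * exp (lam * \<bar>xi0 K \<omega>\<bar>))"
          unfolding Ly_def
        proof (rule integral_mono)
          show "cosh (lam * N.D 0 \<omega>) - 1 \<le> exp (lam * B0) * exp (lam * \<bar>xi0 K \<omega>\<bar>)" for \<omega>
            using c_le[of \<omega>] by linarith
        qed (use int0 exp_int[OF K] in auto)
        also have "\<dots> \<le> L0" unfolding L0_def using exp_le[OF K] by simp
        finally show ?thesis .
      qed
      moreover have "\<forall>n. Ly (Suc n) \<le> (1 - ck * (\<gamma>1 * real (Suc n) powr (-\<beta>)) + Qk * (\<gamma>1 * real (Suc n) powr (-\<beta>))\<^sup>2) * Ly n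
        + Qk * (\<gamma>1 * real (Suc n) powr (-\<beta>))\<^sup>2"
        using N.Lyapunov_recursion[OF lam int0] unfolding Ly_def ck_def Qk_def by blast
      ultimately show ?thesis using A(2)[of Ly] by blast
    qed
    have D2: "(N.D n \<omega>)\<^sup>2 \<le> 2 / lam\<^sup>2 * (cosh (lam * N.D n \<omega>) - 1)" for n \<omega>
    proof -
      have "(lam * N.D n \<omega>)\<^sup>2 / 2 \<le> cosh (lam * N.D n \<omega>) - 1" by (rule cosh_minus_one_ge)
      then have "2 / lam\<^sup>2 * ((lam * N.D n \<omega>)\<^sup>2 / 2) \<le> 2 / lam\<^sup>2 * (cosh (lam * N.D n \<omega>) - 1)"
        by (intro mult_left_mono) auto
      then show ?thesis using lam by (simp add: power_mult_distrib)
    qed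
    have Bi: "integrable M (\<lambda>\<omega>. 2 / lam\<^sup>2 * (cosh (lam * N.D n \<omega>) - 1))" for n using ci by simp
    have D2i: "integrable M (\<lambda>\<omega>. (N.D n \<omega>)\<^sup>2)" for n
    proof (rule Bochner_Integration.integrable_bound[OF Bi[of n]])
      show "AE \<omega> in M. norm ((N.D n \<omega>)\<^sup>2) \<le> norm (2 / lam\<^sup>2 * (cosh (lam * N.D n \<omega>) - 1))"
      proof (intro AE_I2)
        fix \<omega>
        have "\<bar>(N.D n \<omega>)\<^sup>2\<bar> \<le> 2 / lam\<^sup>2 * (cosh (lam * N.D n \<omega>) - 1)" using D2[of n \<omega>] by simp
        also have "\<dots> \<le> \<bar>2 / lam\<^sup>2 * (cosh (lam * N.D n \<omega>) - 1)\<bar>" by (rule abs_ge_self)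
        finally show "norm ((N.D n \<omega>)\<^sup>2) \<le> norm (2 / lam\<^sup>2 * (cosh (lam * N.D n \<omega>) - 1))"
          unfolding real_norm_def .
      qed
    qed measurable
    show ?thesis
    proof
      show "integrable M (\<lambda>\<omega>. (N.D n \<omega>)\<^sup>2)" for n by (rule D2i)
      show "expectation (\<lambda>\<omega>. (N.D n \<omega>)\<^sup>2) \<le> 2 / lam\<^sup>2 * A * real (Suc n) powr (- \<beta>)" for n
      proof -
        have "expectation (\<lambda>\<omega>. (N.D n \<omega>)\<^sup>2) \<le> expectation (\<lambda>\<omega>. 2 / lam\<^sup>2 * (cosh (lam * N.D n \<omega>) - 1))"
          by (intro integral_mono D2i Bi D2)
        also have "\<dots> = 2 / lam\<^sup>2 * Ly n" unfolding Ly_def by (rule integral_mult_right_zero)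
        also have "\<dots> \<le> 2 / lam\<^sup>2 * (A * real (Suc n) powr (-\<beta>))" by (intro mult_left_mono Ly_le) auto
        finally show ?thesis by (simp add: mult.assoc)
      qed
    qed
  qed

  have chi: "chi_star M \<alpha> (X K) = Vfun (\<nu> K) \<alpha> (\<lambda>x. x) (xs K)" for K
    by (simp add: chi_star_def V_eq xs_def)
  have me: "(\<integral>\<omega>. max 0 (X 0 \<omega> - xs 0) \<partial>M) = F.mean_excess 0"
    unfolding F.mean_excess_def \<nu>_def by (simp add: integral_distr)
  have var: "variance (\<lambda>\<omega>. max 0 (X 0 \<omega> - xs 0)) = prob_space.variance (\<nu> 0) (\<lambda>x. max 0 (x - xs 0))"
    unfolding \<nu>_def by (simp add: integral_distr)
  show ?thesis
    using F.nsa_conv_law[OF P xi0_meas Xn_meas Xn_iid scheme_L2]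
    unfolding F.S11_def F.S12_def F.S22_def me[symmetric] var[symmetric] chi[symmetric]
    unfolding xs_def by blast
qed

end
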